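(* Let $d\ge 1$ and $0\le m\le d^2$ be integers, and let $r_d^{(m)}(q)=\left[{d^2\atop m}\right]_q-s_d^{(m)}(q)$. Then $$\deg r_d^{(m)}(q)\leq m(d^2-m)-(m-1)(d-1).$$
   Context: The polynomial $s_d^{(m)}(q)\in\mathbb{Z}[q]$ is the unique polynomial such that, for every finite field $k$, $s_d^{(m)}(|k|)$ is the number of $m$-dimensional $k$-subspaces of the matrix algebra $M_d(k)$ which generate $M_d(k)$ as a unital $k$-algebra (such polynomials exist). The Gaussian binomial coefficient is $$\left[{a\atop b}\right]_q=\frac{(q^a-1)\cdots(q^{a-b+1}-1)}{(q^b-1)\cdots(q-1)}.$$ The degree of the zero polynomial is understood as $-\infty$. *)

theory Defs
  imports
    "HOL-Algebra.Algebra"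
    "HOL-Computational_Algebra.Polynomial"
    "HOL-Number_Theory.Number_Theory"
    "Jordan_Normal_Form.Missing_VectorSpace"
begin

text \<open>Matrices over a carrier-based field are extensional functions on the index set, so that
  equality of matrices is equality of functions.\<close>

definition mat_algebra :: "('a, 'b) ring_scheme \<Rightarrow> nat \<Rightarrow> ('a, nat \<times> nat \<Rightarrow> 'a) module" where
  "mat_algebra F d =
    \<lparr> carrier = ({..<d} \<times> {..<d}) \<rightarrow>\<^sub>E carrier F,
      monoid.mult = (\<lambda>A B. \<lambda>(i, j) \<in> {..<d} \<times> {..<d}. \<Oplus>\<^bsub>F\<^esub> l \<in> {..<d}. A (i, l) \<otimes>\<^bsub>F\<^esub> B (l, j)),
      monoid.one = (\<lambda>(i, j) \<in> {..<d} \<times> {..<d}. if i = j then \<one>\<^bsub>F\<^esub> else \<zero>\<^bsub>F\<^esub>),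
      ring.zero = (\<lambda>(i, j) \<in> {..<d} \<times> {..<d}. \<zero>\<^bsub>F\<^esub>),
      ring.add = (\<lambda>A B. \<lambda>(i, j) \<in> {..<d} \<times> {..<d}. A (i, j) \<oplus>\<^bsub>F\<^esub> B (i, j)),
      module.smult = (\<lambda>c A. \<lambda>(i, j) \<in> {..<d} \<times> {..<d}. c \<otimes>\<^bsub>F\<^esub> A (i, j)) \<rparr>"

text \<open>A \<^const>\<open>subring\<close> contains \<open>\<one>\<close>, so these are the unital subalgebras.\<close>

definition unital_subalgebra ::
    "('a, 'b) ring_scheme \<Rightarrow> 'c set \<Rightarrow> ('a, 'c, 'd) module_scheme \<Rightarrow> bool" where
  "unital_subalgebra K A M \<longleftrightarrow>
     subring A M \<and> (\<forall>c \<in> carrier K. \<forall>a \<in> A. c \<odot>\<^bsub>M\<^esub> a \<in> A)"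

definition generated_subalgebra ::
    "('a, 'b) ring_scheme \<Rightarrow> ('a, 'c, 'd) module_scheme \<Rightarrow> 'c set \<Rightarrow> 'c set" where
  "generated_subalgebra K M V = \<Inter> {A. unital_subalgebra K A M \<and> V \<subseteq> A}"

definition generating_subspaces ::
    "('a, 'b) ring_scheme \<Rightarrow> nat \<Rightarrow> nat \<Rightarrow> (nat \<times> nat \<Rightarrow> 'a) set set" where
  "generating_subspaces F d m =
     {V. subspace F V (mat_algebra F d)
       \<and> vectorspace.dim F (mat_algebra F d \<lparr> carrier := V \<rparr>) = m
       \<and> generated_subalgebra F (mat_algebra F d) V = carrier (mat_algebra F d)}"

text \<open>The defining property of \<open>s\<^sub>d\<^sup>(\<^sup>m\<^sup>)\<close>. HOL cannot quantify over all types, but every finite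
  field is isomorphic to one whose carrier is a set of natural numbers, so the quantification
  over \<^typ>\<open>nat ring\<close> covers all finite fields. The lemma \<open>is_s_poly_unique\<close> below shows that
  the property determines the polynomial.\<close>

definition is_s_poly :: "nat \<Rightarrow> nat \<Rightarrow> int poly \<Rightarrow> bool" where
  "is_s_poly d m s \<longleftrightarrow>
     (\<forall>F :: nat ring. field F \<and> finite (carrier F) \<longrightarrow>
        poly s (int (card (carrier F))) = int (card (generating_subspaces F d m)))"

text \<open>The quotient is taken in \<open>\<int>[q]\<close>; for \<open>b \<le> a\<close> it is exact, see \<open>gauss_binom_mult_denom\<close>
  below.\<close>

definition gauss_binom :: "nat \<Rightarrow> nat \<Rightarrow> int poly" where
  "gauss_binom a b =
     (\<Prod>i<b. monom 1 (a - i) - 1) div (\<Prod>i<b. monom 1 (b - i) - 1)"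


subsection \<open>Well-definedness of the Gaussian binomial coefficients\<close>

lemma gauss_denom_nonzero: "(\<Prod>i<b. monom (1::int) (b - i) - 1) \<noteq> 0"
proof -
  have "monom (1::int) (b - i) - 1 \<noteq> 0" if "i < b" for i
  proof
    assume "monom (1::int) (b - i) - 1 = 0"
    then have "coeff (monom (1::int) (b - i) - 1) 0 = 0" by simp
    with that show False by simp
  qed
  then show ?thesis by simp
qed

lemma gauss_denom_dvd_numer:
  "b \<le> a \<Longrightarrow> (\<Prod>i<b. monom (1::int) (b - i) - 1) dvd (\<Prod>i<b. monom 1 (a - i) - 1)"
proof (induction a arbitrary: b)
  case 0
  then show ?case by simp
next
  case (Suc a)
  let ?f = "\<lambda>n. monom (1::int) n - 1"
  show ?case
  proof (cases b)
    case 0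
    then show ?thesis by simp
  next
    case (Suc c)
    have top: "(\<Prod>i<Suc c. ?f (Suc a - i)) = ?f (Suc a) * (\<Prod>i<c. ?f (a - i))"
      by (subst prod.lessThan_Suc_shift) simp
    have den: "(\<Prod>i<Suc c. ?f (Suc c - i)) = ?f (Suc c) * (\<Prod>i<c. ?f (c - i))"
      by (subst prod.lessThan_Suc_shift) simp
    show ?thesis
    proof (cases "c = a")
      case True
      then show ?thesis using Suc by simp
    next
      case False
      then have le: "Suc c \<le> a" "c \<le> a" using Suc Suc.prems by auto
      have split: "?f (Suc a) = ?f (Suc c) + monom 1 (Suc c) * ?f (a - c)"
        using le by (simp add: algebra_simps mult_monom)
      have last: "(\<Prod>i<Suc c. ?f (a - i)) = (\<Prod>i<c. ?f (a - i)) * ?f (a - c)"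
        by simp
      have "(\<Prod>i<Suc c. ?f (Suc a - i)) =
          ?f (Suc c) * (\<Prod>i<c. ?f (a - i)) + monom 1 (Suc c) * (\<Prod>i<Suc c. ?f (a - i))"
        unfolding top split last by (simp only: algebra_simps)
      moreover have "(\<Prod>i<Suc c. ?f (Suc c - i)) dvd ?f (Suc c) * (\<Prod>i<c. ?f (a - i))"
        unfolding den by (intro mult_dvd_mono dvd_refl Suc.IH le)
      moreover have "(\<Prod>i<Suc c. ?f (Suc c - i)) dvd (\<Prod>i<Suc c. ?f (a - i))"
        by (intro Suc.IH le)
      ultimately show ?thesis unfolding \<open>b = Suc c\<close> by (metis dvd_add dvd_mult)
    qed
  qed
qed

lemma gauss_binom_mult_denom:
  assumes "b \<le> a"
  shows "gauss_binom a b * (\<Prod>i<b. monom 1 (b - i) - 1) = (\<Prod>i<b. monom 1 (a - i) - 1)"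
  unfolding gauss_binom_def using gauss_denom_dvd_numer[OF assms] by simp


subsection \<open>The matrix algebra\<close>

lemma mat_algebra_simps:
  "carrier (mat_algebra F d) = ({..<d} \<times> {..<d}) \<rightarrow>\<^sub>E carrier F"
  "A \<otimes>\<^bsub>mat_algebra F d\<^esub> B =
     (\<lambda>(i, j) \<in> {..<d} \<times> {..<d}. \<Oplus>\<^bsub>F\<^esub> l \<in> {..<d}. A (i, l) \<otimes>\<^bsub>F\<^esub> B (l, j))"
  "\<one>\<^bsub>mat_algebra F d\<^esub> = (\<lambda>(i, j) \<in> {..<d} \<times> {..<d}. if i = j then \<one>\<^bsub>F\<^esub> else \<zero>\<^bsub>F\<^esub>)"
  "\<zero>\<^bsub>mat_algebra F d\<^esub> = (\<lambda>(i, j) \<in> {..<d} \<times> {..<d}. \<zero>\<^bsub>F\<^esub>)"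
  "A \<oplus>\<^bsub>mat_algebra F d\<^esub> B = (\<lambda>(i, j) \<in> {..<d} \<times> {..<d}. A (i, j) \<oplus>\<^bsub>F\<^esub> B (i, j))"
  "c \<odot>\<^bsub>mat_algebra F d\<^esub> A = (\<lambda>(i, j) \<in> {..<d} \<times> {..<d}. c \<otimes>\<^bsub>F\<^esub> A (i, j))"
  by (simp_all add: mat_algebra_def)

lemma mat_algebra_eqI:
  assumes "A \<in> carrier (mat_algebra F d)" "B \<in> carrier (mat_algebra F d)"
    and "\<And>i j. i < d \<Longrightarrow> j < d \<Longrightarrow> A (i, j) = B (i, j)"
  shows "A = B"
  by (rule PiE_ext[OF assms(1,2)[unfolded mat_algebra_simps]]) (use assms(3) in auto)

lemma mat_algebra_entry:
  assumes "A \<in> carrier (mat_algebra F d)" "i < d" "j < d"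
  shows "A (i, j) \<in> carrier F"
  using assms by (auto simp: mat_algebra_simps)

lemma mat_algebra_abelian_group:
  assumes "field F"
  shows "abelian_group (mat_algebra F d)"
proof -
  interpret F: field F by fact
  show ?thesis
  proof (rule abelian_groupI)
    fix A assume A: "A \<in> carrier (mat_algebra F d)"
    let ?B = "\<lambda>(i, j) \<in> {..<d} \<times> {..<d}. \<ominus>\<^bsub>F\<^esub> A (i, j)"
    have "?B \<in> carrier (mat_algebra F d)"
      using A by (auto simp: mat_algebra_simps)
    moreover have "?B \<oplus>\<^bsub>mat_algebra F d\<^esub> A = \<zero>\<^bsub>mat_algebra F d\<^esub>"
      using mat_algebra_entry[OF A] by (auto simp: mat_algebra_simps F.l_neg fun_eq_iff)
    ultimately show "\<exists>B \<in> carrier (mat_algebra F d).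
        B \<oplus>\<^bsub>mat_algebra F d\<^esub> A = \<zero>\<^bsub>mat_algebra F d\<^esub>" by blast
  next
    fix A B C
    assume ABC: "A \<in> carrier (mat_algebra F d)" "B \<in> carrier (mat_algebra F d)"
      "C \<in> carrier (mat_algebra F d)"
    show "A \<oplus>\<^bsub>mat_algebra F d\<^esub> B \<oplus>\<^bsub>mat_algebra F d\<^esub> C =
        A \<oplus>\<^bsub>mat_algebra F d\<^esub> (B \<oplus>\<^bsub>mat_algebra F d\<^esub> C)"
      using ABC[THEN mat_algebra_entry] by (auto simp: mat_algebra_simps F.a_assoc fun_eq_iff)
  next
    fix A B
    assume AB: "A \<in> carrier (mat_algebra F d)" "B \<in> carrier (mat_algebra F d)"
    show "A \<oplus>\<^bsub>mat_algebra F d\<^esub> B \<in> carrier (mat_algebra F d)"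
      using AB[THEN mat_algebra_entry] by (auto simp: mat_algebra_simps)
    show "A \<oplus>\<^bsub>mat_algebra F d\<^esub> B = B \<oplus>\<^bsub>mat_algebra F d\<^esub> A"
      using AB[THEN mat_algebra_entry] by (auto simp: mat_algebra_simps F.a_comm fun_eq_iff)
  next
    show "\<zero>\<^bsub>mat_algebra F d\<^esub> \<in> carrier (mat_algebra F d)"
      by (auto simp: mat_algebra_simps)
  next
    fix A assume A: "A \<in> carrier (mat_algebra F d)"
    show "\<zero>\<^bsub>mat_algebra F d\<^esub> \<oplus>\<^bsub>mat_algebra F d\<^esub> A = A"
    proof (rule mat_algebra_eqI[of _ F d])
      show "\<zero>\<^bsub>mat_algebra F d\<^esub> \<oplus>\<^bsub>mat_algebra F d\<^esub> A \<in> carrier (mat_algebra F d)"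
        using mat_algebra_entry[OF A] by (auto simp: mat_algebra_simps)
    qed (use A mat_algebra_entry[OF A] in \<open>auto simp: mat_algebra_simps\<close>)
  qed
qed

lemma mat_algebra_vectorspace:
  assumes "field F"
  shows "vectorspace F (mat_algebra F d)"
proof -
  interpret F: field F by fact
  have "module F (mat_algebra F d)"
  proof (rule moduleI[OF F.is_cring mat_algebra_abelian_group[OF assms]])
    fix A assume A: "A \<in> carrier (mat_algebra F d)"
    note entry = mat_algebra_entry[OF A]
    show "a \<odot>\<^bsub>mat_algebra F d\<^esub> A \<in> carrier (mat_algebra F d)" if "a \<in> carrier F" for a
      using entry that by (auto simp: mat_algebra_simps)
    show "(a \<oplus>\<^bsub>F\<^esub> b) \<odot>\<^bsub>mat_algebra F d\<^esub> A =
        a \<odot>\<^bsub>mat_algebra F d\<^esub> A \<oplus>\<^bsub>mat_algebra F d\<^esub> b \<odot>\<^bsub>mat_algebra F d\<^esub> A"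
      if "a \<in> carrier F" "b \<in> carrier F" for a b
      using entry that by (auto simp: mat_algebra_simps F.l_distr fun_eq_iff)
    show "(a \<otimes>\<^bsub>F\<^esub> b) \<odot>\<^bsub>mat_algebra F d\<^esub> A =
        a \<odot>\<^bsub>mat_algebra F d\<^esub> (b \<odot>\<^bsub>mat_algebra F d\<^esub> A)"
      if "a \<in> carrier F" "b \<in> carrier F" for a b
      using entry that by (auto simp: mat_algebra_simps F.m_assoc fun_eq_iff)
    show "a \<odot>\<^bsub>mat_algebra F d\<^esub> (A \<oplus>\<^bsub>mat_algebra F d\<^esub> B) =
        a \<odot>\<^bsub>mat_algebra F d\<^esub> A \<oplus>\<^bsub>mat_algebra F d\<^esub> a \<odot>\<^bsub>mat_algebra F d\<^esub> B"
      if "a \<in> carrier F" and B: "B \<in> carrier (mat_algebra F d)" for a B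
      using entry mat_algebra_entry[OF B] that(1)
      by (auto simp: mat_algebra_simps F.r_distr fun_eq_iff)
    have "\<one>\<^bsub>F\<^esub> \<odot>\<^bsub>mat_algebra F d\<^esub> A \<in> carrier (mat_algebra F d)"
      using entry by (auto simp: mat_algebra_simps)
    then show "\<one>\<^bsub>F\<^esub> \<odot>\<^bsub>mat_algebra F d\<^esub> A = A"
      using A by (rule mat_algebra_eqI) (use entry in \<open>auto simp: mat_algebra_simps\<close>)
  qed
  then show ?thesis by (simp add: vectorspace_def F.field_axioms)
qed

lemma finsum_swap:
  fixes f :: "'i \<Rightarrow> 'j \<Rightarrow> 'a" and F (structure)
  assumes "abelian_monoid F" "finite I" "finite J" "\<And>i j. i \<in> I \<Longrightarrow> j \<in> J \<Longrightarrow> f i j \<in> carrier F"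
  shows "(\<Oplus>i\<in>I. \<Oplus>j\<in>J. f i j) = (\<Oplus>j\<in>J. \<Oplus>i\<in>I. f i j)"
proof -
  interpret abelian_monoid F by fact
  from assms(2,4) show ?thesis
  proof (induction I rule: finite_induct)
    case empty
    then show ?case by (simp add: finsum_zero)
  next
    case (insert x I)
    have "(\<Oplus>j\<in>J. \<Oplus>i\<in>insert x I. f i j) = (\<Oplus>j\<in>J. f x j \<oplus> (\<Oplus>i\<in>I. f i j))"
      using insert by (intro finsum_cong') (auto intro!: finsum_insert)
    also have "\<dots> = (\<Oplus>j\<in>J. f x j) \<oplus> (\<Oplus>j\<in>J. \<Oplus>i\<in>I. f i j)"
      using insert by (intro finsum_addf) auto
    also have "\<dots> = (\<Oplus>i\<in>insert x I. \<Oplus>j\<in>J. f i j)"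
      using insert by (subst finsum_insert) auto
    finally show ?case by simp
  qed
qed

lemma mat_algebra_ring:
  assumes "field F"
  shows "ring (mat_algebra F d)"
proof -
  interpret F: field F by fact
  let ?M = "mat_algebra F d"
  have mult: "(A \<otimes>\<^bsub>?M\<^esub> B) (i, j) = (\<Oplus>\<^bsub>F\<^esub> l \<in> {..<d}. A (i, l) \<otimes>\<^bsub>F\<^esub> B (l, j))"
    if "i < d" "j < d" for A B i j using that by (simp add: mat_algebra_simps)
  have add: "(A \<oplus>\<^bsub>?M\<^esub> B) (i, j) = A (i, j) \<oplus>\<^bsub>F\<^esub> B (i, j)"
    if "i < d" "j < d" for A B i j using that by (simp add: mat_algebra_simps)
  have one: "\<one>\<^bsub>?M\<^esub> (i, j) = (if i = j then \<one>\<^bsub>F\<^esub> else \<zero>\<^bsub>F\<^esub>)"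
    if "i < d" "j < d" for i j using that by (simp add: mat_algebra_simps)
  have mult_closed: "A \<otimes>\<^bsub>?M\<^esub> B \<in> carrier ?M"
    if "A \<in> carrier ?M" "B \<in> carrier ?M" for A B
  proof -
    have "(\<Oplus>\<^bsub>F\<^esub> l \<in> {..<d}. A (i, l) \<otimes>\<^bsub>F\<^esub> B (l, j)) \<in> carrier F" if "i < d" "j < d" for i j
      using that mat_algebra_entry[OF \<open>A \<in> _\<close>] mat_algebra_entry[OF \<open>B \<in> _\<close>]
      by (intro F.finsum_closed) auto
    then show ?thesis by (auto simp: mat_algebra_simps)
  qed
  have one_closed: "\<one>\<^bsub>?M\<^esub> \<in> carrier ?M"
    by (auto simp: mat_algebra_simps)
  have add_closed: "A \<oplus>\<^bsub>?M\<^esub> B \<in> carrier ?M"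
    if "A \<in> carrier ?M" "B \<in> carrier ?M" for A B
    using abelian_group.axioms(1)[OF mat_algebra_abelian_group[OF assms]] that
    by (rule abelian_monoid.a_closed)
  note [simp] = mult add one mult_closed one_closed add_closed mat_algebra_entry
  have assoc: "A \<otimes>\<^bsub>?M\<^esub> B \<otimes>\<^bsub>?M\<^esub> C = A \<otimes>\<^bsub>?M\<^esub> (B \<otimes>\<^bsub>?M\<^esub> C)"
    if A: "A \<in> carrier ?M" and B: "B \<in> carrier ?M" and C: "C \<in> carrier ?M" for A B C
  proof (rule mat_algebra_eqI[of _ F d])
    fix i j assume ij: "i < d" "j < d"
    have "(A \<otimes>\<^bsub>?M\<^esub> B \<otimes>\<^bsub>?M\<^esub> C) (i, j) =
        (\<Oplus>\<^bsub>F\<^esub> l \<in> {..<d}. (\<Oplus>\<^bsub>F\<^esub> k \<in> {..<d}. A (i, k) \<otimes>\<^bsub>F\<^esub> B (k, l)) \<otimes>\<^bsub>F\<^esub> C (l, j))"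
      unfolding mult[OF ij] using ij A B C
      by (intro F.finsum_cong') (auto intro!: F.finsum_closed)
    also have "\<dots> =
        (\<Oplus>\<^bsub>F\<^esub> l \<in> {..<d}. \<Oplus>\<^bsub>F\<^esub> k \<in> {..<d}. A (i, k) \<otimes>\<^bsub>F\<^esub> B (k, l) \<otimes>\<^bsub>F\<^esub> C (l, j))"
      using ij A B C
      by (intro F.finsum_cong') (auto intro!: F.finsum_closed F.finsum_ldistr)
    also have "\<dots> =
        (\<Oplus>\<^bsub>F\<^esub> k \<in> {..<d}. \<Oplus>\<^bsub>F\<^esub> l \<in> {..<d}. A (i, k) \<otimes>\<^bsub>F\<^esub> B (k, l) \<otimes>\<^bsub>F\<^esub> C (l, j))"
      using ij A B C by (intro finsum_swap) (auto intro: F.abelian_monoid_axioms)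
    also have "\<dots> =
        (\<Oplus>\<^bsub>F\<^esub> k \<in> {..<d}. \<Oplus>\<^bsub>F\<^esub> l \<in> {..<d}. A (i, k) \<otimes>\<^bsub>F\<^esub> (B (k, l) \<otimes>\<^bsub>F\<^esub> C (l, j)))"
      using ij A B C
      by (intro F.finsum_cong' refl) (auto intro!: F.finsum_closed F.m_assoc)
    also have "\<dots> =
        (\<Oplus>\<^bsub>F\<^esub> k \<in> {..<d}. A (i, k) \<otimes>\<^bsub>F\<^esub> (\<Oplus>\<^bsub>F\<^esub> l \<in> {..<d}. B (k, l) \<otimes>\<^bsub>F\<^esub> C (l, j)))"
      using ij A B C
      by (intro F.finsum_cong' refl) (auto intro!: F.finsum_closed F.finsum_rdistr[symmetric])
    also have "\<dots> = (A \<otimes>\<^bsub>?M\<^esub> (B \<otimes>\<^bsub>?M\<^esub> C)) (i, j)"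
      unfolding mult[OF ij] using ij A B C
      by (intro F.finsum_cong') (auto intro!: F.finsum_closed)
    finally show "(A \<otimes>\<^bsub>?M\<^esub> B \<otimes>\<^bsub>?M\<^esub> C) (i, j) = (A \<otimes>\<^bsub>?M\<^esub> (B \<otimes>\<^bsub>?M\<^esub> C)) (i, j)" .
  qed (use that in auto)
  have l_one: "\<one>\<^bsub>?M\<^esub> \<otimes>\<^bsub>?M\<^esub> A = A" if A: "A \<in> carrier ?M" for A
  proof (rule mat_algebra_eqI[of _ F d])
    fix i j assume ij: "i < d" "j < d"
    have "(\<one>\<^bsub>?M\<^esub> \<otimes>\<^bsub>?M\<^esub> A) (i, j) = (\<Oplus>\<^bsub>F\<^esub> l \<in> {..<d}. if i = l then A (l, j) else \<zero>\<^bsub>F\<^esub>)"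
      unfolding mult[OF ij] using ij A by (intro F.finsum_cong') auto
    also have "\<dots> = A (i, j)"
      using ij A by (intro F.finsum_singleton) auto
    finally show "(\<one>\<^bsub>?M\<^esub> \<otimes>\<^bsub>?M\<^esub> A) (i, j) = A (i, j)" .
  qed (use that in auto)
  have r_one: "A \<otimes>\<^bsub>?M\<^esub> \<one>\<^bsub>?M\<^esub> = A" if A: "A \<in> carrier ?M" for A
  proof (rule mat_algebra_eqI[of _ F d])
    fix i j assume ij: "i < d" "j < d"
    have "(A \<otimes>\<^bsub>?M\<^esub> \<one>\<^bsub>?M\<^esub>) (i, j) = (\<Oplus>\<^bsub>F\<^esub> l \<in> {..<d}. if j = l then A (i, l) else \<zero>\<^bsub>F\<^esub>)"
      unfolding mult[OF ij] using ij A by (intro F.finsum_cong') auto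
    also have "\<dots> = A (i, j)"
      using ij A by (intro F.finsum_singleton) auto
    finally show "(A \<otimes>\<^bsub>?M\<^esub> \<one>\<^bsub>?M\<^esub>) (i, j) = A (i, j)" .
  qed (use that in auto)
  have l_distr: "(A \<oplus>\<^bsub>?M\<^esub> B) \<otimes>\<^bsub>?M\<^esub> C = A \<otimes>\<^bsub>?M\<^esub> C \<oplus>\<^bsub>?M\<^esub> B \<otimes>\<^bsub>?M\<^esub> C"
    if A: "A \<in> carrier ?M" and B: "B \<in> carrier ?M" and C: "C \<in> carrier ?M" for A B C
  proof (rule mat_algebra_eqI[of _ F d])
    fix i j assume ij: "i < d" "j < d"
    have "((A \<oplus>\<^bsub>?M\<^esub> B) \<otimes>\<^bsub>?M\<^esub> C) (i, j) =
        (\<Oplus>\<^bsub>F\<^esub> l \<in> {..<d}. A (i, l) \<otimes>\<^bsub>F\<^esub> C (l, j) \<oplus>\<^bsub>F\<^esub> B (i, l) \<otimes>\<^bsub>F\<^esub> C (l, j))"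
      unfolding mult[OF ij] using ij A B C by (intro F.finsum_cong') (auto intro!: F.l_distr)
    also have "\<dots> = (A \<otimes>\<^bsub>?M\<^esub> C \<oplus>\<^bsub>?M\<^esub> B \<otimes>\<^bsub>?M\<^esub> C) (i, j)"
      unfolding mult[OF ij] add[OF ij] using ij A B C by (intro F.finsum_addf) auto
    finally show "((A \<oplus>\<^bsub>?M\<^esub> B) \<otimes>\<^bsub>?M\<^esub> C) (i, j) = (A \<otimes>\<^bsub>?M\<^esub> C \<oplus>\<^bsub>?M\<^esub> B \<otimes>\<^bsub>?M\<^esub> C) (i, j)" .
  qed (use that in auto)
  have r_distr: "C \<otimes>\<^bsub>?M\<^esub> (A \<oplus>\<^bsub>?M\<^esub> B) = C \<otimes>\<^bsub>?M\<^esub> A \<oplus>\<^bsub>?M\<^esub> C \<otimes>\<^bsub>?M\<^esub> B"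
    if A: "A \<in> carrier ?M" and B: "B \<in> carrier ?M" and C: "C \<in> carrier ?M" for A B C
  proof (rule mat_algebra_eqI[of _ F d])
    fix i j assume ij: "i < d" "j < d"
    have "(C \<otimes>\<^bsub>?M\<^esub> (A \<oplus>\<^bsub>?M\<^esub> B)) (i, j) =
        (\<Oplus>\<^bsub>F\<^esub> l \<in> {..<d}. C (i, l) \<otimes>\<^bsub>F\<^esub> A (l, j) \<oplus>\<^bsub>F\<^esub> C (i, l) \<otimes>\<^bsub>F\<^esub> B (l, j))"
      unfolding mult[OF ij] using ij A B C by (intro F.finsum_cong') (auto intro!: F.r_distr)
    also have "\<dots> = (C \<otimes>\<^bsub>?M\<^esub> A \<oplus>\<^bsub>?M\<^esub> C \<otimes>\<^bsub>?M\<^esub> B) (i, j)"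
      unfolding mult[OF ij] add[OF ij] using ij A B C by (intro F.finsum_addf) auto
    finally show "(C \<otimes>\<^bsub>?M\<^esub> (A \<oplus>\<^bsub>?M\<^esub> B)) (i, j) = (C \<otimes>\<^bsub>?M\<^esub> A \<oplus>\<^bsub>?M\<^esub> C \<otimes>\<^bsub>?M\<^esub> B) (i, j)" .
  qed (use that in auto)
  show ?thesis
    by (intro ringI mat_algebra_abelian_group[OF assms] monoidI)
       (auto simp: assoc l_one r_one l_distr r_distr)
qed


subsection \<open>Uniqueness\<close>

definition nat_mod_field :: "nat \<Rightarrow> nat ring" where
  "nat_mod_field p =
    \<lparr> carrier = {..<p}, monoid.mult = (\<lambda>a b. a * b mod p), monoid.one = 1,
      ring.zero = 0, ring.add = (\<lambda>a b. (a + b) mod p) \<rparr>"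

lemma nat_mod_field:
  assumes "Factorial_Ring.prime p"
  shows "field (nat_mod_field p)"
proof -
  let ?F = "nat_mod_field p"
  have p: "1 < p" using assms prime_gt_1_nat by blast
  have "abelian_group ?F"
  proof (rule abelian_groupI)
    fix x assume "x \<in> carrier ?F"
    then have "x < p" by (simp add: nat_mod_field_def)
    then have "((p - x) mod p + x) mod p = 0" by (simp add: mod_add_left_eq)
    then have "(p - x) mod p \<oplus>\<^bsub>?F\<^esub> x = \<zero>\<^bsub>?F\<^esub>" by (simp add: nat_mod_field_def)
    then show "\<exists>y \<in> carrier ?F. y \<oplus>\<^bsub>?F\<^esub> x = \<zero>\<^bsub>?F\<^esub>"
      using p by (intro bexI[of _ "(p - x) mod p"]) (auto simp: nat_mod_field_def)
  qed (use p in \<open>auto simp: nat_mod_field_def mod_simps ac_simps\<close>)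
  moreover have "comm_monoid ?F"
    by (rule comm_monoidI) (use p in \<open>auto simp: nat_mod_field_def mod_simps ac_simps\<close>)
  ultimately have "cring ?F"
    by (rule cringI) (auto simp: nat_mod_field_def mod_simps algebra_simps)
  then show ?thesis
  proof (rule cring.cring_fieldI2)
    show "\<zero>\<^bsub>?F\<^esub> \<noteq> \<one>\<^bsub>?F\<^esub>" by (simp add: nat_mod_field_def)
  next
    fix a assume "a \<in> carrier ?F" "a \<noteq> \<zero>\<^bsub>?F\<^esub>"
    then have "0 < a" "a < p" by (simp_all add: nat_mod_field_def)
    then have "coprime a p"
      using assms by (metis coprime_commute nat_dvd_not_less prime_imp_coprime)
    then obtain b where "[a * b = 1] (mod p)" using cong_solve_coprime_nat by auto
    then have "a * (b mod p) mod p = 1" using p by (simp add: cong_def mod_simps)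
    then show "\<exists>b \<in> carrier ?F. a \<otimes>\<^bsub>?F\<^esub> b = \<one>\<^bsub>?F\<^esub>"
      using p by (intro bexI[of _ "b mod p"]) (auto simp: nat_mod_field_def)
  qed
qed

lemma is_s_poly_unique:
  assumes "is_s_poly d m s" "is_s_poly d m t"
  shows "s = t"
proof (rule ccontr)
  assume "s \<noteq> t"
  then have "finite {x. poly (s - t) x = 0}" by (intro poly_roots_finite) simp
  moreover have "int ` {p::nat. Factorial_Ring.prime p} \<subseteq> {x. poly (s - t) x = 0}"
  proof safe
    fix p :: nat assume "Factorial_Ring.prime p"
    then have "field (nat_mod_field p)" by (rule nat_mod_field)
    moreover have "carrier (nat_mod_field p) = {..<p}" by (simp add: nat_mod_field_def)
    ultimately show "poly (s - t) (int p) = 0"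
      using assms unfolding is_s_poly_def by (metis (no_types, lifting) card_lessThan
          cancel_comm_monoid_add_class.diff_cancel finite_lessThan poly_diff)
  qed
  ultimately have "finite (int ` {p::nat. Factorial_Ring.prime p})" by (rule rev_finite_subset)
  then have "finite {p::nat. Factorial_Ring.prime p}" by (rule finite_imageD) simp
  then show False using primes_infinite by blast
qed

end

theory Submission
  imports Defs
begin

text \<open>Let \<open>F\<close> be a field with \<open>q\<close> elements. At \<open>q\<close> the polynomial \<open>r\<close> takes as its value the number of
\<open>m\<close>-dimensional subspaces of the matrix algebra that do not generate it, since the Gaussian binomial
counts all of them. It suffices to bound this number by a constant times a power of \<open>q\<close>, uniformly in
\<open>q\<close>, and prime fields are enough (\<open>degree_le_if_bounded_at_primes\<close>). A space of dimension \<open>m\<close> has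
about \<open>q ^ (m * m)\<close> ordered bases, so the question becomes to show that there are
\<open>O(q ^ (m * d\<^sup>2 - (m - 1) * (d - 1)))\<close> tuples of \<open>m\<close> matrices whose entries lie in a proper unital
subalgebra \<open>S\<close> (\<open>card_nongenerating_subspaces\<close>, \<open>card_nongenerating_tuples\<close>). For \<open>m \<le> 1\<close> there
are not more tuples than that at all.

If \<open>S\<close> has an invariant subspace \<open>U\<close> of dimension \<open>k\<close> with \<open>0 < k < d\<close>, then there are about
\<open>q ^ (k * (d - k))\<close> choices for \<open>U\<close>, and its stabilizer has codimension \<open>k * (d - k)\<close>. So these
tuples number about \<open>q ^ (m * d\<^sup>2 - (m - 1) * k * (d - k))\<close>, and \<open>k * (d - k) \<ge> d - 1\<close>
(\<open>card_invariant_tuples\<close>).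

If \<open>S\<close> is irreducible, then by Burnside's theorem it commutes with an operator \<open>T\<close> that is not a
scalar, and by Schur's lemma \<open>F[T]\<close> is a field of some degree \<open>n \<ge> 2\<close> over \<open>F\<close> (\<open>burnside\<close>). The
columns form a space of dimension \<open>r = d / n\<close> over it, so the commutant of \<open>T\<close> has at most
\<open>q ^ (d * r)\<close> elements. It remains to bound the number of \<open>T\<close>: a pair of \<open>T\<close> and a basis over \<open>F[T]\<close>
is determined by \<open>d + 1\<close> column vectors, and each \<open>T\<close> has about \<open>q ^ (d * r)\<close> such bases
(\<open>card_fieldlike_ops\<close>). A factor \<open>q\<close> is gained from the translates of \<open>T\<close> by scalars, and the
resulting exponent is within the bound when \<open>m \<ge> 2\<close> (\<open>card_commuting_tuples\<close>,
\<open>commuting_exponent_bound\<close>).\<close>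

section \<open>Linear algebra over a finite division ring of operators\<close>

text \<open>The restrictions of \<open>L\<close> to the group form a division ring, which is finite as the group is, and
the group is a vector space over it. Linear algebra is set up at this level because two kinds of
scalars are needed on the space of column vectors: the elements of the ground field \<open>F\<close>, and the
elements of an extension \<open>F[T]\<close> generated by an operator \<open>T\<close>, for which this form avoids
constructing a field. Operators are compared only on the carrier, so \<open>L\<close> may contain several
functions that represent the same operator.\<close>

locale division_operators = abelian_group G for G :: "('a, 'b) ring_scheme" (structure) +
  fixes L :: "('a \<Rightarrow> 'a) set"
  assumes finite_carrier: "finite (carrier G)"
    and nontrivial: "carrier G \<noteq> {\<zero>}"
    and op_closed: "f \<in> L \<Longrightarrow> x \<in> carrier G \<Longrightarrow> f x \<in> carrier G"
    and op_add: "f \<in> L \<Longrightarrow> x \<in> carrier G \<Longrightarrow> y \<in> carrier G \<Longrightarrow> f (x \<oplus> y) = f x \<oplus> f y"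
    and has_one: "\<exists>h\<in>L. \<forall>x\<in>carrier G. h x = x"
    and has_sum: "f \<in> L \<Longrightarrow> g \<in> L \<Longrightarrow> \<exists>h\<in>L. \<forall>x\<in>carrier G. h x = f x \<oplus> g x"
    and has_minus: "f \<in> L \<Longrightarrow> \<exists>h\<in>L. \<forall>x\<in>carrier G. h x = \<ominus> f x"
    and has_comp: "f \<in> L \<Longrightarrow> g \<in> L \<Longrightarrow> \<exists>h\<in>L. \<forall>x\<in>carrier G. h x = f (g x)"
    and op_inj: "f \<in> L \<Longrightarrow> x \<in> carrier G \<Longrightarrow> x \<noteq> \<zero> \<Longrightarrow> f x = \<zero> \<Longrightarrow> y \<in> carrier G \<Longrightarrow> f y = \<zero>"
begin

lemma op_zero: "f \<in> L \<Longrightarrow> f \<zero> = \<zero>"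
  using op_add[of f \<zero> \<zero>] op_closed[of f \<zero>] by (simp add: add.r_cancel_one')

lemma diff_eq_diff:
  assumes "x \<oplus> u = y \<oplus> w" "x \<in> carrier G" "y \<in> carrier G" "u \<in> carrier G" "w \<in> carrier G"
  shows "x \<ominus> y = w \<ominus> u"
proof -
  have "x = x \<oplus> u \<ominus> u" using assms(2-) by (simp add: minus_eq a_assoc r_neg)
  also have "\<dots> = y \<oplus> (w \<ominus> u)" using assms by (simp add: minus_eq a_assoc)
  finally have "x \<ominus> y = \<ominus> y \<oplus> (y \<oplus> (w \<ominus> u))"
    using assms(2-) by (simp add: minus_eq a_comm)
  then show ?thesis using assms(2-) by (simp add: r_neg1)
qed

lemma minus_zero_iff:
  assumes "x \<in> carrier G" "y \<in> carrier G"
  shows "x \<ominus> y = \<zero> \<longleftrightarrow> x = y"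
proof
  assume "x \<ominus> y = \<zero>"
  then have "x = \<ominus> (\<ominus> y)" using minus_equality[of x "\<ominus> y"] assms by (simp add: minus_eq)
  then show "x = y" using assms by simp
qed (use assms in \<open>simp add: minus_eq r_neg\<close>)

lemma has_diff:
  assumes "f \<in> L" "g \<in> L"
  shows "\<exists>h\<in>L. \<forall>x\<in>carrier G. h x = f x \<ominus> g x"
proof -
  obtain k where k: "k \<in> L" "\<forall>x\<in>carrier G. k x = \<ominus> g x" using has_minus[OF assms(2)] by blast
  obtain h where "h \<in> L" "\<forall>x\<in>carrier G. h x = f x \<oplus> k x" using has_sum[OF assms(1) k(1)] by blast
  then show ?thesis using k(2) by (intro bexI[of _ h]) (auto simp: minus_eq)
qed

definition orbit :: "'a \<Rightarrow> 'a set" where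
  "orbit v = (\<lambda>f. f v) ` L"

text \<open>The order of the division ring. Evaluation at a nonzero vector is injective, so every nonzero orbit
has this size.\<close>

definition Q :: nat where
  "Q = card (orbit (SOME v. v \<in> carrier G \<and> v \<noteq> \<zero>))"

lemma orbit_subset: "v \<in> carrier G \<Longrightarrow> orbit v \<subseteq> carrier G"
  using op_closed by (auto simp: orbit_def)

lemma finite_orbit: "v \<in> carrier G \<Longrightarrow> finite (orbit v)"
  using orbit_subset finite_carrier finite_subset by blast

lemma in_own_orbit: "v \<in> carrier G \<Longrightarrow> v \<in> orbit v"
  using has_one unfolding orbit_def by (metis image_eqI)

lemma zero_in_orbit: "v \<in> carrier G \<Longrightarrow> \<zero> \<in> orbit v"
proof -
  assume v: "v \<in> carrier G"
  obtain e where e: "e \<in> L" "e v = v" using has_one v by blast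
  obtain h where "h \<in> L" "h v = v \<ominus> v" using has_diff[OF e(1) e(1)] e v by auto
  then have "h v = \<zero>" using minus_zero_iff v by simp
  then show ?thesis using \<open>h \<in> L\<close> unfolding orbit_def by (metis image_eqI)
qed

lemma op_eq_if_eq_at:
  assumes "f \<in> L" "g \<in> L" "v \<in> carrier G" "v \<noteq> \<zero>" "f v = g v" "x \<in> carrier G"
  shows "f x = g x"
proof -
  obtain h where h: "h \<in> L" "\<And>x. x \<in> carrier G \<Longrightarrow> h x = f x \<ominus> g x"
    using has_diff[OF assms(1,2)] by blast
  have "h v = \<zero>" using h assms op_closed by (simp add: minus_zero_iff)
  then have "h x = \<zero>" using op_inj h assms by blast
  then show ?thesis using h assms op_closed by (simp add: minus_zero_iff)
qed

lemma card_orbit_le: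
  assumes "v \<in> carrier G" "v \<noteq> \<zero>" "w \<in> carrier G"
  shows "card (orbit w) \<le> card (orbit v)"
proof (rule surj_card_le[where f = "\<lambda>x. (SOME f. f \<in> L \<and> f v = x) w"])
  show "finite (orbit v)" using assms finite_orbit by blast
  show "orbit w \<subseteq> (\<lambda>x. (SOME f. f \<in> L \<and> f v = x) w) ` orbit v"
  proof
    fix y assume "y \<in> orbit w"
    then obtain f where f: "f \<in> L" "y = f w" by (auto simp: orbit_def)
    let ?g = "SOME g. g \<in> L \<and> g v = f v"
    have "?g \<in> L \<and> ?g v = f v" by (rule someI[of _ f]) (use f in simp)
    then have "?g w = y" using op_eq_if_eq_at[of ?g f v w] f assms by simp
    then show "y \<in> (\<lambda>x. (SOME f. f \<in> L \<and> f v = x) w) ` orbit v"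
      using f by (force simp: orbit_def)
  qed
qed

lemma card_orbit:
  assumes "v \<in> carrier G" "v \<noteq> \<zero>"
  shows "card (orbit v) = Q"
proof -
  let ?w = "SOME v. v \<in> carrier G \<and> v \<noteq> \<zero>"
  have "?w \<in> carrier G \<and> ?w \<noteq> \<zero>" by (rule someI_ex) (use assms in blast)
  then show ?thesis unfolding Q_def using card_orbit_le assms by (simp add: le_antisym)
qed

lemma Q_ge_2: "2 \<le> Q"
proof -
  obtain v where v: "v \<in> carrier G" "v \<noteq> \<zero>" using nontrivial by blast
  have "card {v, \<zero>} \<le> card (orbit v)"
    using v in_own_orbit zero_in_orbit finite_orbit by (intro card_mono) auto
  then show ?thesis using v card_orbit by simp
qed

text \<open>The orbit of \<open>f v\<close> is contained in the orbit of \<open>v\<close> and has the same finite size, so it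
contains \<open>v\<close>.\<close>

lemma op_invertible:
  assumes "f \<in> L" "v \<in> carrier G" "f v \<noteq> \<zero>"
  shows "\<exists>g\<in>L. g (f v) = v"
proof -
  have "v \<noteq> \<zero>" using assms op_zero by auto
  have "orbit (f v) \<subseteq> orbit v"
  proof
    fix y assume "y \<in> orbit (f v)"
    then obtain g where "g \<in> L" "y = g (f v)" by (auto simp: orbit_def)
    then show "y \<in> orbit v"
      using has_comp[of g f] assms unfolding orbit_def by (metis image_eqI)
  qed
  moreover have "card (orbit (f v)) = card (orbit v)"
    using card_orbit assms \<open>v \<noteq> \<zero>\<close> op_closed by simp
  ultimately have "orbit (f v) = orbit v"
    using card_subset_eq finite_orbit assms(2) by blast
  then obtain g where "g \<in> L" "v = g (f v)"
    using in_own_orbit[OF assms(2)] by (auto simp: orbit_def)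
  then show ?thesis by metis
qed

definition submod :: "'a set \<Rightarrow> bool" where
  "submod U \<longleftrightarrow> U \<subseteq> carrier G \<and> \<zero> \<in> U \<and> (\<forall>x\<in>U. \<forall>y\<in>U. x \<oplus> y \<in> U) \<and> (\<forall>f\<in>L. \<forall>x\<in>U. f x \<in> U)"

lemma submodD:
  assumes "submod U"
  shows "U \<subseteq> carrier G" "\<zero> \<in> U" "x \<in> U \<Longrightarrow> y \<in> U \<Longrightarrow> x \<oplus> y \<in> U"
    "f \<in> L \<Longrightarrow> x \<in> U \<Longrightarrow> f x \<in> U" "x \<in> U \<Longrightarrow> x \<in> carrier G"
  using assms by (auto simp: submod_def)

lemma submod_minus:
  assumes "submod U" "x \<in> U"
  shows "\<ominus> x \<in> U"
proof -
  obtain e where e: "e \<in> L" "e x = x" using has_one submodD(5)[OF assms] by blast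
  obtain h where "h \<in> L" "h x = \<ominus> x" using has_minus[OF e(1)] e submodD(5)[OF assms] by auto
  then show ?thesis using submodD(4)[OF assms(1) _ assms(2)] by metis
qed

lemma submod_finite: "submod U \<Longrightarrow> finite U"
  using submodD(1) finite_carrier finite_subset by blast

lemma submod_carrier: "submod (carrier G)"
  using op_closed by (auto simp: submod_def)

lemma submod_diff: "submod U \<Longrightarrow> x \<in> U \<Longrightarrow> y \<in> U \<Longrightarrow> x \<ominus> y \<in> U"
  by (simp add: minus_eq submodD submod_minus)

fun sp :: "'a list \<Rightarrow> 'a set" where
  "sp [] = {\<zero>}"
| "sp (v # vs) = {x \<oplus> u | x u. x \<in> orbit v \<and> u \<in> sp vs}"

lemma sp_ConsI: "f \<in> L \<Longrightarrow> u \<in> sp vs \<Longrightarrow> f v \<oplus> u \<in> sp (v # vs)"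
  unfolding sp.simps orbit_def by blast

lemma submod_sp: "set vs \<subseteq> carrier G \<Longrightarrow> submod (sp vs)"
proof (induction vs)
  case Nil
  then show ?case by (auto simp: submod_def op_zero)
next
  case (Cons v vs)
  then have IH: "submod (sp vs)" and v: "v \<in> carrier G" by auto
  note [simp] = submodD(5)[OF IH] op_closed v
  show ?case unfolding submod_def
  proof (intro conjI ballI)
    show "sp (v # vs) \<subseteq> carrier G" using orbit_subset[OF v] submodD(1)[OF IH] by auto
    have "\<zero> \<oplus> \<zero> \<in> sp (v # vs)"
      unfolding sp.simps using zero_in_orbit[OF v] submodD(2)[OF IH] by blast
    then show "\<zero> \<in> sp (v # vs)" by simp
  next
    fix x y assume "x \<in> sp (v # vs)" "y \<in> sp (v # vs)"
    then obtain f u g w where *: "f \<in> L" "g \<in> L" "u \<in> sp vs" "w \<in> sp vs"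
      "x = f v \<oplus> u" "y = g v \<oplus> w" by (auto simp: orbit_def)
    then obtain h where h: "h \<in> L" "h v = f v \<oplus> g v" using has_sum[of f g] v by blast
    have "x \<oplus> y = h v \<oplus> (u \<oplus> w)" using * h by (simp add: a_ac)
    then show "x \<oplus> y \<in> sp (v # vs)"
      using sp_ConsI[OF h(1) submodD(3)[OF IH *(3,4)], of v] by simp
  next
    fix f x assume f: "f \<in> L" and "x \<in> sp (v # vs)"
    then obtain g u where *: "g \<in> L" "u \<in> sp vs" "x = g v \<oplus> u" by (auto simp: orbit_def)
    then obtain h where h: "h \<in> L" "h v = f (g v)" using has_comp[of f g] f v by blast
    have "f x = h v \<oplus> f u" using * h f by (simp add: op_add)
    then show "f x \<in> sp (v # vs)"
      using sp_ConsI[OF h(1) submodD(4)[OF IH f *(2)], of v] by simp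
  qed
qed

lemma sp_subset_Cons:
  assumes "v \<in> carrier G" "set vs \<subseteq> carrier G"
  shows "sp vs \<subseteq> sp (v # vs)"
proof
  fix u assume "u \<in> sp vs"
  moreover then have "u = \<zero> \<oplus> u" using submodD(5)[OF submod_sp] assms(2) by simp
  ultimately show "u \<in> sp (v # vs)" using zero_in_orbit[OF assms(1)] by auto
qed

lemma orbit_subset_sp:
  assumes "v \<in> carrier G" "set vs \<subseteq> carrier G"
  shows "orbit v \<subseteq> sp (v # vs)"
proof
  fix u assume "u \<in> orbit v"
  moreover then have "u \<in> carrier G" using orbit_subset[OF assms(1)] by auto
  then have "u = u \<oplus> \<zero>" by simp
  ultimately show "u \<in> sp (v # vs)" using submodD(2)[OF submod_sp] assms(2) by auto
qed

lemma set_subset_sp: "set vs \<subseteq> carrier G \<Longrightarrow> set vs \<subseteq> sp vs"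
proof (induction vs)
  case (Cons v vs)
  then have "v \<in> carrier G" "set vs \<subseteq> carrier G" by auto
  then show ?case
    using Cons.IH sp_subset_Cons[of v vs] orbit_subset_sp[of v vs] in_own_orbit[of v]
    by (metis insert_subset list.simps(15) subset_iff)
qed simp

lemma sp_least: "submod U \<Longrightarrow> set vs \<subseteq> U \<Longrightarrow> sp vs \<subseteq> U"
  by (induction vs) (auto simp: orbit_def submodD)

fun indep :: "'a list \<Rightarrow> bool" where
  "indep [] \<longleftrightarrow> True"
| "indep (v # vs) \<longleftrightarrow> indep vs \<and> v \<in> carrier G \<and> v \<notin> sp vs"

lemma indep_carrier: "indep vs \<Longrightarrow> set vs \<subseteq> carrier G"
  by (induction vs) auto

text \<open>If \<open>f v + u = g v + w\<close> with \<open>u\<close>, \<open>w\<close> in the span of \<open>vs\<close> and \<open>f v\<close>, \<open>g v\<close> different, then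
\<open>f - g\<close> is invertible and carries \<open>v\<close> into that span, so \<open>v\<close> lies there itself. Hence adding an
independent vector multiplies the size by \<open>Q\<close>.\<close>

lemma card_sp: "indep vs \<Longrightarrow> card (sp vs) = Q ^ length vs"
proof (induction vs)
  case (Cons v vs)
  then have v: "v \<in> carrier G" "v \<notin> sp vs" and vs: "indep vs" by auto
  have S: "submod (sp vs)" using submod_sp indep_carrier vs by blast
  note [simp] = submodD(5)[OF S] op_closed v(1)
  have inj: "inj_on (\<lambda>(x, u). x \<oplus> u) (orbit v \<times> sp vs)"
  proof (intro inj_onI, clarify)
    fix x u y w
    assume xy: "x \<in> orbit v" "y \<in> orbit v" and uw: "u \<in> sp vs" "w \<in> sp vs"
      and eq: "x \<oplus> u = y \<oplus> w"
    obtain f g where fg: "f \<in> L" "g \<in> L" "x = f v" "y = g v" using xy by (auto simp: orbit_def)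
    obtain h where h: "h \<in> L" "h v = f v \<ominus> g v" using has_diff[of f g] fg v by blast
    have "x \<ominus> y = w \<ominus> u" using eq fg uw by (intro diff_eq_diff) auto
    then have hv: "h v \<in> sp vs" using submod_diff[OF S] uw fg h by simp
    have "h v = \<zero>"
    proof (rule ccontr)
      assume "h v \<noteq> \<zero>"
      then obtain k where "k \<in> L" "k (h v) = v" using op_invertible h v by blast
      then show False using submodD(4)[OF S] hv v by metis
    qed
    then have "x = y" using h fg by simp
    then show "x = y \<and> u = w" using eq fg uw by simp
  qed
  have "sp (v # vs) = (\<lambda>(x, u). x \<oplus> u) ` (orbit v \<times> sp vs)" by auto
  then have "card (sp (v # vs)) = card (orbit v \<times> sp vs)"
    using card_image[OF inj] by simp
  also have "\<dots> = Q * Q ^ length vs"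
    using Cons.IH vs card_orbit[of v] v submodD(2)[OF S] by (auto simp: card_cartesian_product)
  finally show ?case by simp
qed simp

lemma indep_extend:
  assumes "submod U" "indep us" "set us \<subseteq> U"
  shows "\<exists>vs. indep (vs @ us) \<and> sp (vs @ us) = U"
  using assms(2,3)
proof (induction "card U - card (sp us)" arbitrary: us rule: less_induct)
  case less
  have sub: "sp us \<subseteq> U" using sp_least assms less by blast
  show ?case
  proof (cases "sp us = U")
    case True
    then show ?thesis using less by (intro exI[of _ "[]"]) simp
  next
    case False
    then obtain v where v: "v \<in> U" "v \<notin> sp us" using sub by blast
    have ind: "indep (v # us)" and set: "set (v # us) \<subseteq> U"
      using v less submodD(5)[OF assms(1)] by auto
    have "card (sp us) < card (sp (v # us))"
      using card_sp[OF ind] card_sp[OF less(2)] Q_ge_2 by simp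
    moreover have "card (sp (v # us)) \<le> card U"
      using sp_least[OF assms(1) set] submod_finite[OF assms(1)] card_mono by blast
    ultimately have "card U - card (sp (v # us)) < card U - card (sp us)" by linarith
    from less(1)[OF this ind set] obtain vs where
      "indep (vs @ v # us)" "sp (vs @ v # us) = U" by blast
    then show ?thesis by (intro exI[of _ "vs @ [v]"]) simp
  qed
qed

lemma basis_exists:
  assumes "submod U"
  obtains vs where "indep vs" "sp vs = U" "card U = Q ^ length vs"
  using indep_extend[OF assms, of "[]"] card_sp by auto

lemma card_indep_lists:
  assumes "submod U" "card U = Q ^ m"
  shows "finite {vs. length vs = k \<and> set vs \<subseteq> U \<and> indep vs} \<and>
    card {vs. length vs = k \<and> set vs \<subseteq> U \<and> indep vs} = (\<Prod>i<k. Q ^ m - Q ^ i)"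
proof (induction k)
  case 0
  have "{vs. length vs = 0 \<and> set vs \<subseteq> U \<and> indep vs} = {[]}" by auto
  then show ?case by (simp cong: conj_cong)
next
  case (Suc k)
  let ?S = "\<lambda>k. {vs. length vs = k \<and> set vs \<subseteq> U \<and> indep vs}"
  have "?S (Suc k) = (\<lambda>(vs, v). v # vs) ` (SIGMA vs:?S k. U - sp vs)"
  proof (intro equalityI subsetI)
    fix ws assume ws: "ws \<in> ?S (Suc k)"
    then obtain v vs where "ws = v # vs" by (auto simp: length_Suc_conv)
    with ws show "ws \<in> (\<lambda>(vs, v). v # vs) ` (SIGMA vs:?S k. U - sp vs)"
      by (intro image_eqI[of _ _ "(vs, v)"]) auto
  qed (use submodD(1)[OF assms(1)] in auto)
  moreover have "inj_on (\<lambda>(vs, v). v # vs) (SIGMA vs:?S k. U - sp vs)"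
    by (auto simp: inj_on_def)
  ultimately have fin: "finite (?S (Suc k)) = finite (SIGMA vs:?S k. U - sp vs)"
    and "card (?S (Suc k)) = card (SIGMA vs:?S k. U - sp vs)"
    by (simp_all only: card_image finite_image_iff)
  note this(2)
  also have "card (SIGMA vs:?S k. U - sp vs) = (\<Sum>vs\<in>?S k. card (U - sp vs))"
    using Suc submod_finite[OF assms(1)] by (simp add: card_SigmaI)
  also have "\<dots> = (\<Sum>vs\<in>?S k. Q ^ m - Q ^ k)"
  proof (rule sum.cong)
    fix vs assume vs: "vs \<in> ?S k"
    have "sp vs \<subseteq> U" using sp_least assms vs by blast
    then have "card (U - sp vs) = card U - card (sp vs)"
      using submod_finite[OF assms(1)] finite_subset by (intro card_Diff_subset) blast+
    then show "card (U - sp vs) = Q ^ m - Q ^ k" using card_sp[of vs] vs assms(2) by simp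
  qed simp
  finally have "card (?S (Suc k)) = (\<Prod>i<Suc k. Q ^ m - Q ^ i)" using Suc by simp
  moreover have "finite (?S (Suc k))"
    unfolding fin using Suc submod_finite[OF assms(1)] by auto
  ultimately show ?case by blast
qed

lemma finite_submods: "finite {U. submod U}"
  by (rule finite_subset[of _ "Pow (carrier G)"]) (use finite_carrier submodD(1) in auto)

text \<open>Double counting of pairs of a subspace and an ordered basis of it: an independent list of length
\<open>k\<close> inside a \<open>k\<close>-dimensional subspace spans it.\<close>

lemma card_submods_mult:
  assumes "\<And>U. U \<in> \<U> \<Longrightarrow> submod U \<and> card U = Q ^ k"
  shows "card \<U> * (\<Prod>i<k. Q ^ k - Q ^ i) = card {vs. length vs = k \<and> indep vs \<and> sp vs \<in> \<U>}"
proof -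
  let ?S = "\<lambda>U. {vs. length vs = k \<and> set vs \<subseteq> U \<and> indep vs}"
  have sp_eq: "sp vs = U" if "U \<in> \<U>" "vs \<in> ?S U" for U vs
  proof (rule card_subset_eq)
    show "finite U" "sp vs \<subseteq> U" "card (sp vs) = card U"
      using that assms[OF that(1)] submod_finite[of U] sp_least[of U vs] card_sp[of vs] by simp_all
  qed
  have "{vs. length vs = k \<and> indep vs \<and> sp vs \<in> \<U>} = (\<Union>U\<in>\<U>. ?S U)"
  proof (intro equalityI subsetI)
    fix vs assume vs: "vs \<in> {vs. length vs = k \<and> indep vs \<and> sp vs \<in> \<U>}"
    then have "set vs \<subseteq> sp vs" using set_subset_sp[OF indep_carrier] by simp
    then show "vs \<in> (\<Union>U\<in>\<U>. ?S U)" using vs by (intro UN_I[of "sp vs"]) simp_all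
  next
    fix vs assume "vs \<in> (\<Union>U\<in>\<U>. ?S U)"
    then show "vs \<in> {vs. length vs = k \<and> indep vs \<and> sp vs \<in> \<U>}" using sp_eq by fastforce
  qed
  also have "card \<dots> = (\<Sum>U\<in>\<U>. card (?S U))"
  proof (rule card_UN_disjoint)
    have "\<U> \<subseteq> {U. submod U}" using assms by blast
    then show "finite \<U>" by (rule finite_subset[OF _ finite_submods])
    show "\<forall>U\<in>\<U>. finite (?S U)" using card_indep_lists[of _ k k] assms by simp
    show "\<forall>U\<in>\<U>. \<forall>V\<in>\<U>. U \<noteq> V \<longrightarrow> ?S U \<inter> ?S V = {}"
    proof (intro ballI impI, rule ccontr)
      fix U V assume "U \<in> \<U>" "V \<in> \<U>" "U \<noteq> V" "?S U \<inter> ?S V \<noteq> {}"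
      then obtain vs where "vs \<in> ?S U" "vs \<in> ?S V" by blast
      then show False using sp_eq[of U vs] sp_eq[of V vs] \<open>U \<in> \<U>\<close> \<open>V \<in> \<U>\<close> \<open>U \<noteq> V\<close> by simp
    qed
  qed
  also have "\<dots> = (\<Sum>U\<in>\<U>. \<Prod>i<k. Q ^ k - Q ^ i)"
    using card_indep_lists[of _ k k] assms by (intro sum.cong) simp_all
  finally show ?thesis by simp
qed

lemma card_submods:
  assumes "card (carrier G) = Q ^ m"
  shows "card {U. submod U \<and> card U = Q ^ k} * (\<Prod>i<k. Q ^ k - Q ^ i) = (\<Prod>i<k. Q ^ m - Q ^ i)"
proof -
  have "{vs. length vs = k \<and> indep vs \<and> sp vs \<in> {U. submod U \<and> card U = Q ^ k}}
      = {vs. length vs = k \<and> set vs \<subseteq> carrier G \<and> indep vs}"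
    using submod_sp[OF indep_carrier] card_sp indep_carrier by blast
  then show ?thesis
    using card_submods_mult[of "{U. submod U \<and> card U = Q ^ k}" k]
      card_indep_lists[OF submod_carrier assms, of k] by simp
qed

text \<open>The number of ordered bases of a \<open>k\<close>-dimensional space is, up to the constant \<open>2 ^ k\<close>, the number
of all \<open>k\<close>-tuples. This is what allows subspaces to be replaced by tuples in estimates.\<close>

lemma prod_diff_power_lower:
  assumes "k \<le> m"
  shows "Q ^ (m * k) \<le> 2 ^ k * (\<Prod>i<k. Q ^ m - Q ^ i)"
proof -
  have "Q ^ m \<le> 2 * (Q ^ m - Q ^ i)" if "i < k" for i
  proof -
    have "2 * Q ^ i \<le> Q * Q ^ i" using Q_ge_2 by simp
    also have "\<dots> \<le> Q ^ m"
      using power_increasing[of "Suc i" m Q] Q_ge_2 that assms by simp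
    finally show ?thesis by linarith
  qed
  then have "(\<Prod>i<k. Q ^ m) \<le> (\<Prod>i<k. 2 * (Q ^ m - Q ^ i))" by (intro prod_mono) auto
  then show ?thesis by (simp add: power_mult prod.distrib)
qed

lemma card_submods_bound:
  assumes "card (carrier G) = Q ^ m"
  shows "card {U. submod U \<and> card U = Q ^ k} * Q ^ (k * k) \<le> 2 ^ k * Q ^ (m * k)"
proof -
  let ?N = "card {U. submod U \<and> card U = Q ^ k}"
  have "?N * Q ^ (k * k) \<le> ?N * (2 ^ k * (\<Prod>i<k. Q ^ k - Q ^ i))"
    by (intro mult_le_mono prod_diff_power_lower) auto
  also have "\<dots> = 2 ^ k * (\<Prod>i<k. Q ^ m - Q ^ i)"
    unfolding card_submods[OF assms, symmetric] by simp
  also have "\<dots> \<le> 2 ^ k * (\<Prod>i<k. Q ^ m)" by (intro mult_le_mono prod_mono) auto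
  finally show ?thesis by (simp add: power_mult)
qed

text \<open>The hypotheses on \<open>f\<close> and \<open>g\<close> say that the set where they agree is a subspace.\<close>

lemma eq_on_sp:
  assumes "set vs \<subseteq> carrier G"
    and "\<And>v. v \<in> set vs \<Longrightarrow> f v = g v"
    and "\<And>x y. x \<in> carrier G \<Longrightarrow> y \<in> carrier G \<Longrightarrow> f x = g x \<Longrightarrow> f y = g y \<Longrightarrow> f (x \<oplus> y) = g (x \<oplus> y)"
    and "\<And>l x. l \<in> L \<Longrightarrow> x \<in> carrier G \<Longrightarrow> f x = g x \<Longrightarrow> f (l x) = g (l x)"
    and "f \<zero> = g \<zero>"
    and "x \<in> sp vs"
  shows "f x = g x"
proof -
  have "submod {x \<in> carrier G. f x = g x}"
    unfolding submod_def
  proof (intro conjI ballI)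
    fix x y assume "x \<in> {x \<in> carrier G. f x = g x}" "y \<in> {x \<in> carrier G. f x = g x}"
    then show "x \<oplus> y \<in> {x \<in> carrier G. f x = g x}" using assms(3)[of x y] by simp
  next
    fix l x assume "l \<in> L" "x \<in> {x \<in> carrier G. f x = g x}"
    then show "l x \<in> {x \<in> carrier G. f x = g x}" using assms(4)[of l x] op_closed by simp
  qed (use assms(5) in auto)
  then have "sp vs \<subseteq> {x \<in> carrier G. f x = g x}" using assms(1,2) by (intro sp_least) auto
  then show ?thesis using assms(6) by blast
qed

end

section \<open>Vector spaces over finite fields\<close>

locale finite_vectorspace = vectorspace K V for K and V +
  assumes finite_scalars: "finite (carrier K)"
    and finite_vectors: "finite (carrier V)"
    and nonzero_vector: "carrier V \<noteq> {\<zero>\<^bsub>V\<^esub>}"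
begin

definition scalars where "scalars = (\<lambda>c x. c \<odot>\<^bsub>V\<^esub> x) ` carrier K"

lemma smult_eq_zero:
  assumes "c \<in> carrier K" "x \<in> carrier V" "c \<odot>\<^bsub>V\<^esub> x = \<zero>\<^bsub>V\<^esub>" "x \<noteq> \<zero>\<^bsub>V\<^esub>"
  shows "c = \<zero>\<^bsub>K\<^esub>"
proof (rule ccontr)
  assume "c \<noteq> \<zero>\<^bsub>K\<^esub>"
  then have c: "inv\<^bsub>K\<^esub> c \<in> carrier K" "inv\<^bsub>K\<^esub> c \<otimes>\<^bsub>K\<^esub> c = \<one>\<^bsub>K\<^esub>"
    using assms(1) field_Units by auto
  have "x = (inv\<^bsub>K\<^esub> c \<otimes>\<^bsub>K\<^esub> c) \<odot>\<^bsub>V\<^esub> x" using c assms by simp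
  also have "\<dots> = \<zero>\<^bsub>V\<^esub>" using c(1) assms smult_assoc1 by simp
  finally show False using assms(4) by simp
qed

sublocale S: division_operators V scalars
proof
  show "finite (carrier V)" "carrier V \<noteq> {\<zero>\<^bsub>V\<^esub>}"
    using finite_vectors nonzero_vector by auto
  show "\<exists>h\<in>scalars. \<forall>x\<in>carrier V. h x = x"
    unfolding scalars_def by (intro bexI[of _ "\<lambda>x. \<one>\<^bsub>K\<^esub> \<odot>\<^bsub>V\<^esub> x"]) auto
next
  fix f g assume "f \<in> scalars" "g \<in> scalars"
  then obtain a b where ab: "a \<in> carrier K" "b \<in> carrier K"
    "f = (\<lambda>x. a \<odot>\<^bsub>V\<^esub> x)" "g = (\<lambda>x. b \<odot>\<^bsub>V\<^esub> x)" by (auto simp: scalars_def)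
  then show "\<exists>h\<in>scalars. \<forall>x\<in>carrier V. h x = f x \<oplus>\<^bsub>V\<^esub> g x"
    unfolding scalars_def
    by (intro bexI[of _ "\<lambda>x. (a \<oplus>\<^bsub>K\<^esub> b) \<odot>\<^bsub>V\<^esub> x"]) (auto simp: smult_l_distr)
  show "\<exists>h\<in>scalars. \<forall>x\<in>carrier V. h x = f (g x)"
    unfolding scalars_def using ab
    by (intro bexI[of _ "\<lambda>x. (a \<otimes>\<^bsub>K\<^esub> b) \<odot>\<^bsub>V\<^esub> x"]) (auto simp: smult_assoc1)
next
  fix f assume "f \<in> scalars"
  then obtain a where a: "a \<in> carrier K" "f = (\<lambda>x. a \<odot>\<^bsub>V\<^esub> x)" by (auto simp: scalars_def)
  show "f x \<in> carrier V" if "x \<in> carrier V" for x using that a by simp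
  show "f (x \<oplus>\<^bsub>V\<^esub> y) = f x \<oplus>\<^bsub>V\<^esub> f y" if "x \<in> carrier V" "y \<in> carrier V" for x y
    using that a smult_r_distr by simp
  show "\<exists>h\<in>scalars. \<forall>x\<in>carrier V. h x = \<ominus>\<^bsub>V\<^esub> f x"
    unfolding scalars_def using a
    by (intro bexI[of _ "\<lambda>x. (\<ominus>\<^bsub>K\<^esub> a) \<odot>\<^bsub>V\<^esub> x"]) (auto simp: smult_l_minus)
  show "f y = \<zero>\<^bsub>V\<^esub>" if "x \<in> carrier V" "x \<noteq> \<zero>\<^bsub>V\<^esub>" "f x = \<zero>\<^bsub>V\<^esub>" "y \<in> carrier V" for x y
    using smult_eq_zero[of a x] that a by simp
qed

lemma orbit_scalars: "S.orbit x = (\<lambda>c. c \<odot>\<^bsub>V\<^esub> x) ` carrier K"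
  unfolding S.orbit_def unfolding scalars_def by (simp add: image_image)

lemma Q_scalars: "S.Q = card (carrier K)"
proof -
  obtain v where v: "v \<in> carrier V" "v \<noteq> \<zero>\<^bsub>V\<^esub>" using S.nontrivial by blast
  have "inj_on (\<lambda>c. c \<odot>\<^bsub>V\<^esub> v) (carrier K)"
  proof (rule inj_onI)
    fix a b assume ab: "a \<in> carrier K" "b \<in> carrier K" "a \<odot>\<^bsub>V\<^esub> v = b \<odot>\<^bsub>V\<^esub> v"
    then have "(a \<oplus>\<^bsub>K\<^esub> (\<ominus>\<^bsub>K\<^esub> b)) \<odot>\<^bsub>V\<^esub> v = \<zero>\<^bsub>V\<^esub>"
      using v by (simp add: smult_l_distr smult_l_minus M.r_neg)
    then have "a \<oplus>\<^bsub>K\<^esub> (\<ominus>\<^bsub>K\<^esub> b) = \<zero>\<^bsub>K\<^esub>" using smult_eq_zero v ab by simp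
    then show "a = b" using ab R.minus_equality[of a "\<ominus>\<^bsub>K\<^esub> b"] by simp
  qed
  then show ?thesis using S.card_orbit[OF v] by (simp add: orbit_scalars card_image)
qed

lemma submod_iff_subspace: "S.submod U \<longleftrightarrow> subspace K U V"
proof
  assume "S.submod U"
  then show "subspace K U V"
    unfolding S.submod_def unfolding subspace_def submodule_def scalars_def
    using vectorspace_axioms module_axioms by auto
next
  assume "subspace K U V"
  then have U: "submodule K U V" by simp
  then show "S.submod U"
    unfolding S.submod_def unfolding scalars_def
    using submodule.subset[OF U] submodule.m_closed[OF U] submodule.zero_closed[OF U]
      submodule.smult_closed[OF U] by auto
qed

lemma sp_eq_span:
  assumes "set bs \<subseteq> carrier V"
  shows "S.sp bs = span (set bs)"
proof
  show "S.sp bs \<subseteq> span (set bs)"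
    using S.sp_least span_is_subspace[OF assms] in_own_span[OF assms] submod_iff_subspace by blast
  show "span (set bs) \<subseteq> S.sp bs"
    using S.submod_sp[OF assms] S.set_subset_sp[OF assms] submod_iff_subspace
    by (intro span_is_subset) auto
qed

lemma indep_if_lin_indpt:
  assumes "distinct bs" "lin_indpt (set bs)" "set bs \<subseteq> carrier V"
  shows "S.indep bs"
  using assms
proof (induction bs)
  case (Cons v bs)
  have li: "lin_indpt (set bs)" using subset_li_is_li[OF Cons.prems(2), of "set bs"] by auto
  moreover have "v \<notin> span (set bs)"
    using lin_dep_iff_in_span[of "set bs" v] li Cons.prems by auto
  ultimately show ?case using Cons sp_eq_span[of bs] by simp
qed simp

text \<open>A basis in the sense of \<open>vectorspace\<close>, listed in any order, is independent in the sense of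
\<open>division_operators\<close>. This identifies the two notions of dimension.\<close>

lemma card_carrier: "card (carrier V) = card (carrier K) ^ dim"
proof -
  have "span (carrier V) = carrier V"
    using in_own_span[of "carrier V"] span_is_subset2[of "carrier V"] by auto
  then have "fin_dim" unfolding fin_dim_def using finite_vectors by blast
  then obtain B where B: "finite B" "basis B" using finite_basis_exists by blast
  then obtain bs where bs: "set bs = B" "distinct bs" using finite_distinct_list by blast
  have vsV: "set bs \<subseteq> carrier V" using B bs by (simp add: basis_def)
  have "S.indep bs" using bs B by (intro indep_if_lin_indpt) (auto simp: basis_def)
  moreover have "S.sp bs = carrier V" using sp_eq_span[OF vsV] B bs by (simp add: basis_def)
  moreover have "length bs = dim" using dim_basis B bs distinct_card by metis
  ultimately show ?thesis using S.card_sp Q_scalars by metis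
qed

lemma card_subspace:
  assumes "subspace K U V"
  shows "card U = card (carrier K) ^ vectorspace.dim K (vs U)"
proof -
  interpret U: vectorspace K "vs U" using subspace_is_vs[OF assms] .
  have UV: "U \<subseteq> carrier V" using S.submodD(1) assms submod_iff_subspace by blast
  show ?thesis
  proof (cases "carrier (vs U) = {\<zero>\<^bsub>vs U\<^esub>}")
    case False
    then interpret U: finite_vectorspace K "vs U"
      using UV finite_vectors finite_subset finite_scalars by unfold_locales auto
    show ?thesis using U.card_carrier by simp
  next
    case True
    have "U.basis {}"
    proof -
      have "U.span {} = {\<zero>\<^bsub>V\<^esub>}" using U.sum_simp by (auto simp: U.span_def U.lincomb_def)
      moreover have "U.lin_indpt {}" by (auto simp: U.lin_dep_def)
      ultimately show ?thesis unfolding U.basis_def True by simp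
    qed
    then have "U.dim = 0" using U.dim_basis[of "{}"] by simp
    then show ?thesis using True by simp
  qed
qed

lemma card_scalars_ge_2: "2 \<le> card (carrier K)"
  using S.Q_ge_2 Q_scalars by simp

lemma dim_eq_iff_card:
  assumes "subspace K U V"
  shows "vectorspace.dim K (vs U) = m \<longleftrightarrow> card U = card (carrier K) ^ m"
  using card_subspace[OF assms] card_scalars_ge_2 power_inject_exp[of "card (carrier K)"] by auto

end

section \<open>The matrix algebra and its action on columns\<close>

locale matrices_over_finite_field = field F for F (structure) +
  fixes d :: nat
  assumes finite_field: "finite (carrier F)" and d_pos: "1 \<le> d"
begin

abbreviation "M \<equiv> mat_algebra F d"
abbreviation "q \<equiv> card (carrier F)"

lemma M_vectorspace: "vectorspace F M"
  using mat_algebra_vectorspace field_axioms by blast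

sublocale R: ring M
  using mat_algebra_ring field_axioms by blast

lemma card_M: "card (carrier M) = q ^ (d * d)"
  by (simp add: mat_algebra_simps card_PiE)

lemma finite_M: "finite (carrier M)"
  by (simp add: mat_algebra_simps finite_PiE finite_field)

lemma q_gt_1: "2 \<le> q"
proof -
  have "card {\<zero>, \<one>} \<le> q" by (intro card_mono finite_field) auto
  then show ?thesis by simp
qed

sublocale mat: finite_vectorspace F M
proof (intro finite_vectorspace.intro finite_vectorspace_axioms.intro M_vectorspace finite_field finite_M)
  have "1 < q ^ (d * d)" using q_gt_1 d_pos by (intro one_less_power) auto
  then show "carrier M \<noteq> {\<zero>\<^bsub>M\<^esub>}" using card_M by auto
qed

lemma entry_mult:
  "i < d \<Longrightarrow> j < d \<Longrightarrow> (A \<otimes>\<^bsub>M\<^esub> B) (i, j) = (\<Oplus>l\<in>{..<d}. A (i, l) \<otimes> B (l, j))"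
  by (simp add: mat_algebra_simps)

lemma entry_smult: "i < d \<Longrightarrow> j < d \<Longrightarrow> (c \<odot>\<^bsub>M\<^esub> B) (i, j) = c \<otimes> B (i, j)"
  by (simp add: mat_algebra_simps)

lemma entry_add: "i < d \<Longrightarrow> j < d \<Longrightarrow> (A \<oplus>\<^bsub>M\<^esub> B) (i, j) = A (i, j) \<oplus> B (i, j)"
  by (simp add: mat_algebra_simps)

lemma entry_zero: "i < d \<Longrightarrow> j < d \<Longrightarrow> \<zero>\<^bsub>M\<^esub> (i, j) = \<zero>"
  by (simp add: mat_algebra_simps)

lemma smult_mult_left:
  assumes "c \<in> carrier F" "A \<in> carrier M" "B \<in> carrier M"
  shows "(c \<odot>\<^bsub>M\<^esub> A) \<otimes>\<^bsub>M\<^esub> B = c \<odot>\<^bsub>M\<^esub> (A \<otimes>\<^bsub>M\<^esub> B)"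
proof (rule mat_algebra_eqI[of _ F d])
  fix i j assume ij: "i < d" "j < d"
  note [simp] = assms mat_algebra_entry[OF assms(2)] mat_algebra_entry[OF assms(3)] ij
  have "((c \<odot>\<^bsub>M\<^esub> A) \<otimes>\<^bsub>M\<^esub> B) (i, j) = (\<Oplus>l\<in>{..<d}. c \<otimes> (A (i, l) \<otimes> B (l, j)))"
    unfolding entry_mult[OF ij] by (intro finsum_cong') (auto simp: entry_smult m_assoc)
  also have "\<dots> = c \<otimes> (\<Oplus>l\<in>{..<d}. A (i, l) \<otimes> B (l, j))"
    by (intro finsum_rdistr[symmetric]) auto
  finally show "((c \<odot>\<^bsub>M\<^esub> A) \<otimes>\<^bsub>M\<^esub> B) (i, j) = (c \<odot>\<^bsub>M\<^esub> (A \<otimes>\<^bsub>M\<^esub> B)) (i, j)"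
    by (simp add: entry_mult entry_smult)
qed (use assms in auto)

lemma smult_mult_right:
  assumes "c \<in> carrier F" "A \<in> carrier M" "B \<in> carrier M"
  shows "A \<otimes>\<^bsub>M\<^esub> (c \<odot>\<^bsub>M\<^esub> B) = c \<odot>\<^bsub>M\<^esub> (A \<otimes>\<^bsub>M\<^esub> B)"
proof (rule mat_algebra_eqI[of _ F d])
  fix i j assume ij: "i < d" "j < d"
  note [simp] = assms mat_algebra_entry[OF assms(2)] mat_algebra_entry[OF assms(3)] ij
  have "(A \<otimes>\<^bsub>M\<^esub> (c \<odot>\<^bsub>M\<^esub> B)) (i, j) = (\<Oplus>l\<in>{..<d}. c \<otimes> (A (i, l) \<otimes> B (l, j)))"
    unfolding entry_mult[OF ij] by (intro finsum_cong') (auto simp: entry_smult m_lcomm)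
  also have "\<dots> = c \<otimes> (\<Oplus>l\<in>{..<d}. A (i, l) \<otimes> B (l, j))"
    by (intro finsum_rdistr[symmetric]) auto
  finally show "(A \<otimes>\<^bsub>M\<^esub> (c \<odot>\<^bsub>M\<^esub> B)) (i, j) = (c \<odot>\<^bsub>M\<^esub> (A \<otimes>\<^bsub>M\<^esub> B)) (i, j)"
    by (simp add: entry_mult entry_smult)
qed (use assms in auto)

text \<open>Column vectors are represented by the matrices that vanish outside column \<open>0\<close>. They form a left
ideal, so the action of matrices on columns is the multiplication of the matrix ring, and
associativity and distributivity need no separate proof.\<close>

definition first_columns :: "(nat \<times> nat \<Rightarrow> 'a) set" where
  "first_columns = {A \<in> carrier M. \<forall>i<d. \<forall>j<d. j \<noteq> 0 \<longrightarrow> A (i, j) = \<zero>}"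

definition W where "W = M\<lparr>carrier := first_columns\<rparr>"

lemma W_simps:
  "carrier W = first_columns" "\<zero>\<^bsub>W\<^esub> = \<zero>\<^bsub>M\<^esub>" "x \<oplus>\<^bsub>W\<^esub> y = x \<oplus>\<^bsub>M\<^esub> y" "c \<odot>\<^bsub>W\<^esub> x = c \<odot>\<^bsub>M\<^esub> x"
  by (simp_all add: W_def)

lemma W_entry_simps:
  assumes "i < d" "j < d"
  shows "(x \<oplus>\<^bsub>W\<^esub> y) (i, j) = x (i, j) \<oplus> y (i, j)" "(c \<odot>\<^bsub>W\<^esub> x) (i, j) = c \<otimes> x (i, j)"
    "\<zero>\<^bsub>W\<^esub> (i, j) = \<zero>"
  unfolding W_simps using assms by (simp_all add: entry_add entry_smult entry_zero)

lemma W_in_M: "w \<in> carrier W \<Longrightarrow> w \<in> carrier M"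
  by (simp add: W_simps first_columns_def)

lemma W_entry: "w \<in> carrier W \<Longrightarrow> i < d \<Longrightarrow> j < d \<Longrightarrow> w (i, j) \<in> carrier F"
  using mat_algebra_entry W_in_M by blast

lemma W_eqI:
  assumes "v \<in> carrier W" "w \<in> carrier W" "\<And>i. i < d \<Longrightarrow> v (i, 0) = w (i, 0)"
  shows "v = w"
proof (rule mat_algebra_eqI[of _ F d])
  fix i j assume "i < d" "j < d"
  then show "v (i, j) = w (i, j)"
    using assms by (cases "j = 0") (simp_all add: W_simps first_columns_def)
qed (use assms W_in_M in auto)

lemma first_columns_subspace: "subspace F first_columns M"
proof -
  have "mat.S.submod first_columns"
    unfolding mat.S.submod_def unfolding mat.scalars_def
    by (auto simp: first_columns_def entry_add entry_smult entry_zero)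
  then show ?thesis using mat.submod_iff_subspace by blast
qed

lemma card_W: "card (carrier W) = q ^ d"
proof -
  let ?g = "\<lambda>f. \<lambda>(i, j)\<in>{..<d} \<times> {..<d}. if j = 0 then f i else \<zero>"
  have 0: "0 < d" using d_pos by simp
  have g: "?g f \<in> carrier W" if "f \<in> {..<d} \<rightarrow>\<^sub>E carrier F" for f
  proof -
    have "?g f \<in> carrier M"
      unfolding mat_algebra_simps using PiE_mem[OF that] by (intro restrict_PiE_iff[THEN iffD2]) auto
    then show ?thesis by (simp add: W_simps first_columns_def)
  qed
  have "bij_betw ?g ({..<d} \<rightarrow>\<^sub>E carrier F) (carrier W)"
  proof (rule bij_betw_imageI)
    show "inj_on ?g ({..<d} \<rightarrow>\<^sub>E carrier F)"
    proof (rule inj_onI)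
      fix f h assume fh: "f \<in> {..<d} \<rightarrow>\<^sub>E carrier F" "h \<in> {..<d} \<rightarrow>\<^sub>E carrier F" "?g f = ?g h"
      show "f = h"
      proof (rule PiE_ext[OF fh(1,2)])
        fix i assume "i \<in> {..<d}"
        then show "f i = h i" using fun_cong[OF fh(3), of "(i, 0)"] 0 by simp
      qed
    qed
    show "?g ` ({..<d} \<rightarrow>\<^sub>E carrier F) = carrier W"
    proof (intro equalityI subsetI)
      fix w assume w: "w \<in> carrier W"
      let ?f = "\<lambda>i\<in>{..<d}. w (i, 0)"
      have f: "?f \<in> {..<d} \<rightarrow>\<^sub>E carrier F"
        using W_entry[OF w] 0 by (intro restrict_PiE_iff[THEN iffD2]) auto
      have "w = ?g ?f" by (rule W_eqI[OF w g[OF f]]) (use 0 in simp)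
      then show "w \<in> ?g ` ({..<d} \<rightarrow>\<^sub>E carrier F)" using f by (rule image_eqI)
    qed (use g in blast)
  qed
  then have "card (carrier W) = card ({..<d} \<rightarrow>\<^sub>E carrier F)" by (metis bij_betw_same_card)
  then show ?thesis by (simp add: card_PiE)
qed

sublocale W: finite_vectorspace F W
proof (intro finite_vectorspace.intro finite_vectorspace_axioms.intro finite_field)
  show "vectorspace F W"
    unfolding W_def by (rule mat.subspace_is_vs[OF first_columns_subspace])
  have 1: "1 < q ^ d" using q_gt_1 d_pos by (intro one_less_power) auto
  then show "finite (carrier W)" using card_W card.infinite by force
  show "carrier W \<noteq> {\<zero>\<^bsub>W\<^esub>}" using card_W 1 by auto
qed

definition act where "act A w = A \<otimes>\<^bsub>M\<^esub> w"

lemma act_closed: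
  assumes "A \<in> carrier M" "w \<in> carrier W"
  shows "act A w \<in> carrier W"
proof -
  have w: "w (l, j) = \<zero>" if "l < d" "j < d" "j \<noteq> 0" for l j
    using assms(2) that by (simp add: W_simps first_columns_def)
  have "act A w (i, j) = \<zero>" if "i < d" "j < d" "j \<noteq> 0" for i j
  proof -
    have "act A w (i, j) = (\<Oplus>l\<in>{..<d}. \<zero>)"
      unfolding act_def entry_mult[OF that(1,2)]
      using that w mat_algebra_entry[OF assms(1) that(1)] by (intro finsum_cong') simp_all
    then show ?thesis by simp
  qed
  moreover have "act A w \<in> carrier M"
    unfolding act_def using assms(1) W_in_M[OF assms(2)] by (rule R.m_closed)
  ultimately show ?thesis by (simp add: W_simps first_columns_def)
qed

lemma act_add:
  assumes "A \<in> carrier M" "v \<in> carrier W" "w \<in> carrier W"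
  shows "act A (v \<oplus>\<^bsub>W\<^esub> w) = act A v \<oplus>\<^bsub>W\<^esub> act A w"
  unfolding act_def W_simps using assms(1) W_in_M[OF assms(2)] W_in_M[OF assms(3)]
  by (simp only: R.r_distr)

lemma act_smult:
  assumes "A \<in> carrier M" "w \<in> carrier W" "c \<in> carrier F"
  shows "act A (c \<odot>\<^bsub>W\<^esub> w) = c \<odot>\<^bsub>W\<^esub> act A w"
  unfolding act_def W_simps using assms(1,3) W_in_M[OF assms(2)] by (simp only: smult_mult_right)

lemma add_act:
  assumes "A \<in> carrier M" "B \<in> carrier M" "w \<in> carrier W"
  shows "act (A \<oplus>\<^bsub>M\<^esub> B) w = act A w \<oplus>\<^bsub>W\<^esub> act B w"
  unfolding act_def W_simps using assms(1,2) W_in_M[OF assms(3)] by (simp only: R.l_distr)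

lemma smult_act:
  assumes "A \<in> carrier M" "w \<in> carrier W" "c \<in> carrier F"
  shows "act (c \<odot>\<^bsub>M\<^esub> A) w = c \<odot>\<^bsub>W\<^esub> act A w"
  unfolding act_def W_simps using assms(1,3) W_in_M[OF assms(2)] by (simp only: smult_mult_left)

lemma mult_act:
  assumes "A \<in> carrier M" "B \<in> carrier M" "w \<in> carrier W"
  shows "act (A \<otimes>\<^bsub>M\<^esub> B) w = act A (act B w)"
  unfolding act_def using assms(1,2) W_in_M[OF assms(3)] by (simp only: R.m_assoc)

lemma act_one: "w \<in> carrier W \<Longrightarrow> act \<one>\<^bsub>M\<^esub> w = w"
  using W_in_M by (simp add: act_def)

lemma act_zero: "A \<in> carrier M \<Longrightarrow> act A \<zero>\<^bsub>W\<^esub> = \<zero>\<^bsub>W\<^esub>"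
  by (simp add: act_def W_simps)

lemma act_zero_left: "w \<in> carrier W \<Longrightarrow> act \<zero>\<^bsub>M\<^esub> w = \<zero>\<^bsub>W\<^esub>"
  using W_in_M by (simp add: act_def W_simps)

definition unit_column :: "nat \<Rightarrow> nat \<times> nat \<Rightarrow> 'a" where
  "unit_column j = (\<lambda>(i, k)\<in>{..<d} \<times> {..<d}. if i = j \<and> k = 0 then \<one> else \<zero>)"

lemma unit_column_in_W: "unit_column j \<in> carrier W"
  by (auto simp: unit_column_def W_simps first_columns_def mat_algebra_simps)

lemma act_unit_column:
  assumes "A \<in> carrier M" "i < d" "j < d"
  shows "act A (unit_column j) (i, 0) = A (i, j)"
proof -
  have 0: "0 < d" using d_pos by simp
  note [simp] = mat_algebra_entry[OF assms(1)]
  have "act A (unit_column j) (i, 0) = (\<Oplus>l\<in>{..<d}. if j = l then A (i, l) else \<zero>)"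
    unfolding act_def entry_mult[OF assms(2) 0] using assms 0
    by (intro finsum_cong') (auto simp: unit_column_def)
  also have "\<dots> = A (i, j)"
    using assms by (intro finsum_singleton) auto
  finally show ?thesis .
qed

lemma act_faithful:
  assumes "A \<in> carrier M" "B \<in> carrier M" "\<And>w. w \<in> carrier W \<Longrightarrow> act A w = act B w"
  shows "A = B"
proof (rule mat_algebra_eqI[OF assms(1,2)])
  fix i j assume "i < d" "j < d"
  then show "A (i, j) = B (i, j)"
    using act_unit_column[OF assms(1), of i j] act_unit_column[OF assms(2), of i j] assms(3)[OF unit_column_in_W[of j]] by simp
qed

text \<open>A matrix is the sum of its columns, each placed into an otherwise zero matrix.\<close>

lemma all_matrices_if_all_columns:
  assumes sub: "S \<subseteq> carrier M" and zero: "\<zero>\<^bsub>M\<^esub> \<in> S"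
    and add: "\<And>A B. A \<in> S \<Longrightarrow> B \<in> S \<Longrightarrow> A \<oplus>\<^bsub>M\<^esub> B \<in> S"
    and col: "\<And>j w. j < d \<Longrightarrow> w \<in> carrier W \<Longrightarrow>
      \<exists>a\<in>S. act a (unit_column j) = w \<and> (\<forall>i<d. i \<noteq> j \<longrightarrow> act a (unit_column i) = \<zero>\<^bsub>W\<^esub>)"
  shows "S = carrier M"
proof
  show "carrier M \<subseteq> S"
  proof
    fix A assume A: "A \<in> carrier M"
    note [simp] = mat_algebra_entry[OF A]
    define T where "T k = (\<lambda>(i, j)\<in>{..<d} \<times> {..<d}. if j < k then A (i, j) else \<zero>)" for k
    have T: "T k \<in> carrier M" for k by (auto simp: T_def mat_algebra_simps)
    have T_entry: "T k (i, j) = (if j < k then A (i, j) else \<zero>)" if "i < d" "j < d" for i j k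
      using that by (simp add: T_def)
    have "k \<le> d \<Longrightarrow> T k \<in> S" for k
    proof (induction k)
      case 0
      have "T 0 = \<zero>\<^bsub>M\<^esub>" by (simp add: T_def mat_algebra_simps)
      then show ?case using zero by simp
    next
      case (Suc k)
      then have k: "k < d" by simp
      obtain a where a: "a \<in> S" "act a (unit_column k) = act A (unit_column k)"
        "\<And>i. i < d \<Longrightarrow> i \<noteq> k \<Longrightarrow> act a (unit_column i) = \<zero>\<^bsub>W\<^esub>"
        using col[OF k act_closed[OF A unit_column_in_W]] by blast
      have aM: "a \<in> carrier M" using a sub by blast
      have "a (i, j) = (if j = k then A (i, j) else \<zero>)" if "i < d" "j < d" for i j
        using act_unit_column[OF aM that] act_unit_column[OF A that] a(2) a(3)[OF that(2)] that d_pos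
        by (auto simp: W_simps entry_zero)
      then have "T (Suc k) = T k \<oplus>\<^bsub>M\<^esub> a"
        by (intro mat_algebra_eqI[OF T R.a_closed[OF T aM]])
          (auto simp: entry_add less_Suc_eq T_entry)
      then show ?case using add[OF Suc.IH a(1)] Suc.prems by simp
    qed
    moreover have "T d = A"
      by (intro mat_algebra_eqI[OF T A]) (simp add: T_entry)
    ultimately show "A \<in> S" by (metis order_refl)
  qed
qed (rule sub)

lemma unit_column_not_in_sp:
  assumes "j < d" "j \<notin> set js" "set js \<subseteq> {..<d}"
  shows "unit_column j \<notin> W.S.sp (map unit_column js)"
proof -
  let ?U = "{w \<in> carrier W. w (j, 0) = \<zero>}"
  have 0: "0 < d" using d_pos by simp
  have "W.S.submod ?U"
    unfolding W.S.submod_def unfolding W.scalars_def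
    using assms 0 by (auto simp: W_entry_simps)
  have "set (map unit_column js) \<subseteq> ?U"
    using assms 0 unit_column_in_W by (auto simp: unit_column_def)
  then have "W.S.sp (map unit_column js) \<subseteq> ?U" by (rule W.S.sp_least[OF \<open>W.S.submod ?U\<close>])
  moreover have "unit_column j (j, 0) \<noteq> \<zero>" using assms 0 by (simp add: unit_column_def)
  ultimately show ?thesis by blast
qed

end

section \<open>Burnside's theorem\<close>

context matrices_over_finite_field
begin

definition linear :: "((nat \<times> nat \<Rightarrow> 'a) \<Rightarrow> nat \<times> nat \<Rightarrow> 'a) \<Rightarrow> bool" where
  "linear T \<longleftrightarrow> (\<forall>x\<in>carrier W. T x \<in> carrier W) \<and>
     (\<forall>x\<in>carrier W. \<forall>y\<in>carrier W. T (x \<oplus>\<^bsub>W\<^esub> y) = T x \<oplus>\<^bsub>W\<^esub> T y) \<and>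
     (\<forall>c\<in>carrier F. \<forall>x\<in>carrier W. T (c \<odot>\<^bsub>W\<^esub> x) = c \<odot>\<^bsub>W\<^esub> T x)"

lemma linearD:
  assumes "linear T" "x \<in> carrier W"
  shows "T x \<in> carrier W" "y \<in> carrier W \<Longrightarrow> T (x \<oplus>\<^bsub>W\<^esub> y) = T x \<oplus>\<^bsub>W\<^esub> T y"
    "c \<in> carrier F \<Longrightarrow> T (c \<odot>\<^bsub>W\<^esub> x) = c \<odot>\<^bsub>W\<^esub> T x"
  using assms by (auto simp: linear_def)

lemma linear_zero: "linear T \<Longrightarrow> T \<zero>\<^bsub>W\<^esub> = \<zero>\<^bsub>W\<^esub>"
  using linearD(3)[of T "\<zero>\<^bsub>W\<^esub>" \<zero>] linearD(1)[of T "\<zero>\<^bsub>W\<^esub>"] by simp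

definition commute where
  "commute A T \<longleftrightarrow> (\<forall>w\<in>carrier W. T (act A w) = act A (T w))"

text \<open>The operators \<open>p(T)\<close> for polynomials \<open>p\<close> over \<open>F\<close>, generated by Horner's scheme.\<close>

inductive_set poly_ops :: "((nat \<times> nat \<Rightarrow> 'a) \<Rightarrow> nat \<times> nat \<Rightarrow> 'a) \<Rightarrow> ((nat \<times> nat \<Rightarrow> 'a) \<Rightarrow> nat \<times> nat \<Rightarrow> 'a) set"
  for T where
  zero: "(\<lambda>x. \<zero>\<^bsub>W\<^esub>) \<in> poly_ops T"
| horner: "f \<in> poly_ops T \<Longrightarrow> c \<in> carrier F \<Longrightarrow> (\<lambda>x. c \<odot>\<^bsub>W\<^esub> x \<oplus>\<^bsub>W\<^esub> T (f x)) \<in> poly_ops T"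

lemma linear_poly_ops: "f \<in> poly_ops T \<Longrightarrow> linear T \<Longrightarrow> linear f"
proof (induction rule: poly_ops.induct)
  case zero
  then show ?case by (simp add: linear_def)
next
  case (horner f c)
  then have f: "linear f" and T: "linear T" by auto
  note [simp] = linearD[OF f] linearD[OF T] horner(2)
  show ?case unfolding linear_def
  proof (intro conjI ballI)
    fix x y assume "x \<in> carrier W" "y \<in> carrier W"
    then show "c \<odot>\<^bsub>W\<^esub> (x \<oplus>\<^bsub>W\<^esub> y) \<oplus>\<^bsub>W\<^esub> T (f (x \<oplus>\<^bsub>W\<^esub> y)) =
      (c \<odot>\<^bsub>W\<^esub> x \<oplus>\<^bsub>W\<^esub> T (f x)) \<oplus>\<^bsub>W\<^esub> (c \<odot>\<^bsub>W\<^esub> y \<oplus>\<^bsub>W\<^esub> T (f y))"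
      by (simp add: W.smult_r_distr W.M.add.m_ac)
  next
    fix a x assume "a \<in> carrier F" "x \<in> carrier W"
    then show "c \<odot>\<^bsub>W\<^esub> (a \<odot>\<^bsub>W\<^esub> x) \<oplus>\<^bsub>W\<^esub> T (f (a \<odot>\<^bsub>W\<^esub> x)) =
      a \<odot>\<^bsub>W\<^esub> (c \<odot>\<^bsub>W\<^esub> x \<oplus>\<^bsub>W\<^esub> T (f x))"
      by (simp add: W.smult_r_distr m_comm flip: W.smult_assoc1)
  qed auto
qed

lemma commute_poly_ops:
  assumes "linear T" "A \<in> carrier M" "commute A T"
  shows "f \<in> poly_ops T \<Longrightarrow> commute A f"
proof (induction rule: poly_ops.induct)
  case zero
  then show ?case using act_zero[OF assms(2)] by (simp add: commute_def)
next
  case (horner f c)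
  have f: "linear f" using linear_poly_ops horner assms by blast
  show ?case unfolding commute_def
  proof
    fix w assume w: "w \<in> carrier W"
    note [simp] = linearD[OF f] linearD[OF assms(1)] horner(2) w assms(2) act_closed
    have fw: "f (act A w) = act A (f w)" using horner.IH w by (simp add: commute_def)
    have "T (act A (f w)) = act A (T (f w))" using assms(3) by (simp add: commute_def)
    then show "c \<odot>\<^bsub>W\<^esub> act A w \<oplus>\<^bsub>W\<^esub> T (f (act A w)) = act A (c \<odot>\<^bsub>W\<^esub> w \<oplus>\<^bsub>W\<^esub> T (f w))"
      unfolding fw using act_add[of A "c \<odot>\<^bsub>W\<^esub> w" "T (f w)"] act_smult[of A w c] by simp
  qed
qed

text \<open>The algebra \<open>F[T]\<close> has no zero divisors in its action on the columns. As everything is finite,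
\<open>F[T]\<close> is then a field.\<close>

definition fieldlike where
  "fieldlike T \<longleftrightarrow> linear T \<and> (\<forall>f\<in>poly_ops T. \<forall>x\<in>carrier W. x \<noteq> \<zero>\<^bsub>W\<^esub> \<longrightarrow> f x = \<zero>\<^bsub>W\<^esub> \<longrightarrow>
     (\<forall>y\<in>carrier W. f y = \<zero>\<^bsub>W\<^esub>))"

definition scalar_op where
  "scalar_op T \<longleftrightarrow> (\<exists>c\<in>carrier F. \<forall>w\<in>carrier W. T w = c \<odot>\<^bsub>W\<^esub> w)"

lemma act_diff_eq_zero:
  assumes "A \<in> carrier M" "B \<in> carrier M" "w \<in> carrier W"
  shows "act (A \<ominus>\<^bsub>M\<^esub> B) w = \<zero>\<^bsub>W\<^esub> \<longleftrightarrow> act A w = act B w"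
proof -
  have "A = (A \<ominus>\<^bsub>M\<^esub> B) \<oplus>\<^bsub>M\<^esub> B"
    using assms by (simp add: R.minus_eq R.a_assoc R.l_neg)
  then have "act A w = act (A \<ominus>\<^bsub>M\<^esub> B) w \<oplus>\<^bsub>W\<^esub> act B w"
    using add_act[of "A \<ominus>\<^bsub>M\<^esub> B" B w] assms by simp
  then show ?thesis
    using act_closed[of "A \<ominus>\<^bsub>M\<^esub> B" w] act_closed[of B w] assms
    by (simp add: W.M.add.r_cancel_one)
qed

lemma submod_W_I:
  assumes "U \<subseteq> carrier W" "\<zero>\<^bsub>W\<^esub> \<in> U" "\<And>x y. x \<in> U \<Longrightarrow> y \<in> U \<Longrightarrow> x \<oplus>\<^bsub>W\<^esub> y \<in> U"
    "\<And>c x. c \<in> carrier F \<Longrightarrow> x \<in> U \<Longrightarrow> c \<odot>\<^bsub>W\<^esub> x \<in> U"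
  shows "W.S.submod U"
  unfolding W.S.submod_def unfolding W.scalars_def using assms by auto

lemma kernel_submod:
  assumes "linear f"
  shows "W.S.submod {x \<in> carrier W. f x = \<zero>\<^bsub>W\<^esub>}"
  by (rule submod_W_I) (use linearD[OF assms] linear_zero[OF assms] in auto)

lemma linear_act: "A \<in> carrier M \<Longrightarrow> linear (act A)"
  unfolding linear_def using act_closed act_add act_smult by blast

end

locale irreducible_subalgebra = matrices_over_finite_field +
  fixes S
  assumes subalgebra: "unital_subalgebra F S M"
    and irreducible: "W.S.submod U \<Longrightarrow> (\<And>A u. A \<in> S \<Longrightarrow> u \<in> U \<Longrightarrow> act A u \<in> U) \<Longrightarrow>
      U = {\<zero>\<^bsub>W\<^esub>} \<or> U = carrier W"
begin

lemma S_closed: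
  "A \<in> S \<Longrightarrow> A \<in> carrier M" "\<zero>\<^bsub>M\<^esub> \<in> S" "\<one>\<^bsub>M\<^esub> \<in> S"
  "A \<in> S \<Longrightarrow> B \<in> S \<Longrightarrow> A \<oplus>\<^bsub>M\<^esub> B \<in> S" "A \<in> S \<Longrightarrow> B \<in> S \<Longrightarrow> A \<ominus>\<^bsub>M\<^esub> B \<in> S"
  "A \<in> S \<Longrightarrow> B \<in> S \<Longrightarrow> A \<otimes>\<^bsub>M\<^esub> B \<in> S" "c \<in> carrier F \<Longrightarrow> A \<in> S \<Longrightarrow> c \<odot>\<^bsub>M\<^esub> A \<in> S"
proof -
  have S: "subring S M" and sm: "\<forall>c\<in>carrier F. \<forall>a\<in>S. c \<odot>\<^bsub>M\<^esub> a \<in> S"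
    using subalgebra by (auto simp: unital_subalgebra_def)
  note E = subringE[OF S]
  show "A \<in> S \<Longrightarrow> A \<in> carrier M" "\<zero>\<^bsub>M\<^esub> \<in> S" "\<one>\<^bsub>M\<^esub> \<in> S"
    "A \<in> S \<Longrightarrow> B \<in> S \<Longrightarrow> A \<oplus>\<^bsub>M\<^esub> B \<in> S" "A \<in> S \<Longrightarrow> B \<in> S \<Longrightarrow> A \<ominus>\<^bsub>M\<^esub> B \<in> S"
    "A \<in> S \<Longrightarrow> B \<in> S \<Longrightarrow> A \<otimes>\<^bsub>M\<^esub> B \<in> S" "c \<in> carrier F \<Longrightarrow> A \<in> S \<Longrightarrow> c \<odot>\<^bsub>M\<^esub> A \<in> S"
    using E sm by (auto simp: a_minus_def)
qed

text \<open>Schur's lemma: the kernel of an operator that commutes with an irreducible algebra is invariant.\<close>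

lemma fieldlike_if_commutes:
  assumes "linear T" "\<And>A. A \<in> S \<Longrightarrow> commute A T"
  shows "fieldlike T"
  unfolding fieldlike_def
proof (intro conjI ballI impI assms(1))
  fix f x y
  assume f: "f \<in> poly_ops T" and x: "x \<in> carrier W" "x \<noteq> \<zero>\<^bsub>W\<^esub>" "f x = \<zero>\<^bsub>W\<^esub>" and y: "y \<in> carrier W"
  let ?U = "{x \<in> carrier W. f x = \<zero>\<^bsub>W\<^esub>}"
  have lf: "linear f" using linear_poly_ops[OF f assms(1)] .
  have "?U = {\<zero>\<^bsub>W\<^esub>} \<or> ?U = carrier W"
  proof (rule irreducible[OF kernel_submod[OF lf]])
    fix A u assume A: "A \<in> S" and u: "u \<in> ?U"
    have "commute A f"
      using commute_poly_ops[OF assms(1) S_closed(1)[OF A] assms(2)[OF A] f] .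
    then show "act A u \<in> ?U"
      using u act_closed S_closed(1)[OF A] act_zero by (simp add: commute_def)
  qed
  then show "f y = \<zero>\<^bsub>W\<^esub>" using x y by auto
qed

definition ann where
  "ann bs = {a \<in> S. \<forall>v\<in>set bs. act a v = \<zero>\<^bsub>W\<^esub>}"

lemma ann_closed:
  assumes "set bs \<subseteq> carrier W"
  shows "\<zero>\<^bsub>M\<^esub> \<in> ann bs"
    "A \<in> ann bs \<Longrightarrow> B \<in> ann bs \<Longrightarrow> A \<oplus>\<^bsub>M\<^esub> B \<in> ann bs"
    "A \<in> ann bs \<Longrightarrow> B \<in> ann bs \<Longrightarrow> A \<ominus>\<^bsub>M\<^esub> B \<in> ann bs"
    "A \<in> S \<Longrightarrow> B \<in> ann bs \<Longrightarrow> A \<otimes>\<^bsub>M\<^esub> B \<in> ann bs"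
    "c \<in> carrier F \<Longrightarrow> B \<in> ann bs \<Longrightarrow> c \<odot>\<^bsub>M\<^esub> B \<in> ann bs"
proof -
  have W: "v \<in> carrier W" if "v \<in> set bs" for v using assms that by auto
  show "\<zero>\<^bsub>M\<^esub> \<in> ann bs" using W by (simp add: ann_def S_closed act_zero_left)
  show "A \<oplus>\<^bsub>M\<^esub> B \<in> ann bs" if "A \<in> ann bs" "B \<in> ann bs"
    using that W add_act[of A B _] by (simp add: ann_def S_closed)
  show "A \<ominus>\<^bsub>M\<^esub> B \<in> ann bs" if "A \<in> ann bs" "B \<in> ann bs"
    using that W by (simp add: ann_def S_closed act_diff_eq_zero)
  show "A \<otimes>\<^bsub>M\<^esub> B \<in> ann bs" if "A \<in> S" "B \<in> ann bs"
    using that W mult_act[of A B _] by (simp add: ann_def S_closed act_zero)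
  show "c \<odot>\<^bsub>M\<^esub> B \<in> ann bs" if "c \<in> carrier F" "B \<in> ann bs"
    using that W smult_act[of B _ c] by (simp add: ann_def S_closed)
qed

text \<open>The matrices that kill \<open>bs\<close> form a left ideal of \<open>S\<close>, so the vectors to which they carry \<open>v\<close> form
an invariant subspace.\<close>

lemma ann_transitive:
  assumes bs: "set bs \<subseteq> carrier W" and v: "v \<in> carrier W"
    and a: "a \<in> ann bs" "act a v \<noteq> \<zero>\<^bsub>W\<^esub>" and y: "y \<in> carrier W"
  shows "\<exists>a\<in>ann bs. act a v = y"
proof -
  let ?U = "(\<lambda>a. act a v) ` ann bs"
  have M: "a \<in> carrier M" if "a \<in> ann bs" for a using that S_closed(1) by (simp add: ann_def)
  have "?U = {\<zero>\<^bsub>W\<^esub>} \<or> ?U = carrier W"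
  proof (rule irreducible)
    show "W.S.submod ?U"
    proof (rule submod_W_I)
      show "?U \<subseteq> carrier W" using M act_closed v by auto
      show "\<zero>\<^bsub>W\<^esub> \<in> ?U" using ann_closed(1)[OF bs] act_zero_left[OF v] by force
    next
      fix x y assume "x \<in> ?U" "y \<in> ?U"
      then obtain a b where ab: "a \<in> ann bs" "b \<in> ann bs" "x = act a v" "y = act b v" by blast
      then have "x \<oplus>\<^bsub>W\<^esub> y = act (a \<oplus>\<^bsub>M\<^esub> b) v"
        using add_act[of a b v] M v by simp
      then show "x \<oplus>\<^bsub>W\<^esub> y \<in> ?U" using ann_closed(2)[OF bs ab(1,2)] by (rule image_eqI)
    next
      fix c x assume c: "c \<in> carrier F" and "x \<in> ?U"
      then obtain a where a: "a \<in> ann bs" "x = act a v" by blast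
      then have "c \<odot>\<^bsub>W\<^esub> x = act (c \<odot>\<^bsub>M\<^esub> a) v"
        using smult_act[of a v c] M v c by simp
      then show "c \<odot>\<^bsub>W\<^esub> x \<in> ?U" using ann_closed(5)[OF bs c a(1)] by (rule image_eqI)
    qed
    fix A u assume A: "A \<in> S" and "u \<in> ?U"
    then obtain a where a: "a \<in> ann bs" "u = act a v" by blast
    then have "act A u = act (A \<otimes>\<^bsub>M\<^esub> a) v"
      using mult_act[of A a v] M v S_closed(1)[OF A] by simp
    then show "act A u \<in> ?U" using ann_closed(4)[OF bs A a(1)] by (rule image_eqI)
  qed
  moreover have "act a v \<in> ?U" using a by blast
  ultimately have "y \<in> ?U" using a(2) y by blast
  then show ?thesis by blast
qed

lemma ann_sp:
  assumes "set bs \<subseteq> carrier W" "a \<in> ann bs" "w \<in> W.S.sp bs"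
  shows "act a w = \<zero>\<^bsub>W\<^esub>"
proof -
  have "a \<in> carrier M" using assms(2) S_closed(1) by (simp add: ann_def)
  then have "W.S.sp bs \<subseteq> {x \<in> carrier W. act a x = \<zero>\<^bsub>W\<^esub>}"
    using assms(1,2) by (intro W.S.sp_least kernel_submod linear_act) (auto simp: ann_def)
  then show ?thesis using assms(3) by blast
qed

text \<open>The Jacobson density theorem in the case where only scalars commute with \<open>S\<close>. By induction, the
annihilator \<open>I\<close> of \<open>bs\<close> satisfies \<open>I v = W\<close> whenever \<open>v\<close> is outside the span of \<open>bs\<close>. If every
element of \<open>I\<close> that kills \<open>v\<close> also killed \<open>w\<close>, then \<open>a v\<close> would determine \<open>a w\<close> for \<open>a\<close> in \<open>I\<close>.
The resulting map \<open>T\<close> commutes with \<open>S\<close>, so it is a scalar \<open>c\<close>, and \<open>I\<close> kills \<open>w - c v\<close>. By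
induction \<open>w - c v\<close> is in the span of \<open>bs\<close>, so \<open>w\<close> is in the span of \<open>v # bs\<close>.\<close>

lemma density:
  assumes scalar: "\<And>T. fieldlike T \<Longrightarrow> (\<And>A. A \<in> S \<Longrightarrow> commute A T) \<Longrightarrow> T \<in> extensional (carrier W) \<Longrightarrow> scalar_op T"
  shows "set bs \<subseteq> carrier W \<Longrightarrow> w \<in> carrier W \<Longrightarrow> w \<notin> W.S.sp bs \<Longrightarrow>
    \<exists>a\<in>ann bs. act a w \<noteq> \<zero>\<^bsub>W\<^esub>"
proof (induction bs arbitrary: w)
  case Nil
  then show ?case
    using S_closed(3) by (intro bexI[of _ "\<one>\<^bsub>M\<^esub>"]) (auto simp: ann_def act_one)
next
  case (Cons v bs)
  then have bs: "set bs \<subseteq> carrier W" and v: "v \<in> carrier W" and w: "w \<in> carrier W" by auto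
  have M: "a \<in> carrier M" if "a \<in> ann bs" for a using that S_closed(1) by (simp add: ann_def)
  have w': "w \<notin> W.S.sp bs" using Cons.prems(3) W.S.sp_subset_Cons[OF v bs] by blast
  have ann_Cons: "a \<in> ann (v # bs) \<longleftrightarrow> a \<in> ann bs \<and> act a v = \<zero>\<^bsub>W\<^esub>" for a
    by (auto simp: ann_def)
  show ?case
  proof (cases "v \<in> W.S.sp bs")
    case True
    then show ?thesis using Cons.IH[OF bs w w'] ann_sp[OF bs _ True] ann_Cons by blast
  next
    case False
    show ?thesis
    proof (rule ccontr)
      assume "\<not> ?thesis"
      then have kill: "act a w = \<zero>\<^bsub>W\<^esub>" if "a \<in> ann bs" "act a v = \<zero>\<^bsub>W\<^esub>" for a
        using that ann_Cons by blast
      have onto: "\<exists>a\<in>ann bs. act a v = y" if "y \<in> carrier W" for y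
        using Cons.IH[OF bs v False] ann_transitive[OF bs v _ _ that] by blast
      define T where "T = (\<lambda>x\<in>carrier W. act (SOME a. a \<in> ann bs \<and> act a v = x) w)"
      have T: "T (act a v) = act a w" if a: "a \<in> ann bs" for a
      proof -
        let ?b = "SOME b. b \<in> ann bs \<and> act b v = act a v"
        have b: "?b \<in> ann bs \<and> act ?b v = act a v" by (rule someI[of _ a]) (use a in simp)
        then have "act (?b \<ominus>\<^bsub>M\<^esub> a) v = \<zero>\<^bsub>W\<^esub>" using act_diff_eq_zero M a v by simp
        then have "act (?b \<ominus>\<^bsub>M\<^esub> a) w = \<zero>\<^bsub>W\<^esub>" using kill ann_closed(3)[OF bs] b a by simp
        then have "act ?b w = act a w" using act_diff_eq_zero M a w b by simp
        then show ?thesis using act_closed M a v by (simp add: T_def)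
      qed
      have "linear T" unfolding linear_def
      proof (intro conjI ballI)
        fix x assume x: "x \<in> carrier W"
        then obtain a where a: "a \<in> ann bs" "act a v = x" using onto by blast
        show "T x \<in> carrier W" using T[OF a(1)] a act_closed M w by simp
        fix y assume "y \<in> carrier W"
        then obtain b where b: "b \<in> ann bs" "act b v = y" using onto by blast
        have "T (x \<oplus>\<^bsub>W\<^esub> y) = T (act (a \<oplus>\<^bsub>M\<^esub> b) v)"
          using add_act[of a b v] M a b v by simp
        also have "\<dots> = act a w \<oplus>\<^bsub>W\<^esub> act b w"
          using T[OF ann_closed(2)[OF bs a(1) b(1)]] add_act[of a b w] M a b w by simp
        also have "\<dots> = T x \<oplus>\<^bsub>W\<^esub> T y" using T a b by force
        finally show "T (x \<oplus>\<^bsub>W\<^esub> y) = T x \<oplus>\<^bsub>W\<^esub> T y" .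
      next
        fix c x assume c: "c \<in> carrier F" and x: "x \<in> carrier W"
        then obtain a where a: "a \<in> ann bs" "act a v = x" using onto by blast
        have "T (c \<odot>\<^bsub>W\<^esub> x) = T (act (c \<odot>\<^bsub>M\<^esub> a) v)"
          using smult_act[of a v c] M a c v by simp
        also have "\<dots> = c \<odot>\<^bsub>W\<^esub> T x"
          using T[OF ann_closed(5)[OF bs c a(1)]] T[OF a(1)] smult_act[of a w c] M a c w by simp
        finally show "T (c \<odot>\<^bsub>W\<^esub> x) = c \<odot>\<^bsub>W\<^esub> T x" .
      qed
      moreover have comm: "commute A T" if A: "A \<in> S" for A
        unfolding commute_def
      proof
        fix x assume "x \<in> carrier W"
        then obtain a where a: "a \<in> ann bs" "act a v = x" using onto by blast
        have "T (act A x) = T (act (A \<otimes>\<^bsub>M\<^esub> a) v)"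
          using mult_act[of A a v] M a v S_closed(1)[OF A] by simp
        also have "\<dots> = act A (T x)"
          using T[OF ann_closed(4)[OF bs A a(1)]] T[OF a(1)] mult_act[of A a w]
            M a w S_closed(1)[OF A] by simp
        finally show "T (act A x) = act A (T x)" .
      qed
      moreover have "T \<in> extensional (carrier W)" by (simp add: T_def)
      ultimately obtain c where c: "c \<in> carrier F" "\<And>x. x \<in> carrier W \<Longrightarrow> T x = c \<odot>\<^bsub>W\<^esub> x"
        using scalar[of T] fieldlike_if_commutes[of T] by (auto simp: scalar_op_def)
      have cv: "c \<odot>\<^bsub>W\<^esub> v \<in> carrier W" using c v by simp
      have "w \<ominus>\<^bsub>W\<^esub> c \<odot>\<^bsub>W\<^esub> v \<in> W.S.sp bs"
      proof (rule ccontr)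
        assume "\<not> ?thesis"
        then obtain a where a: "a \<in> ann bs" "act a (w \<ominus>\<^bsub>W\<^esub> c \<odot>\<^bsub>W\<^esub> v) \<noteq> \<zero>\<^bsub>W\<^esub>"
          using Cons.IH[OF bs, of "w \<ominus>\<^bsub>W\<^esub> c \<odot>\<^bsub>W\<^esub> v"] w cv by auto
        have "w = (w \<ominus>\<^bsub>W\<^esub> c \<odot>\<^bsub>W\<^esub> v) \<oplus>\<^bsub>W\<^esub> c \<odot>\<^bsub>W\<^esub> v"
          using w cv by (simp add: W.M.minus_eq W.M.a_assoc W.M.l_neg)
        then have "act a w = act a (w \<ominus>\<^bsub>W\<^esub> c \<odot>\<^bsub>W\<^esub> v) \<oplus>\<^bsub>W\<^esub> act a (c \<odot>\<^bsub>W\<^esub> v)"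
          using act_add[of a "w \<ominus>\<^bsub>W\<^esub> c \<odot>\<^bsub>W\<^esub> v" "c \<odot>\<^bsub>W\<^esub> v"] M[OF a(1)] w cv c by simp
        moreover have "act a (c \<odot>\<^bsub>W\<^esub> v) = act a w"
          using T[OF a(1)] c act_smult[of a v c] act_closed M[OF a(1)] v by simp
        ultimately show False
          using a(2) act_closed[OF M[OF a(1)]] w cv by (simp add: W.M.add.r_cancel_one)
      qed
      moreover have "c \<odot>\<^bsub>W\<^esub> v \<oplus>\<^bsub>W\<^esub> (w \<ominus>\<^bsub>W\<^esub> c \<odot>\<^bsub>W\<^esub> v) = w"
        using w cv by (simp add: W.M.minus_eq W.M.a_lcomm W.M.r_neg)
      moreover have "(\<lambda>x. c \<odot>\<^bsub>W\<^esub> x) \<in> W.scalars" using c by (auto simp: W.scalars_def)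
      ultimately have "w \<in> W.S.sp (v # bs)" using W.S.sp_ConsI by metis
      then show False using Cons.prems(3) by blast
    qed
  qed
qed

text \<open>Otherwise density, applied to each standard basis vector and all the others as \<open>bs\<close>, shows that
\<open>S\<close> contains every matrix with a single nonzero column.\<close>

theorem burnside:
  assumes "S \<noteq> carrier M"
  shows "\<exists>T. fieldlike T \<and> (\<forall>A\<in>S. commute A T) \<and> T \<in> extensional (carrier W) \<and> \<not> scalar_op T"
proof (rule ccontr)
  assume "\<not> ?thesis"
  then have scalar: "scalar_op T"
    if "fieldlike T" "\<And>A. A \<in> S \<Longrightarrow> commute A T" "T \<in> extensional (carrier W)" for T
    using that by blast
  have "S = carrier M"
  proof (rule all_matrices_if_all_columns)
    fix j w assume j: "j < d" and w: "w \<in> carrier W"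
    let ?js = "filter (\<lambda>i. i \<noteq> j) [0..<d]"
    have W: "set (map unit_column ?js) \<subseteq> carrier W" using unit_column_in_W by auto
    have "unit_column j \<notin> W.S.sp (map unit_column ?js)" using j by (intro unit_column_not_in_sp) auto
    then obtain a where "a \<in> ann (map unit_column ?js)" "act a (unit_column j) \<noteq> \<zero>\<^bsub>W\<^esub>"
      using density[OF scalar W unit_column_in_W] by blast
    then obtain b where "b \<in> ann (map unit_column ?js)" "act b (unit_column j) = w"
      using ann_transitive[OF W unit_column_in_W _ _ w] by blast
    then show "\<exists>a\<in>S. act a (unit_column j) = w \<and> (\<forall>i<d. i \<noteq> j \<longrightarrow> act a (unit_column i) = \<zero>\<^bsub>W\<^esub>)"
      by (intro bexI[of _ b]) (auto simp: ann_def)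
  qed (use S_closed in auto)
  then show False using assms by blast
qed

end

section \<open>Operators that generate a field\<close>

text \<open>The powers are listed in descending order, so that passing from \<open>k\<close> to \<open>Suc k\<close> adds a new head as
in the recursion of spans, and the last entry is \<open>v\<close>.\<close>

definition krylov :: "('a \<Rightarrow> 'a) \<Rightarrow> nat \<Rightarrow> 'a \<Rightarrow> 'a list" where
  "krylov T k v = map (\<lambda>i. (T ^^ i) v) (rev [0..<k])"

lemma krylov_simps: "krylov T 0 v = []" "krylov T (Suc k) v = (T ^^ k) v # krylov T k v"
  by (simp_all add: krylov_def)

context matrices_over_finite_field
begin

lemma poly_ops_closed: "f \<in> poly_ops T \<Longrightarrow> linear T \<Longrightarrow> x \<in> carrier W \<Longrightarrow> f x \<in> carrier W"
  using linear_poly_ops linearD(1) by blast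

lemma poly_ops_add:
  assumes "linear T"
  shows "f \<in> poly_ops T \<Longrightarrow> g \<in> poly_ops T \<Longrightarrow> \<exists>h\<in>poly_ops T. \<forall>x\<in>carrier W. h x = f x \<oplus>\<^bsub>W\<^esub> g x"
proof (induction arbitrary: g rule: poly_ops.induct)
  case zero
  then show ?case using poly_ops_closed[OF zero assms] by (intro bexI[of _ g]) simp_all
next
  case (horner f c)
  from horner.prems show ?case
  proof (cases rule: poly_ops.cases)
    case zero
    then show ?thesis
      using poly_ops_closed[OF poly_ops.horner[OF horner(1,2)] assms] poly_ops.horner[OF horner(1,2)]
      by (intro bexI[of _ "\<lambda>x. c \<odot>\<^bsub>W\<^esub> x \<oplus>\<^bsub>W\<^esub> T (f x)"]) simp_all
  next
    case (horner g' b)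
    obtain h where h: "h \<in> poly_ops T" "\<forall>x\<in>carrier W. h x = f x \<oplus>\<^bsub>W\<^esub> g' x"
      using horner.IH[OF horner(2)] by blast
    have "\<forall>x\<in>carrier W. (c \<oplus> b) \<odot>\<^bsub>W\<^esub> x \<oplus>\<^bsub>W\<^esub> T (h x) =
        (c \<odot>\<^bsub>W\<^esub> x \<oplus>\<^bsub>W\<^esub> T (f x)) \<oplus>\<^bsub>W\<^esub> g x"
    proof
      fix x assume x: "x \<in> carrier W"
      have fg: "f x \<in> carrier W" "g' x \<in> carrier W"
        using poly_ops_closed[OF _ assms x] \<open>f \<in> poly_ops T\<close> horner(2) by blast+
      have "g x = b \<odot>\<^bsub>W\<^esub> x \<oplus>\<^bsub>W\<^esub> T (g' x)" using horner(1) by simp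
      moreover have "T (h x) = T (f x) \<oplus>\<^bsub>W\<^esub> T (g' x)" using h(2) x linearD(2)[OF assms fg] by simp
      ultimately show "(c \<oplus> b) \<odot>\<^bsub>W\<^esub> x \<oplus>\<^bsub>W\<^esub> T (h x) = (c \<odot>\<^bsub>W\<^esub> x \<oplus>\<^bsub>W\<^esub> T (f x)) \<oplus>\<^bsub>W\<^esub> g x"
        using x fg horner(3) \<open>c \<in> carrier F\<close> linearD(1)[OF assms]
        by (simp add: W.smult_l_distr W.M.add.m_ac)
    qed
    moreover have "(\<lambda>x. (c \<oplus> b) \<odot>\<^bsub>W\<^esub> x \<oplus>\<^bsub>W\<^esub> T (h x)) \<in> poly_ops T"
      using poly_ops.horner[OF h(1)] horner(3) \<open>c \<in> carrier F\<close> by simp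
    ultimately show ?thesis by (rule bexI)
  qed
qed

lemma poly_ops_smult:
  assumes "linear T" "a \<in> carrier F"
  shows "f \<in> poly_ops T \<Longrightarrow> \<exists>h\<in>poly_ops T. \<forall>x\<in>carrier W. h x = a \<odot>\<^bsub>W\<^esub> f x"
proof (induction rule: poly_ops.induct)
  case zero
  then show ?case using poly_ops.zero[of T] assms(2) by (intro bexI[of _ "\<lambda>x. \<zero>\<^bsub>W\<^esub>"]) auto
next
  case (horner f c)
  then obtain h where h: "h \<in> poly_ops T" "\<forall>x\<in>carrier W. h x = a \<odot>\<^bsub>W\<^esub> f x" by blast
  have "\<forall>x\<in>carrier W. (a \<otimes> c) \<odot>\<^bsub>W\<^esub> x \<oplus>\<^bsub>W\<^esub> T (h x) = a \<odot>\<^bsub>W\<^esub> (c \<odot>\<^bsub>W\<^esub> x \<oplus>\<^bsub>W\<^esub> T (f x))"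
  proof
    fix x assume x: "x \<in> carrier W"
    have f: "f x \<in> carrier W" by (rule poly_ops_closed[OF horner(1) assms(1) x])
    have "T (h x) = a \<odot>\<^bsub>W\<^esub> T (f x)" using h(2) x linearD(3)[OF assms(1) f assms(2)] by simp
    then show "(a \<otimes> c) \<odot>\<^bsub>W\<^esub> x \<oplus>\<^bsub>W\<^esub> T (h x) = a \<odot>\<^bsub>W\<^esub> (c \<odot>\<^bsub>W\<^esub> x \<oplus>\<^bsub>W\<^esub> T (f x))"
      using x assms(2) horner(2) linearD(1)[OF assms(1) f] by (simp add: W.smult_r_distr W.smult_assoc1)
  qed
  moreover have "(\<lambda>x. (a \<otimes> c) \<odot>\<^bsub>W\<^esub> x \<oplus>\<^bsub>W\<^esub> T (h x)) \<in> poly_ops T"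
    using poly_ops.horner[OF h(1)] assms(2) horner(2) by simp
  ultimately show ?case by (rule bexI)
qed

lemma poly_ops_apply:
  assumes "linear T" "f \<in> poly_ops T"
  shows "\<exists>h\<in>poly_ops T. \<forall>x\<in>carrier W. h x = T (f x)"
  using poly_ops.horner[OF assms(2) zero_closed] linearD(1)[OF assms(1) poly_ops_closed[OF assms(2,1)]]
  by (intro bexI[of _ "\<lambda>x. \<zero> \<odot>\<^bsub>W\<^esub> x \<oplus>\<^bsub>W\<^esub> T (f x)"]) simp_all

lemma poly_ops_scalar:
  assumes "linear T" "c \<in> carrier F"
  shows "\<exists>h\<in>poly_ops T. \<forall>x\<in>carrier W. h x = c \<odot>\<^bsub>W\<^esub> x"
  using poly_ops.horner[OF poly_ops.zero assms(2), of T] linear_zero[OF assms(1)] assms(2)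
  by (intro bexI[of _ "\<lambda>x. c \<odot>\<^bsub>W\<^esub> x \<oplus>\<^bsub>W\<^esub> T \<zero>\<^bsub>W\<^esub>"]) simp_all

lemma poly_ops_comp:
  assumes T: "linear T" and g: "g \<in> poly_ops T"
  shows "f \<in> poly_ops T \<Longrightarrow> \<exists>h\<in>poly_ops T. \<forall>x\<in>carrier W. h x = f (g x)"
proof (induction rule: poly_ops.induct)
  case zero
  show ?case using poly_ops.zero by (intro bexI[of _ "\<lambda>x. \<zero>\<^bsub>W\<^esub>"]) simp_all
next
  case (horner f c)
  then obtain h where h: "h \<in> poly_ops T" "\<forall>x\<in>carrier W. h x = f (g x)" by blast
  obtain k where k: "k \<in> poly_ops T" "\<forall>x\<in>carrier W. k x = T (h x)"
    using poly_ops_apply[OF T h(1)] by blast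
  obtain l where l: "l \<in> poly_ops T" "\<forall>x\<in>carrier W. l x = c \<odot>\<^bsub>W\<^esub> g x"
    using poly_ops_smult[OF T horner(2) g] by blast
  obtain p where "p \<in> poly_ops T" "\<forall>x\<in>carrier W. p x = l x \<oplus>\<^bsub>W\<^esub> k x"
    using poly_ops_add[OF T l(1) k(1)] by blast
  then show ?case using k l h by (intro bexI[of _ p]) simp_all
qed

lemma poly_ops_power:
  assumes "linear T"
  shows "\<exists>h\<in>poly_ops T. \<forall>x\<in>carrier W. h x = (T ^^ i) x"
proof (induction i)
  case 0
  then show ?case using poly_ops_scalar[OF assms one_closed] by simp
next
  case (Suc i)
  then obtain h where h: "h \<in> poly_ops T" "\<forall>x\<in>carrier W. h x = (T ^^ i) x" by blast
  show ?case using poly_ops_apply[OF assms h(1)] h(2) by simp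
qed

lemma power_closed:
  assumes "linear T" "x \<in> carrier W"
  shows "(T ^^ i) x \<in> carrier W"
  by (induction i) (use assms linearD in auto)

lemma krylov_closed: "linear T \<Longrightarrow> v \<in> carrier W \<Longrightarrow> set (krylov T k v) \<subseteq> carrier W"
  using power_closed by (auto simp: krylov_def)

end

locale fieldlike_operator = matrices_over_finite_field +
  fixes T
  assumes fieldlike: "fieldlike T"
begin

lemma linear_T: "linear T"
  using fieldlike by (simp add: fieldlike_def)

sublocale P: division_operators W "poly_ops T"
proof (intro division_operators.intro division_operators_axioms.intro W.M.abelian_group_axioms)
  fix f x y
  assume "f \<in> poly_ops T" "x \<in> carrier W" "x \<noteq> \<zero>\<^bsub>W\<^esub>" "f x = \<zero>\<^bsub>W\<^esub>" "y \<in> carrier W"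
  then show "f y = \<zero>\<^bsub>W\<^esub>" using fieldlike unfolding fieldlike_def by simp
next
  fix f assume f: "f \<in> poly_ops T"
  obtain h where h: "h \<in> poly_ops T" "\<forall>x\<in>carrier W. h x = (\<ominus> \<one>) \<odot>\<^bsub>W\<^esub> f x"
    using poly_ops_smult[OF linear_T _ f, of "\<ominus> \<one>"] by auto
  moreover have "(\<ominus> \<one>) \<odot>\<^bsub>W\<^esub> f x = \<ominus>\<^bsub>W\<^esub> f x" if "x \<in> carrier W" for x
    using W.smult_l_minus[OF one_closed] poly_ops_closed[OF f linear_T that] by simp
  ultimately show "\<exists>h\<in>poly_ops T. \<forall>x\<in>carrier W. h x = \<ominus>\<^bsub>W\<^esub> f x"
    by (intro bexI[of _ h]) simp_all
next
  show "\<exists>h\<in>poly_ops T. \<forall>x\<in>carrier W. h x = x"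
    using poly_ops_scalar[OF linear_T one_closed] by simp
next
  fix f x assume f: "f \<in> poly_ops T" and x: "x \<in> carrier W"
  show "f x \<in> carrier W" by (rule poly_ops_closed[OF f linear_T x])
next
  fix f x y assume f: "f \<in> poly_ops T" and xy: "x \<in> carrier W" "y \<in> carrier W"
  show "f (x \<oplus>\<^bsub>W\<^esub> y) = f x \<oplus>\<^bsub>W\<^esub> f y" by (rule linearD(2)[OF linear_poly_ops[OF f linear_T] xy])
next
  fix f g assume fg: "f \<in> poly_ops T" "g \<in> poly_ops T"
  show "\<exists>h\<in>poly_ops T. \<forall>x\<in>carrier W. h x = f x \<oplus>\<^bsub>W\<^esub> g x" by (rule poly_ops_add[OF linear_T fg])
  show "\<exists>h\<in>poly_ops T. \<forall>x\<in>carrier W. h x = f (g x)" by (rule poly_ops_comp[OF linear_T fg(2,1)])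
qed (rule W.finite_vectors W.nonzero_vector)+

lemma orbit_submod:
  assumes v: "v \<in> carrier W"
  shows "W.S.submod (P.orbit v)"
proof (rule submod_W_I)
  show "P.orbit v \<subseteq> carrier W" using P.orbit_subset v .
  show "\<zero>\<^bsub>W\<^esub> \<in> P.orbit v" using P.zero_in_orbit v .
next
  fix x y assume "x \<in> P.orbit v" "y \<in> P.orbit v"
  then obtain f g where fg: "f \<in> poly_ops T" "g \<in> poly_ops T" "x = f v" "y = g v"
    by (auto simp: P.orbit_def)
  then obtain h where "h \<in> poly_ops T" "h v = x \<oplus>\<^bsub>W\<^esub> y"
    using poly_ops_add[OF linear_T fg(1,2)] v by blast
  then show "x \<oplus>\<^bsub>W\<^esub> y \<in> P.orbit v" unfolding P.orbit_def by (metis image_eqI)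
next
  fix c x assume c: "c \<in> carrier F" and "x \<in> P.orbit v"
  then obtain f where f: "f \<in> poly_ops T" "x = f v" by (auto simp: P.orbit_def)
  then obtain h where "h \<in> poly_ops T" "h v = c \<odot>\<^bsub>W\<^esub> x"
    using poly_ops_smult[OF linear_T c f(1)] v by blast
  then show "c \<odot>\<^bsub>W\<^esub> x \<in> P.orbit v" unfolding P.orbit_def by (metis image_eqI)
qed

lemma orbit_least:
  assumes U: "W.S.submod U" and v: "v \<in> U" and T: "\<And>x. x \<in> U \<Longrightarrow> T x \<in> U"
  shows "P.orbit v \<subseteq> U"
proof -
  have "f v \<in> U" if "f \<in> poly_ops T" for f
    using that
  proof induction
    case zero
    then show ?case using W.S.submodD(2)[OF U] .
  next
    case (horner f c)
    have "(\<lambda>x. c \<odot>\<^bsub>W\<^esub> x) \<in> W.scalars" using horner(2) by (simp add: W.scalars_def)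
    from W.S.submodD(4)[OF U this v] show ?case
      using W.S.submodD(3)[OF U] T horner by blast
  qed
  then show ?thesis by (auto simp: P.orbit_def)
qed

lemma Q_power: "\<exists>n. P.Q = q ^ n"
proof -
  obtain v where v: "v \<in> carrier W" "v \<noteq> \<zero>\<^bsub>W\<^esub>" using W.S.nontrivial by blast
  obtain bs where "W.S.indep bs" "W.S.sp bs = P.orbit v" "card (P.orbit v) = W.S.Q ^ length bs"
    using W.S.basis_exists[OF orbit_submod[OF v(1)]] .
  then show ?thesis using P.card_orbit[OF v] W.Q_scalars by auto
qed

lemma power_in_orbit:
  assumes "v \<in> carrier W"
  shows "(T ^^ i) v \<in> P.orbit v"
  using poly_ops_power[OF linear_T, of i] assms unfolding P.orbit_def by (metis image_eqI)

lemma krylov_in_orbit: "v \<in> carrier W \<Longrightarrow> set (krylov T k v) \<subseteq> P.orbit v"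
  using power_in_orbit by (auto simp: krylov_def)

text \<open>As soon as \<open>T ^ k\<close> applied to \<open>v\<close> depends on the lower powers, their span is invariant under \<open>T\<close>
and so contains all \<open>p(T) v\<close>.\<close>

lemma orbit_subset_sp_krylov:
  assumes v: "v \<in> carrier W" "v \<noteq> \<zero>\<^bsub>W\<^esub>" and dep: "(T ^^ k) v \<in> W.S.sp (krylov T k v)"
  shows "P.orbit v \<subseteq> W.S.sp (krylov T k v)"
proof -
  let ?U = "W.S.sp (krylov T k v)"
  have tw: "set (krylov T k v) \<subseteq> carrier W" using krylov_closed[OF linear_T v(1)] .
  have U: "W.S.submod ?U" using W.S.submod_sp[OF tw] .
  have in_U: "set (krylov T (Suc k) v) \<subseteq> ?U"
    using dep W.S.set_subset_sp[OF tw] by (simp add: krylov_simps)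
  have "k \<noteq> 0" using dep v(2) by (cases k) (auto simp: krylov_simps)
  then have "v \<in> set (krylov T k v)" by (force simp: krylov_def)
  then have "v \<in> ?U" using W.S.set_subset_sp[OF tw] by blast
  moreover have "T x \<in> ?U" if "x \<in> ?U" for x
  proof -
    have "W.S.submod {x \<in> carrier W. T x \<in> ?U}"
    proof (rule submod_W_I)
      show "\<zero>\<^bsub>W\<^esub> \<in> {x \<in> carrier W. T x \<in> ?U}"
        using linear_zero[OF linear_T] W.S.submodD(2)[OF U] by simp
    next
      fix x y assume "x \<in> {x \<in> carrier W. T x \<in> ?U}" "y \<in> {x \<in> carrier W. T x \<in> ?U}"
      then show "x \<oplus>\<^bsub>W\<^esub> y \<in> {x \<in> carrier W. T x \<in> ?U}"
        using linearD(2)[OF linear_T] W.S.submodD(3)[OF U] by simp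
    next
      fix c x assume c: "c \<in> carrier F" and x: "x \<in> {x \<in> carrier W. T x \<in> ?U}"
      have "(\<lambda>x. c \<odot>\<^bsub>W\<^esub> x) \<in> W.scalars" using c by (simp add: W.scalars_def)
      from W.S.submodD(4)[OF U this] have "c \<odot>\<^bsub>W\<^esub> T x \<in> ?U" using x by blast
      then show "c \<odot>\<^bsub>W\<^esub> x \<in> {x \<in> carrier W. T x \<in> ?U}"
        using linearD(3)[OF linear_T _ c] c x by simp
    qed blast
    moreover have "set (krylov T k v) \<subseteq> {x \<in> carrier W. T x \<in> ?U}"
    proof
      fix x assume x: "x \<in> set (krylov T k v)"
      then obtain i where i: "i < k" "x = (T ^^ i) v" by (auto simp: krylov_def)
      have "T x = (T ^^ Suc i) v" using i by simp
      also have "\<dots> \<in> set (krylov T (Suc k) v)" using i unfolding krylov_def by (simp only: set_map set_rev set_upt) force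
      finally show "x \<in> {x \<in> carrier W. T x \<in> ?U}" using in_U tw x by blast
    qed
    ultimately have "?U \<subseteq> {x \<in> carrier W. T x \<in> ?U}" by (rule W.S.sp_least)
    then show ?thesis using that by blast
  qed
  ultimately show ?thesis by (rule orbit_least[OF U])
qed

text \<open>A dependency among fewer than \<open>n\<close> powers would confine the orbit, which has \<open>q ^ n\<close> elements, to a
space of smaller dimension. Hence the first \<open>n\<close> powers applied to \<open>v\<close> are an \<open>F\<close>-basis of the
orbit.\<close>

lemma sp_krylov:
  assumes v: "v \<in> carrier W" "v \<noteq> \<zero>\<^bsub>W\<^esub>" and n: "P.Q = q ^ n"
  shows "W.S.sp (krylov T n v) = P.orbit v"
proof -
  have "k \<le> n \<Longrightarrow> W.S.indep (krylov T k v)" for k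
  proof (induction k)
    case 0
    then show ?case by (simp add: krylov_simps)
  next
    case (Suc k)
    have "(T ^^ k) v \<notin> W.S.sp (krylov T k v)"
    proof
      assume "(T ^^ k) v \<in> W.S.sp (krylov T k v)"
      from orbit_subset_sp_krylov[OF v this] have "q ^ n \<le> card (W.S.sp (krylov T k v))"
        using P.card_orbit[OF v] n card_mono
          W.S.submod_finite[OF W.S.submod_sp[OF krylov_closed[OF linear_T v(1)]]] by metis
      then have "q ^ n \<le> q ^ k"
        using W.S.card_sp Suc W.Q_scalars by (simp add: krylov_def)
      then show False using Suc.prems q_gt_1 by (simp add: power_increasing_iff)
    qed
    then show ?case using Suc power_closed[OF linear_T v(1)] by (simp add: krylov_simps)
  qed
  then have ind: "W.S.indep (krylov T n v)" by blast
  show ?thesis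
  proof (rule card_subset_eq)
    show "finite (P.orbit v)" using P.finite_orbit v(1) .
    show "W.S.sp (krylov T n v) \<subseteq> P.orbit v"
      using W.S.sp_least[OF orbit_submod krylov_in_orbit] v(1) by blast
    show "card (W.S.sp (krylov T n v)) = card (P.orbit v)"
      using W.S.card_sp[OF ind] P.card_orbit[OF v] n W.Q_scalars by (simp add: krylov_def)
  qed
qed

end

section \<open>Counting tuples that commute with a field\<close>

lemma (in division_operators) sp_subset_if_orbits:
  assumes "\<zero> \<in> U" "\<And>x y. x \<in> U \<Longrightarrow> y \<in> U \<Longrightarrow> x \<oplus> y \<in> U"
  shows "(\<And>v. v \<in> set vs \<Longrightarrow> orbit v \<subseteq> U) \<Longrightarrow> sp vs \<subseteq> U"
proof (induction vs)
  case (Cons v vs)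
  have "orbit v \<subseteq> U" "sp vs \<subseteq> U" using Cons by auto
  then show ?case using assms(2) by auto
qed (use assms(1) in simp)

lemma (in division_operators) indep_nonzero: "indep vs \<Longrightarrow> v \<in> set vs \<Longrightarrow> v \<noteq> \<zero>"
proof (induction vs)
  case (Cons w vs)
  have "\<zero> \<in> sp vs" using Cons.prems(1) submodD(2)[OF submod_sp[OF indep_carrier]] by simp
  then show ?case using Cons by auto
qed simp

context matrices_over_finite_field
begin

text \<open>An operator \<open>T\<close> of degree \<open>n\<close> is determined by a small amount of data: for a basis \<open>vs\<close> over
\<open>F[T]\<close>, the vectors \<open>T ^ i v\<close> with \<open>i < n\<close>, and \<open>T ^ n\<close> at the first basis vector. Indeed the last
vector fixes the coefficients of the minimal polynomial, which is the same for all basis vectors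
since \<open>F[T]\<close> is a field, and so gives \<open>T ^ n v\<close> for every \<open>v\<close> in \<open>vs\<close>.\<close>

lemma fieldlike_determined:
  assumes T: "fieldlike T" "division_operators.Q W (poly_ops T) = q ^ n"
    and T': "fieldlike T'" "division_operators.Q W (poly_ops T') = q ^ n"
    and vs: "set vs \<subseteq> carrier W" "\<zero>\<^bsub>W\<^esub> \<notin> set vs" "vs \<noteq> []"
    and gen: "division_operators.sp W (poly_ops T) vs = carrier W"
    and same: "\<And>v. v \<in> set vs \<Longrightarrow> krylov T n v = krylov T' n v"
    and top: "(T ^^ n) (hd vs) = (T' ^^ n) (hd vs)"
    and x: "x \<in> carrier W"
  shows "T x = T' x"
proof -
  interpret A: fieldlike_operator F d T by unfold_locales (rule T(1))
  interpret B: fieldlike_operator F d T' by unfold_locales (rule T'(1))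
  have same_power: "(T ^^ i) v = (T' ^^ i) v" if "v \<in> set vs" "i < n" for i v
    using same[OF that(1)] that(2) by (simp add: krylov_def)
  let ?u = "hd vs"
  have u: "?u \<in> set vs" "?u \<in> carrier W" "?u \<noteq> \<zero>\<^bsub>W\<^esub>"
    using vs hd_in_set[OF vs(3)] by (blast, blast, metis)
  \<comment> \<open>A combination of powers below \<open>n\<close> is a polynomial in \<open>T\<close> and, with the same coefficients,
  one in \<open>T'\<close>; the two agree on \<open>vs\<close>.\<close>
  have transfer: "k \<le> n \<Longrightarrow> y \<in> W.S.sp (krylov T k ?u) \<Longrightarrow>
      \<exists>f\<in>poly_ops T. \<exists>g\<in>poly_ops T'. f ?u = y \<and> (\<forall>v\<in>set vs. f v = g v)" for k y
  proof (induction k arbitrary: y)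
    case 0
    then have "y = \<zero>\<^bsub>W\<^esub>" by (simp add: krylov_simps)
    then show ?case using poly_ops.zero[of T] poly_ops.zero[of T']
      by (intro bexI[of _ "\<lambda>x. \<zero>\<^bsub>W\<^esub>"]) simp_all
  next
    case (Suc k)
    from Suc.prems(2) obtain c z where c: "c \<in> carrier F" "z \<in> W.S.sp (krylov T k ?u)"
      "y = c \<odot>\<^bsub>W\<^esub> (T ^^ k) ?u \<oplus>\<^bsub>W\<^esub> z"
      by (auto simp: krylov_simps W.orbit_scalars)
    obtain f g where fg: "f \<in> poly_ops T" "g \<in> poly_ops T'" "f ?u = z" "\<forall>v\<in>set vs. f v = g v"
      using Suc.IH[OF _ c(2)] Suc.prems(1) by auto
    have ext: "\<exists>h\<in>poly_ops R. \<forall>x\<in>carrier W. h x = c \<odot>\<^bsub>W\<^esub> (R ^^ k) x \<oplus>\<^bsub>W\<^esub> f x"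
      if R: "linear R" "f \<in> poly_ops R" for R f
    proof -
      obtain p where p: "p \<in> poly_ops R" "\<forall>x\<in>carrier W. p x = (R ^^ k) x"
        using poly_ops_power[OF R(1), of k] by blast
      obtain p' where p': "p' \<in> poly_ops R" "\<forall>x\<in>carrier W. p' x = c \<odot>\<^bsub>W\<^esub> p x"
        using poly_ops_smult[OF R(1) c(1) p(1)] by blast
      obtain h where h: "h \<in> poly_ops R" "\<forall>x\<in>carrier W. h x = p' x \<oplus>\<^bsub>W\<^esub> f x"
        using poly_ops_add[OF R(1) p'(1) R(2)] by blast
      show ?thesis using h p p' by (intro bexI[of _ h]) simp_all
    qed
    obtain f' where f': "f' \<in> poly_ops T" "\<forall>x\<in>carrier W. f' x = c \<odot>\<^bsub>W\<^esub> (T ^^ k) x \<oplus>\<^bsub>W\<^esub> f x"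
      using ext[OF A.linear_T fg(1)] by blast
    obtain g' where g': "g' \<in> poly_ops T'" "\<forall>x\<in>carrier W. g' x = c \<odot>\<^bsub>W\<^esub> (T' ^^ k) x \<oplus>\<^bsub>W\<^esub> g x"
      using ext[OF B.linear_T fg(2)] by blast
    have "f' ?u = y" using f'(2) u(2) fg(3) c(3) by simp
    moreover have "f' v = g' v" if "v \<in> set vs" for v
      using f'(2) g'(2) fg(4) same_power[OF that, of k] Suc.prems(1) that vs(1) by auto
    ultimately show ?case using f'(1) g'(1) by blast
  qed
  have "(T ^^ n) ?u \<in> W.S.sp (krylov T n ?u)"
    using A.sp_krylov[OF u(2,3) T(2)] A.power_in_orbit[OF u(2)] by simp
  from transfer[OF order_refl this] obtain f g where
    f: "f \<in> poly_ops T" "f ?u = (T ^^ n) ?u" and g: "g \<in> poly_ops T'" and fg: "\<forall>v\<in>set vs. f v = g v"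
    by blast
  obtain p where p: "p \<in> poly_ops T" "\<forall>x\<in>carrier W. p x = (T ^^ n) x"
    using poly_ops_power[OF A.linear_T, of n] by blast
  obtain p' where p': "p' \<in> poly_ops T'" "\<forall>x\<in>carrier W. p' x = (T' ^^ n) x"
    using poly_ops_power[OF B.linear_T, of n] by blast
  have same_top: "(T ^^ n) v = (T' ^^ n) v" if v: "v \<in> set vs" for v
  proof -
    have vW: "v \<in> carrier W" using v vs(1) by blast
    have "f ?u = p ?u" using f(2) p(2) u(2) by simp
    then have "f v = p v" using A.P.op_eq_if_eq_at[OF f(1) p(1) u(2,3) _ vW] by blast
    moreover have "g ?u = p' ?u" using fg u f(2) top p'(2) by metis
    then have "g v = p' v" using B.P.op_eq_if_eq_at[OF g p'(1) u(2,3) _ vW] by blast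
    ultimately show ?thesis using fg v p(2) p'(2) vW by metis
  qed
  have on_orbit: "T y = T' y" if v: "v \<in> set vs" and y: "y \<in> A.P.orbit v" for v y
  proof -
    have vW: "v \<in> carrier W" "v \<noteq> \<zero>\<^bsub>W\<^esub>" using v vs by (blast, metis)
    have "y \<in> W.S.sp (krylov T n v)" using A.sp_krylov[OF vW T(2)] y by simp
    then show ?thesis
    proof (rule W.S.eq_on_sp[where f = T and g = T', OF krylov_closed[OF A.linear_T vW(1)], rotated 4])
      fix z assume "z \<in> set (krylov T n v)"
      then obtain i where i: "i < n" "z = (T ^^ i) v" by (auto simp: krylov_def)
      have "T z = (T ^^ Suc i) v" using i by simp
      also have "\<dots> = (T' ^^ Suc i) v"
        using same_power[OF v, of "Suc i"] same_top[OF v] i(1) by (cases "Suc i = n") auto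
      also have "\<dots> = T' z" using i same_power[OF v i(1)] by simp
      finally show "T z = T' z" .
    next
      fix a b assume "a \<in> carrier W" "b \<in> carrier W" "T a = T' a" "T b = T' b"
      then show "T (a \<oplus>\<^bsub>W\<^esub> b) = T' (a \<oplus>\<^bsub>W\<^esub> b)"
        using linearD(2)[OF A.linear_T] linearD(2)[OF B.linear_T] by simp
    next
      fix l a assume "l \<in> W.scalars" "a \<in> carrier W" "T a = T' a"
      then show "T (l a) = T' (l a)"
        using linearD(3)[OF A.linear_T] linearD(3)[OF B.linear_T] by (auto simp: W.scalars_def)
    next
      show "T \<zero>\<^bsub>W\<^esub> = T' \<zero>\<^bsub>W\<^esub>" using linear_zero A.linear_T B.linear_T by metis
    qed
  qed
  have "A.P.sp vs \<subseteq> {y \<in> carrier W. T y = T' y}"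
  proof (rule A.P.sp_subset_if_orbits)
    show "\<zero>\<^bsub>W\<^esub> \<in> {y \<in> carrier W. T y = T' y}"
      using linear_zero[OF A.linear_T] linear_zero[OF B.linear_T] by simp
    fix a b assume "a \<in> {y \<in> carrier W. T y = T' y}" "b \<in> {y \<in> carrier W. T y = T' y}"
    then show "a \<oplus>\<^bsub>W\<^esub> b \<in> {y \<in> carrier W. T y = T' y}"
      using linearD(2)[OF A.linear_T] linearD(2)[OF B.linear_T] by simp
  next
    fix v assume "v \<in> set vs"
    then show "A.P.orbit v \<subseteq> {y \<in> carrier W. T y = T' y}"
      using on_orbit A.P.orbit_subset vs(1) by blast
  qed
  then show ?thesis using gen x by blast
qed

text \<open>The index \<open>n\<close> is the degree of the field \<open>F[T]\<close> over \<open>F\<close>. Operators are extensional so that they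
can be counted as functions.\<close>

definition fieldlike_ops where
  "fieldlike_ops n = {T \<in> extensional (carrier W). fieldlike T \<and>
     division_operators.Q W (poly_ops T) = q ^ n}"

lemma finite_fieldlike_ops: "finite (fieldlike_ops n)"
proof (rule finite_subset)
  show "fieldlike_ops n \<subseteq> carrier W \<rightarrow>\<^sub>E carrier W"
    using linearD(1) by (auto simp: fieldlike_ops_def fieldlike_def PiE_def)
  show "finite (carrier W \<rightarrow>\<^sub>E carrier W)" using W.finite_vectors by (simp add: finite_PiE)
qed

lemma fieldlike_ops_degree_dvd:
  assumes "T \<in> fieldlike_ops n"
  shows "\<exists>r\<ge>1. d = n * r"
proof -
  interpret A: fieldlike_operator F d T
    by unfold_locales (use assms in \<open>simp add: fieldlike_ops_def\<close>)
  obtain vs where vs: "A.P.indep vs" "A.P.sp vs = carrier W" "card (carrier W) = A.P.Q ^ length vs"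
    using A.P.basis_exists[OF A.P.submod_carrier] .
  have "q ^ d = q ^ (n * length vs)"
    using vs(3) assms card_W by (simp add: fieldlike_ops_def power_mult)
  then have "d = n * length vs" using power_inject_exp[of q] q_gt_1 by simp
  then show ?thesis using d_pos by (intro exI[of _ "length vs"]) (cases "length vs", auto)
qed

lemma degree_ge_2:
  assumes T: "T \<in> fieldlike_ops n" and "\<not> scalar_op T"
  shows "2 \<le> n"
proof (rule ccontr)
  interpret A: fieldlike_operator F d T
    by unfold_locales (use assms in \<open>simp add: fieldlike_ops_def\<close>)
  assume "\<not> 2 \<le> n"
  then have "q ^ n \<le> q" using q_gt_1 power_increasing[of n 1 q] by simp
  then have Q: "A.P.Q \<le> q" using T by (simp add: fieldlike_ops_def)
  obtain v where v: "v \<in> carrier W" "v \<noteq> \<zero>\<^bsub>W\<^esub>" using W.S.nontrivial by blast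
  have "W.S.orbit v \<subseteq> A.P.orbit v"
  proof
    fix x assume "x \<in> W.S.orbit v"
    then obtain c where c: "c \<in> carrier F" "x = c \<odot>\<^bsub>W\<^esub> v" by (auto simp: W.orbit_scalars)
    obtain h where "h \<in> poly_ops T" "\<forall>x\<in>carrier W. h x = c \<odot>\<^bsub>W\<^esub> x"
      using poly_ops_scalar[OF A.linear_T c(1)] by blast
    then show "x \<in> A.P.orbit v" using c v unfolding A.P.orbit_def by (metis image_eqI)
  qed
  moreover have "card (A.P.orbit v) \<le> card (W.S.orbit v)"
    using Q A.P.card_orbit[OF v] W.S.card_orbit[OF v] W.Q_scalars by simp
  ultimately have "A.P.orbit v = W.S.orbit v"
    using card_seteq[OF A.P.finite_orbit[OF v(1)]] by blast
  then have "T v \<in> W.S.orbit v" using A.power_in_orbit[OF v(1), of 1] by simp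
  then obtain c where c: "c \<in> carrier F" "T v = c \<odot>\<^bsub>W\<^esub> v" by (auto simp: W.orbit_scalars)
  obtain h where h: "h \<in> poly_ops T" "\<forall>x\<in>carrier W. h x = c \<odot>\<^bsub>W\<^esub> x"
    using poly_ops_scalar[OF A.linear_T c(1)] by blast
  obtain t where t: "t \<in> poly_ops T" "\<forall>x\<in>carrier W. t x = T x"
    using poly_ops_power[OF A.linear_T, of 1] by auto
  have "T w = c \<odot>\<^bsub>W\<^esub> w" if "w \<in> carrier W" for w
    using A.P.op_eq_if_eq_at[OF t(1) h(1) v _ that] t(2) h(2) c v that by simp
  then show False using assms(2) c(1) by (auto simp: scalar_op_def)
qed

text \<open>Count pairs of an operator \<open>T\<close> and a basis \<open>vs\<close> of the columns over \<open>F[T]\<close>. There are at least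
\<open>q ^ (d * r) / 2 ^ r\<close> bases for each \<open>T\<close>, and by \<open>fieldlike_determined\<close> a pair is determined by
\<open>n * r + 1 = d + 1\<close> column vectors.\<close>

lemma card_fieldlike_ops:
  assumes d: "d = n * r" and r: "1 \<le> r"
  shows "card (fieldlike_ops n) * q ^ (d * r) \<le> 2 ^ r * q ^ (d + d * d)"
proof -
  let ?I = "\<lambda>T. {vs. length vs = r \<and> set vs \<subseteq> carrier W \<and> division_operators.indep W (poly_ops T) vs}"
  let ?X = "SIGMA T:fieldlike_ops n. ?I T"
  let ?L = "{ks. set ks \<subseteq> {k. set k \<subseteq> carrier W \<and> length k = n} \<and> length ks = r}"
  let ?Y = "carrier W \<times> ?L"
  have n: "n \<noteq> 0" using d d_pos by auto
  have card_I: "finite (?I T) \<and> q ^ (d * r) \<le> 2 ^ r * card (?I T)"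
    and basis: "vs \<in> ?I T \<Longrightarrow> division_operators.sp W (poly_ops T) vs = carrier W"
    and nonzero: "vs \<in> ?I T \<Longrightarrow> \<zero>\<^bsub>W\<^esub> \<notin> set vs"
    if T: "T \<in> fieldlike_ops n" for T vs
  proof -
    interpret A: fieldlike_operator F d T
      by unfold_locales (use T in \<open>simp add: fieldlike_ops_def\<close>)
    have Q: "A.P.Q = q ^ n" using T by (simp add: fieldlike_ops_def)
    have cW: "card (carrier W) = A.P.Q ^ r" using card_W d Q by (simp add: power_mult)
    have "d * r = n * (r * r)" using d by simp
    then have "q ^ (d * r) = A.P.Q ^ (r * r)" by (simp only: Q power_mult)
    then show "finite (?I T) \<and> q ^ (d * r) \<le> 2 ^ r * card (?I T)"
      using A.P.card_indep_lists[OF A.P.submod_carrier cW, of r] A.P.prod_diff_power_lower[of r r]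
      by simp
    show "A.P.sp vs = carrier W" if vs: "vs \<in> ?I T"
    proof (rule card_subset_eq[OF W.finite_vectors])
      show "A.P.sp vs \<subseteq> carrier W" using A.P.sp_least[OF A.P.submod_carrier] vs by blast
      show "card (A.P.sp vs) = card (carrier W)" using A.P.card_sp[of vs] vs cW by simp
    qed
    show "\<zero>\<^bsub>W\<^esub> \<notin> set vs" if "vs \<in> ?I T" using A.P.indep_nonzero[of vs] that by blast
  qed
  let ?f = "\<lambda>(T, vs). ((T ^^ n) (hd vs), map (krylov T n) vs)"
  have lin: "linear T" if "T \<in> fieldlike_ops n" for T
    using that by (simp add: fieldlike_ops_def fieldlike_def)
  have inj: "inj_on ?f ?X"
  proof (intro inj_onI, clarify)
    fix T vs T' vs'
    assume T: "T \<in> fieldlike_ops n" and T': "T' \<in> fieldlike_ops n"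
      and vs: "set vs \<subseteq> carrier W" "division_operators.indep W (poly_ops T) vs"
      and vs': "set vs' \<subseteq> carrier W" "division_operators.indep W (poly_ops T') vs'"
      and r: "r = length vs" and len: "length vs' = length vs"
      and top: "(T ^^ n) (hd vs) = (T' ^^ n) (hd vs')"
      and kr: "map (krylov T n) vs = map (krylov T' n) vs'"
    \<comment> \<open>The basis is read off from the data as the zeroth powers.\<close>
    have last: "last (krylov R n v) = v" for R v
      using n by (simp add: krylov_def last_map last_rev hd_upt)
    have "map last (map (krylov T n) vs) = map last (map (krylov T' n) vs')" using kr by simp
    then have eq: "vs = vs'" by (simp add: last comp_def)
    have vsI: "vs \<in> ?I T" using vs r by simp
    have "T x = T' x" if "x \<in> carrier W" for x
    proof (rule fieldlike_determined[OF _ _ _ _ vs(1) nonzero[OF T vsI] _ basis[OF T vsI] _ _ that])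
      show "vs \<noteq> []" using \<open>1 \<le> r\<close> r by auto
      show "krylov T n v = krylov T' n v" if "v \<in> set vs" for v using kr that eq by simp
    qed (use T T' top eq in \<open>auto simp: fieldlike_ops_def\<close>)
    moreover have "T \<in> extensional (carrier W)" "T' \<in> extensional (carrier W)"
      using T T' by (auto simp: fieldlike_ops_def)
    ultimately show "T = T' \<and> vs = vs'" using extensionalityI eq by metis
  qed
  have into: "?f ` ?X \<subseteq> ?Y"
  proof
    fix y assume "y \<in> ?f ` ?X"
    then obtain T vs where T: "T \<in> fieldlike_ops n" and vs: "set vs \<subseteq> carrier W" "length vs = r"
      and y: "y = ((T ^^ n) (hd vs), map (krylov T n) vs)" by auto
    have "hd vs \<in> carrier W" using vs r hd_in_set[of vs] by fastforce
    then have "(T ^^ n) (hd vs) \<in> carrier W" using power_closed[OF lin[OF T]] by blast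
    moreover have "set (krylov T n v) \<subseteq> carrier W" if "v \<in> set vs" for v
      using krylov_closed[OF lin[OF T]] vs(1) that by blast
    moreover have "length (krylov T n v) = n" for v by (simp add: krylov_def)
    ultimately show "y \<in> ?Y" using y vs(2) by auto
  qed
  have fin: "finite {k. set k \<subseteq> carrier W \<and> length k = n}"
    by (rule finite_lists_length_eq[OF W.finite_vectors])
  have "card ?L = ((q ^ d) ^ n) ^ r"
    using card_lists_length_eq[OF fin, of r] card_lists_length_eq[OF W.finite_vectors, of n] card_W
    by simp
  also have "\<dots> = q ^ (d * n * r)" by (simp only: power_mult)
  also have "d * n * r = d * d" using d by simp
  finally have cL: "card ?L = q ^ (d * d)" .
  have "finite ?Y" using finite_lists_length_eq[OF fin] W.finite_vectors by simp
  from card_inj_on_le[OF inj into this] have "card ?X \<le> card ?Y" .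
  also have "\<dots> = q ^ (d + d * d)" using cL card_W by (simp add: card_cartesian_product power_add)
  finally have X: "card ?X \<le> q ^ (d + d * d)" .
  have "card (fieldlike_ops n) * q ^ (d * r) = (\<Sum>T\<in>fieldlike_ops n. q ^ (d * r))" by simp
  also have "\<dots> \<le> (\<Sum>T\<in>fieldlike_ops n. 2 ^ r * card (?I T))"
    using card_I by (intro sum_mono) blast
  also have "\<dots> = 2 ^ r * card ?X"
    using card_SigmaI[OF finite_fieldlike_ops, of n ?I] card_I by (simp add: sum_distrib_left)
  finally show ?thesis using X by (meson le_trans mult_le_mono2)
qed

text \<open>A matrix that commutes with \<open>T\<close> is \<open>F[T]\<close>-linear, so it is determined by its values on a basis of
\<open>r\<close> vectors over \<open>F[T]\<close>.\<close>

lemma card_commutant: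
  assumes T: "T \<in> fieldlike_ops n" and d: "d = n * r"
  shows "card {A \<in> carrier M. commute A T} \<le> q ^ (d * r)"
proof -
  interpret A: fieldlike_operator F d T
    by unfold_locales (use T in \<open>simp add: fieldlike_ops_def\<close>)
  obtain vs where vs: "A.P.indep vs" "A.P.sp vs = carrier W" "card (carrier W) = A.P.Q ^ length vs"
    using A.P.basis_exists[OF A.P.submod_carrier] .
  have vsW: "set vs \<subseteq> carrier W" using A.P.indep_carrier vs(1) .
  have "q ^ d = q ^ (n * length vs)"
    using vs(3) T card_W by (simp add: fieldlike_ops_def power_mult)
  then have "n * r = n * length vs" using power_inject_exp[of q] q_gt_1 d by simp
  then have len: "length vs = r" using d d_pos by auto
  have inj: "inj_on (\<lambda>A. map (act A) vs) {A \<in> carrier M. commute A T}"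
  proof (intro inj_onI, clarify)
    fix A B assume A: "A \<in> carrier M" "commute A T" and B: "B \<in> carrier M" "commute B T"
      and eq: "map (act A) vs = map (act B) vs"
    show "A = B"
    proof (rule act_faithful[OF A(1) B(1)])
      fix w assume "w \<in> carrier W"
      then have "w \<in> A.P.sp vs" using vs(2) by simp
      then show "act A w = act B w"
      proof (rule A.P.eq_on_sp[where f = "act A" and g = "act B", OF vsW, rotated 4])
        show "act A v = act B v" if "v \<in> set vs" for v using eq that by simp
        show "act A \<zero>\<^bsub>W\<^esub> = act B \<zero>\<^bsub>W\<^esub>" using act_zero A(1) B(1) by simp
        show "act A (x \<oplus>\<^bsub>W\<^esub> y) = act B (x \<oplus>\<^bsub>W\<^esub> y)"
          if "x \<in> carrier W" "y \<in> carrier W" "act A x = act B x" "act A y = act B y" for x y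
          using that act_add[OF A(1)] act_add[OF B(1)] by simp
        show "act A (f x) = act B (f x)"
          if "f \<in> poly_ops T" "x \<in> carrier W" "act A x = act B x" for f x
          using that commute_poly_ops[OF A.linear_T A that(1)] commute_poly_ops[OF A.linear_T B that(1)]
          by (metis commute_def)
      qed
    qed
  qed
  have "(\<lambda>A. map (act A) vs) ` {A \<in> carrier M. commute A T} \<subseteq> {ws. set ws \<subseteq> carrier W \<and> length ws = r}"
    using act_closed subsetD[OF vsW] len by auto
  from card_inj_on_le[OF inj this finite_lists_length_eq[OF W.finite_vectors]]
  show ?thesis using card_lists_length_eq[OF W.finite_vectors, of r] card_W by (simp add: power_mult)
qed

text \<open>If \<open>T\<close> commutes with a tuple of matrices then so do its translates by scalars, and these generate
the same field. A tuple with one such operator has therefore at least \<open>q\<close> of them, which gains a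
factor \<open>q\<close> when pairs of a tuple and an operator are counted. For \<open>d = m = 2\<close> the final estimate
would fail without it.\<close>

definition shift where
  "shift T b = (\<lambda>x\<in>carrier W. T x \<oplus>\<^bsub>W\<^esub> b \<odot>\<^bsub>W\<^esub> x)"

lemma linear_shift:
  assumes "linear T" "b \<in> carrier F"
  shows "linear (shift T b)"
  unfolding linear_def
proof (intro conjI ballI)
  fix x y assume xy: "x \<in> carrier W" "y \<in> carrier W"
  show "shift T b (x \<oplus>\<^bsub>W\<^esub> y) = shift T b x \<oplus>\<^bsub>W\<^esub> shift T b y"
    using xy assms(2) linearD[OF assms(1)] by (simp add: shift_def W.smult_r_distr W.M.add.m_ac)
next
  fix c x assume cx: "c \<in> carrier F" "x \<in> carrier W"
  have "b \<odot>\<^bsub>W\<^esub> (c \<odot>\<^bsub>W\<^esub> x) = c \<odot>\<^bsub>W\<^esub> (b \<odot>\<^bsub>W\<^esub> x)"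
    using cx assms(2) by (simp add: m_comm flip: W.smult_assoc1)
  then show "shift T b (c \<odot>\<^bsub>W\<^esub> x) = c \<odot>\<^bsub>W\<^esub> shift T b x"
    using cx assms(2) linearD[OF assms(1)] by (simp add: shift_def W.smult_r_distr)
qed (use assms linearD(1) in \<open>simp add: shift_def\<close>)

lemma poly_ops_shift:
  assumes T: "linear T" and T': "linear T'" and b: "b \<in> carrier F"
    and eq: "\<And>x. x \<in> carrier W \<Longrightarrow> T' x = T x \<oplus>\<^bsub>W\<^esub> b \<odot>\<^bsub>W\<^esub> x"
  shows "f \<in> poly_ops T' \<Longrightarrow> \<exists>g\<in>poly_ops T. \<forall>x\<in>carrier W. g x = f x"
proof (induction rule: poly_ops.induct)
  case zero
  show ?case by (rule bexI[OF _ poly_ops.zero]) simp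
next
  case (horner f c)
  obtain g where g: "g \<in> poly_ops T" "\<forall>x\<in>carrier W. g x = f x" using horner.IH by blast
  obtain h where h: "h \<in> poly_ops T" "\<forall>x\<in>carrier W. h x = b \<odot>\<^bsub>W\<^esub> g x"
    using poly_ops_smult[OF T b g(1)] by blast
  obtain k where k: "k \<in> poly_ops T" "\<forall>x\<in>carrier W. k x = (c \<odot>\<^bsub>W\<^esub> x \<oplus>\<^bsub>W\<^esub> T (g x)) \<oplus>\<^bsub>W\<^esub> h x"
    using poly_ops_add[OF T poly_ops.horner[OF g(1) horner(2)] h(1)] by blast
  have "k x = c \<odot>\<^bsub>W\<^esub> x \<oplus>\<^bsub>W\<^esub> T' (f x)" if x: "x \<in> carrier W" for x
  proof -
    have fx: "f x \<in> carrier W" by (rule poly_ops_closed[OF horner(1) T' x])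
    show ?thesis
      using x fx g(2) h(2) k(2) eq[OF fx] linearD(1)[OF T fx] b horner(2)
      by (simp add: W.M.add.m_assoc)
  qed
  then show ?case using k(1) by (intro bexI[of _ k]) simp_all
qed

lemma shift_fieldlike_ops:
  assumes T: "T \<in> fieldlike_ops n" and b: "b \<in> carrier F"
  shows "shift T b \<in> fieldlike_ops n"
proof -
  interpret A: fieldlike_operator F d T
    by unfold_locales (use T in \<open>simp add: fieldlike_ops_def\<close>)
  let ?T = "shift T b"
  have lin: "linear ?T" using linear_shift[OF A.linear_T b] .
  have to: "\<exists>g\<in>poly_ops T. \<forall>x\<in>carrier W. g x = f x" if "f \<in> poly_ops ?T" for f
    by (rule poly_ops_shift[OF A.linear_T lin b _ that]) (simp add: shift_def)
  have "T x = ?T x \<oplus>\<^bsub>W\<^esub> (\<ominus> b) \<odot>\<^bsub>W\<^esub> x" if "x \<in> carrier W" for x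
    using that b linearD(1)[OF A.linear_T that]
    by (simp add: shift_def W.smult_l_minus W.M.add.m_assoc W.M.r_neg)
  then have conv: "\<exists>g\<in>poly_ops ?T. \<forall>x\<in>carrier W. g x = f x" if "f \<in> poly_ops T" for f
    using poly_ops_shift[OF lin A.linear_T _ _ that, of "\<ominus> b"] b by simp
  have "fieldlike ?T"
    unfolding fieldlike_def
  proof (intro conjI ballI impI lin)
    fix f x y
    assume f: "f \<in> poly_ops ?T" and x: "x \<in> carrier W" "x \<noteq> \<zero>\<^bsub>W\<^esub>" "f x = \<zero>\<^bsub>W\<^esub>" and y: "y \<in> carrier W"
    obtain g where g: "g \<in> poly_ops T" "\<forall>x\<in>carrier W. g x = f x" using to[OF f] by blast
    have "g y = \<zero>\<^bsub>W\<^esub>" using A.P.op_inj[OF g(1) x(1,2) _ y] g(2) x by simp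
    then show "f y = \<zero>\<^bsub>W\<^esub>" using g(2) y by simp
  qed
  then interpret B: fieldlike_operator F d "shift T b" by unfold_locales
  obtain v where v: "v \<in> carrier W" "v \<noteq> \<zero>\<^bsub>W\<^esub>" using W.S.nontrivial by blast
  have "B.P.orbit v = A.P.orbit v"
  proof
    show "B.P.orbit v \<subseteq> A.P.orbit v"
    proof
      fix y assume "y \<in> B.P.orbit v"
      then obtain f where f: "f \<in> poly_ops ?T" "y = f v" by (auto simp: B.P.orbit_def)
      then obtain g where "g \<in> poly_ops T" "g v = y" using to v(1) by metis
      then show "y \<in> A.P.orbit v" unfolding A.P.orbit_def by (metis image_eqI)
    qed
    show "A.P.orbit v \<subseteq> B.P.orbit v"
    proof
      fix y assume "y \<in> A.P.orbit v"
      then obtain f where f: "f \<in> poly_ops T" "y = f v" by (auto simp: A.P.orbit_def)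
      then obtain g where "g \<in> poly_ops ?T" "g v = y" using conv v(1) by metis
      then show "y \<in> B.P.orbit v" unfolding B.P.orbit_def by (metis image_eqI)
    qed
  qed
  then have "B.P.Q = A.P.Q" using A.P.card_orbit[OF v] B.P.card_orbit[OF v] by simp
  then show ?thesis
    using T B.fieldlike by (simp add: fieldlike_ops_def shift_def)
qed

lemma commute_shift:
  assumes "linear T" "A \<in> carrier M" "b \<in> carrier F" "commute A T"
  shows "commute A (shift T b)"
  unfolding commute_def
proof
  fix w assume w: "w \<in> carrier W"
  have "T w \<in> carrier W" using linearD(1) assms(1) w .
  then show "shift T b (act A w) = act A (shift T b w)"
    using w assms act_closed[OF assms(2) w] act_add[OF assms(2)] act_smult[OF assms(2) w assms(3)]
    by (simp add: shift_def commute_def)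
qed

definition commuting_tuples where
  "commuting_tuples m n = {xs. length xs = m \<and> set xs \<subseteq> carrier M \<and>
     (\<exists>T\<in>fieldlike_ops n. \<forall>A\<in>set xs. commute A T)}"

lemma finite_commuting_tuples: "finite (commuting_tuples m n)"
  by (rule finite_subset[OF _ finite_lists_length_eq[OF finite_M, of m]])
    (auto simp: commuting_tuples_def)

text \<open>Count pairs of an operator and a tuple in its commutant; the summand \<open>1\<close> in the exponent on the left
comes from the translates of the operator.\<close>

lemma card_commuting_tuples:
  assumes d: "d = n * r" and r: "1 \<le> r"
  shows "card (commuting_tuples m n) * q ^ (d * r + 1) \<le> 2 ^ r * q ^ (d + d * d + d * r * m)"
proof -
  let ?C = "\<lambda>T. {A \<in> carrier M. commute A T}"
  let ?L = "\<lambda>T. {xs. set xs \<subseteq> ?C T \<and> length xs = m}"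
  let ?X = "SIGMA T:fieldlike_ops n. ?L T"
  have finC: "finite (?C T)" for T using finite_M by simp
  \<comment> \<open>One commuting operator is chosen for each tuple; its translates give \<open>q\<close> different pairs.\<close>
  define ch where "ch xs = (SOME T. T \<in> fieldlike_ops n \<and> (\<forall>A\<in>set xs. commute A T))" for xs
  have ch: "ch xs \<in> fieldlike_ops n" "\<And>A. A \<in> set xs \<Longrightarrow> commute A (ch xs)"
    if "xs \<in> commuting_tuples m n" for xs
  proof -
    have "\<exists>T. T \<in> fieldlike_ops n \<and> (\<forall>A\<in>set xs. commute A T)"
      using that by (auto simp: commuting_tuples_def)
    then have "ch xs \<in> fieldlike_ops n \<and> (\<forall>A\<in>set xs. commute A (ch xs))"
      unfolding ch_def by (rule someI_ex)
    then show "ch xs \<in> fieldlike_ops n" "\<And>A. A \<in> set xs \<Longrightarrow> commute A (ch xs)" by auto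
  qed
  have lin: "linear (ch xs)" if "xs \<in> commuting_tuples m n" for xs
    using ch(1)[OF that] by (simp add: fieldlike_ops_def fieldlike_def)
  obtain v where v: "v \<in> carrier W" "v \<noteq> \<zero>\<^bsub>W\<^esub>" using W.S.nontrivial by blast
  let ?f = "\<lambda>(xs, b). (shift (ch xs) b, xs)"
  have "inj_on ?f (commuting_tuples m n \<times> carrier F)"
  proof (intro inj_onI, clarify)
    fix xs b c assume xs: "xs \<in> commuting_tuples m n" and bc: "b \<in> carrier F" "c \<in> carrier F"
      and eq: "shift (ch xs) b = shift (ch xs) c"
    have "ch xs v \<oplus>\<^bsub>W\<^esub> b \<odot>\<^bsub>W\<^esub> v = ch xs v \<oplus>\<^bsub>W\<^esub> c \<odot>\<^bsub>W\<^esub> v"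
      using fun_cong[OF eq, of v] v(1) by (simp add: shift_def)
    then have bcv: "b \<odot>\<^bsub>W\<^esub> v = c \<odot>\<^bsub>W\<^esub> v"
      using bc v(1) linearD(1)[OF lin[OF xs] v(1)] by simp
    have "(b \<ominus> c) \<odot>\<^bsub>W\<^esub> v = b \<odot>\<^bsub>W\<^esub> v \<oplus>\<^bsub>W\<^esub> \<ominus>\<^bsub>W\<^esub> (c \<odot>\<^bsub>W\<^esub> v)"
      using bc v(1) by (simp add: minus_eq W.smult_l_distr W.smult_l_minus)
    also have "\<dots> = \<zero>\<^bsub>W\<^esub>" unfolding bcv using bc v(1) by (simp add: W.M.r_neg)
    finally have "b \<ominus> c = \<zero>" using W.smult_eq_zero[of "b \<ominus> c" v] v bc by simp
    then show "xs = xs \<and> b = c" using bc by simp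
  qed
  moreover have "?f ` (commuting_tuples m n \<times> carrier F) \<subseteq> ?X"
  proof
    fix y assume "y \<in> ?f ` (commuting_tuples m n \<times> carrier F)"
    then obtain xs b where xs: "xs \<in> commuting_tuples m n" and b: "b \<in> carrier F"
      and y: "y = (shift (ch xs) b, xs)" by auto
    have "commute A (shift (ch xs) b)" if "A \<in> set xs" for A
      using commute_shift[OF lin[OF xs] _ b ch(2)[OF xs that]] that xs
      by (auto simp: commuting_tuples_def)
    then show "y \<in> ?X"
      using shift_fieldlike_ops[OF ch(1)[OF xs] b] xs y by (auto simp: commuting_tuples_def)
  qed
  moreover have "finite ?X"
    using finite_fieldlike_ops finite_lists_length_eq[OF finC] by (intro finite_SigmaI)
  ultimately have "card (commuting_tuples m n \<times> carrier F) \<le> card ?X" by (rule card_inj_on_le)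
  then have 1: "card (commuting_tuples m n) * q \<le> card ?X" by (simp add: card_cartesian_product)
  have "card ?X = (\<Sum>T\<in>fieldlike_ops n. card (?L T))"
    using finite_fieldlike_ops finite_lists_length_eq[OF finC] by (intro card_SigmaI) auto
  also have "\<dots> \<le> (\<Sum>T\<in>fieldlike_ops n. q ^ (d * r * m))"
  proof (rule sum_mono)
    fix T assume "T \<in> fieldlike_ops n"
    from power_mono[OF card_commutant[OF this d], of m] show "card (?L T) \<le> q ^ (d * r * m)"
      by (simp add: card_lists_length_eq[OF finC] power_mult)
  qed
  finally have 2: "card ?X \<le> card (fieldlike_ops n) * q ^ (d * r * m)" by simp
  have "card (commuting_tuples m n) * q ^ (d * r + 1) = (card (commuting_tuples m n) * q) * q ^ (d * r)"
    by (simp add: power_add)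
  also have "\<dots> \<le> (card (fieldlike_ops n) * q ^ (d * r * m)) * q ^ (d * r)"
    using 1 2 by (intro mult_le_mono1) (rule le_trans)
  also have "\<dots> = (card (fieldlike_ops n) * q ^ (d * r)) * q ^ (d * r * m)" by simp
  also have "\<dots> \<le> (2 ^ r * q ^ (d + d * d)) * q ^ (d * r * m)"
    by (intro mult_le_mono1 card_fieldlike_ops[OF d r])
  also have "\<dots> = 2 ^ r * q ^ (d + d * d + d * r * m)" by (simp add: power_add)
  finally show ?thesis .
qed

end

section \<open>Counting tuples in proper subalgebras\<close>

lemma int_poly_eventually_pos:
  fixes p :: "int poly"
  shows "lead_coeff p > 0 \<Longrightarrow> \<exists>n. \<forall>x\<ge>n. poly p x > 0"
proof (induction p)
  case (pCons a p)
  show ?case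
  proof (cases "p = 0")
    case False
    then obtain n where n: "\<And>x. n \<le> x \<Longrightarrow> poly p x > 0" using pCons by auto
    have "poly (pCons a p) x > 0" if x: "max n (1 + \<bar>a\<bar>) \<le> x" for x
    proof -
      have "1 \<le> poly p x" using n[of x] x by simp
      then have "x * 1 \<le> x * poly p x" using x by (intro mult_left_mono) auto
      then show ?thesis unfolding poly_pCons using x abs_ge_minus_self[of a] by linarith
    qed
    then show ?thesis by blast
  qed (use pCons in auto)
qed simp

text \<open>If the degree were larger, \<open>r x ^ a - C x ^ b\<close> would have the leading coefficient of \<open>r\<close>, which is
positive as \<open>r\<close> is nonnegative at all primes, and so would be positive at large primes. The factor
\<open>x ^ a\<close> makes the lemma cover negative bounds \<open>b - a\<close>, where it says that \<open>r = 0\<close>.\<close>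

lemma degree_le_if_bounded_at_primes:
  fixes r :: "int poly"
  assumes r: "r \<noteq> 0"
    and bound: "\<And>p::nat. Factorial_Ring.prime p \<Longrightarrow>
      0 \<le> poly r (int p) \<and> poly r (int p) * int p ^ a \<le> C * int p ^ b"
  shows "degree r + a \<le> b"
proof (rule ccontr)
  assume less: "\<not> degree r + a \<le> b"
  have large: "\<exists>p::nat. Factorial_Ring.prime p \<and> n \<le> int p" for n
  proof -
    obtain p where "Factorial_Ring.prime p" "nat n < p" using bigger_prime by blast
    then show ?thesis by (intro exI[of _ p]) auto
  qed
  have "lead_coeff r > 0"
  proof (rule ccontr)
    assume "\<not> lead_coeff r > 0"
    moreover have "lead_coeff r \<noteq> 0" using r by simp
    ultimately have "lead_coeff (- r) > 0" unfolding degree_minus coeff_minus by linarith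
    from int_poly_eventually_pos[OF this] obtain n where n: "\<forall>x\<ge>n. poly (- r) x > 0" ..
    obtain p :: nat where p: "Factorial_Ring.prime p" "n \<le> int p" using large by blast
    have "poly (- r) (int p) > 0" using n p(2) by simp
    then show False using bound[OF p(1)] by simp
  qed
  define t where "t = r * monom 1 a - monom C b"
  have deg: "degree (r * monom 1 a) = degree r + a"
    using r by (simp add: degree_mult_eq degree_monom_eq)
  have "degree (monom C b) \<le> b" by (rule degree_monom_le)
  then have lt: "degree (monom C b) < degree (r * monom 1 a)" using less deg by simp
  have "coeff (monom C b) (degree (r * monom 1 a)) = 0" using lt coeff_eq_0 by blast
  moreover have "degree t = degree (r * monom 1 a)"
    unfolding t_def diff_conv_add_uminus by (rule degree_add_eq_left) (use lt in simp)
  ultimately have "lead_coeff t = lead_coeff (r * monom 1 a)" by (simp add: t_def)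
  also have "\<dots> = lead_coeff r" by (simp add: lead_coeff_mult degree_monom_eq)
  finally have "lead_coeff t > 0" using \<open>lead_coeff r > 0\<close> by simp
  from int_poly_eventually_pos[OF this] obtain n where n: "\<forall>x\<ge>n. poly t x > 0" ..
  obtain p :: nat where p: "Factorial_Ring.prime p" "n \<le> int p" using large by blast
  have "poly t (int p) > 0" using n p(2) by simp
  then show False using bound[OF p(1)] by (simp add: t_def poly_monom)
qed

lemma le_if_mult_power_le:
  fixes q :: nat
  assumes "c * q ^ a \<le> K * q ^ b" "b \<le> a + N" "0 < q"
  shows "c \<le> K * q ^ N"
proof -
  have "c * q ^ a \<le> K * q ^ b" by fact
  also have "\<dots> \<le> K * q ^ (a + N)" using assms by (intro mult_le_mono2 power_increasing) auto
  also have "\<dots> = K * q ^ N * q ^ a" by (simp add: power_add)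
  finally show ?thesis using assms(3) by simp
qed

text \<open>After cancellation this is \<open>(m - 1) * (d - 1) \<le> (m - 1) * k * (d - k)\<close>: a tuple that fixes a subspace of
dimension \<open>k\<close> costs \<open>k * (d - k)\<close> per matrix, and the choice of the subspace gives one such term
back.\<close>

lemma invariant_exponent_bound:
  fixes k d m N :: nat
  assumes k: "1 \<le> k" "k < d" and m: "1 \<le> m" and N: "N + (m - 1) * (d - 1) = m * d * d"
  shows "d * k + m * (k * k + d * (d - k)) \<le> k * k + N"
proof -
  obtain f where f: "d = k + Suc f" using k(2) less_iff_Suc_add[of k d] by auto
  obtain e where e: "k = Suc e" using k(1) by (cases k) auto
  obtain l where l: "m = Suc l" using m by (cases m) auto
  have "(d - 1) \<le> k * (d - k)" by (simp add: f e)
  then have "l * (d - 1) \<le> l * (k * (d - k))" by (rule mult_le_mono2)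
  moreover have "d * k + m * (k * k + d * (d - k)) + l * (k * (d - k)) = k * k + m * d * d"
    by (simp add: f l algebra_simps)
  moreover have "m - 1 = l" using l by simp
  ultimately show ?thesis using N unfolding \<open>m - 1 = l\<close> by linarith
qed

text \<open>After cancellation this is linear in \<open>m\<close>, with the worst case \<open>m = 2\<close>, where it becomes
\<open>2 * (d - 1) + d * r \<le> d * d\<close>. Equality occurs for \<open>d = n = 2\<close> and \<open>r = 1\<close>.\<close>

lemma commuting_exponent_bound:
  fixes n r d m N :: nat
  assumes d: "d = n * r" and n: "2 \<le> n" and r: "1 \<le> r" and m: "2 \<le> m"
    and N: "N + (m - 1) * (d - 1) = m * d * d"
  shows "d + d * d + d * r * m \<le> d * r + 1 + N"
proof -
  obtain l where l: "m = Suc (Suc l)" using m by (metis add_2_eq_Suc le_Suc_ex)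
  obtain c where c: "n = Suc (Suc c)" using n by (metis add_2_eq_Suc le_Suc_ex)
  have key: "2 * (d - 1) + d * r \<le> d * d"
  proof (cases "r = 1")
    case True
    then show ?thesis using d c by simp
  next
    case False
    then obtain s where s: "r = Suc (Suc s)" using r by (metis One_nat_def Suc_le_D not0_implies_Suc)
    have "2 * r \<le> d" using d n by simp
    then have "d * (2 * r) \<le> d * d" by (rule mult_le_mono2)
    moreover have "2 * d \<le> d * r" using s by simp
    ultimately show ?thesis by linarith
  qed
  define g where "g = d - 1"
  have d1: "d = g + 1" using d n r by (simp add: g_def)
  have "l * (g + d * r) \<le> l * (d * d)" using key by (intro mult_le_mono2) (simp add: g_def)
  then have "l * g + d * r * l \<le> l * (d * d)" by (simp add: algebra_simps)
  moreover have "d * r * m = d * r * l + 2 * (d * r)" "(m - 1) * g = l * g + g"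
    "m * d * d = l * (d * d) + 2 * (d * d)" by (simp_all add: l algebra_simps)
  ultimately have "d + d * d + d * r * m + (m - 1) * (d - 1) \<le> d * r + 1 + m * d * d"
    using key d1 unfolding g_def[symmetric] by linarith
  then show ?thesis using N by simp
qed

context matrices_over_finite_field
begin

definition invariant_tuples where
  "invariant_tuples m k = {xs. length xs = m \<and> set xs \<subseteq> carrier M \<and>
     (\<exists>U. W.S.submod U \<and> card U = q ^ k \<and> (\<forall>A\<in>set xs. \<forall>u\<in>U. act A u \<in> U))}"

text \<open>In a basis that extends a basis of \<open>U\<close>, the first \<open>k\<close> columns are confined to \<open>U\<close> and the remaining
ones are free.\<close>

lemma card_stabilizer:
  assumes U: "W.S.submod U" "card U = q ^ k"
  shows "card {A \<in> carrier M. \<forall>u\<in>U. act A u \<in> U} \<le> q ^ (k * k + d * (d - k))"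
proof -
  let ?St = "{A \<in> carrier M. \<forall>u\<in>U. act A u \<in> U}"
  obtain us where us: "W.S.indep us" "W.S.sp us = U" "card U = W.S.Q ^ length us"
    using W.S.basis_exists[OF U(1)] .
  have len_us: "length us = k"
    using us(3) U(2) W.Q_scalars power_inject_exp[of q] q_gt_1 by simp
  have usW: "set us \<subseteq> carrier W" using W.S.indep_carrier us(1) .
  then have usU: "set us \<subseteq> U" using W.S.set_subset_sp us(2) by metis
  obtain vs where vs: "W.S.indep (vs @ us)" "W.S.sp (vs @ us) = carrier W"
    using W.S.indep_extend[OF W.S.submod_carrier us(1) usW] by blast
  have allW: "set (vs @ us) \<subseteq> carrier W" using W.S.indep_carrier vs(1) .
  have "q ^ d = q ^ length (vs @ us)" using W.S.card_sp[OF vs(1)] vs(2) card_W W.Q_scalars by metis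
  then have "length (vs @ us) = d" using power_inject_exp[of q] q_gt_1 by simp
  then have len_vs: "length vs = d - k" using len_us by simp
  let ?f = "\<lambda>A. (map (act A) us, map (act A) vs)"
  let ?Y = "{ws. set ws \<subseteq> U \<and> length ws = k} \<times> {ws. set ws \<subseteq> carrier W \<and> length ws = d - k}"
  have "inj_on ?f ?St"
  proof (intro inj_onI, clarify)
    fix A B assume A: "A \<in> carrier M" and B: "B \<in> carrier M"
      and eq: "map (act A) us = map (act B) us" "map (act A) vs = map (act B) vs"
    show "A = B"
    proof (rule act_faithful[OF A B])
      fix w assume "w \<in> carrier W"
      then have "w \<in> W.S.sp (vs @ us)" using vs(2) by simp
      then show "act A w = act B w"
      proof (rule W.S.eq_on_sp[where f = "act A" and g = "act B", OF allW, rotated 4])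
        show "act A v = act B v" if "v \<in> set (vs @ us)" for v using eq that by auto
        show "act A \<zero>\<^bsub>W\<^esub> = act B \<zero>\<^bsub>W\<^esub>" using act_zero A B by simp
        show "act A (x \<oplus>\<^bsub>W\<^esub> y) = act B (x \<oplus>\<^bsub>W\<^esub> y)"
          if "x \<in> carrier W" "y \<in> carrier W" "act A x = act B x" "act A y = act B y" for x y
          using that act_add[OF A] act_add[OF B] by simp
        show "act A (f x) = act B (f x)"
          if "f \<in> W.scalars" "x \<in> carrier W" "act A x = act B x" for f x
          using that act_smult[OF A] act_smult[OF B] by (auto simp: W.scalars_def)
      qed
    qed
  qed
  moreover have "?f ` ?St \<subseteq> ?Y"
  proof
    fix y assume "y \<in> ?f ` ?St"
    then obtain A where A: "A \<in> carrier M" "\<forall>u\<in>U. act A u \<in> U" "y = ?f A" by auto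
    have "act A v \<in> carrier W" if "v \<in> set vs" for v using that allW act_closed[OF A(1)] by auto
    then show "y \<in> ?Y" using A usU len_us len_vs by auto
  qed
  moreover have "finite ?Y"
    using finite_lists_length_eq[OF W.finite_vectors] finite_lists_length_eq[OF W.S.submod_finite[OF U(1)]]
    by simp
  ultimately have "card ?St \<le> card ?Y" by (rule card_inj_on_le)
  also have "\<dots> = (q ^ k) ^ k * (q ^ d) ^ (d - k)"
    using card_lists_length_eq[OF W.finite_vectors] card_lists_length_eq[OF W.S.submod_finite[OF U(1)]] U(2) card_W
    by (simp add: card_cartesian_product)
  also have "\<dots> = q ^ (k * k + d * (d - k))" by (simp add: power_add power_mult)
  finally show ?thesis .
qed

lemma card_invariant_tuples:
  "card (invariant_tuples m k) * q ^ (k * k) \<le> 2 ^ k * q ^ (d * k + m * (k * k + d * (d - k)))"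
proof -
  let ?\<U> = "{U. W.S.submod U \<and> card U = q ^ k}"
  let ?St = "\<lambda>U. {A \<in> carrier M. \<forall>u\<in>U. act A u \<in> U}"
  let ?L = "\<lambda>U. {xs. set xs \<subseteq> ?St U \<and> length xs = m}"
  let ?b = "q ^ (m * (k * k + d * (d - k)))"
  have finSt: "finite (?St U)" for U using finite_M by simp
  have finU: "finite ?\<U>" using W.S.finite_submods by simp
  have "invariant_tuples m k \<subseteq> (\<Union>U\<in>?\<U>. ?L U)" by (auto simp: invariant_tuples_def)
  then have "card (invariant_tuples m k) \<le> card (\<Union>U\<in>?\<U>. ?L U)"
    using finU finite_lists_length_eq[OF finSt] by (intro card_mono finite_UN_I) auto
  also have "\<dots> \<le> (\<Sum>U\<in>?\<U>. card (?L U))" by (rule card_UN_le[OF finU])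
  also have "\<dots> \<le> (\<Sum>U\<in>?\<U>. ?b)"
  proof (rule sum_mono)
    fix U assume "U \<in> ?\<U>"
    then have "card (?St U) \<le> q ^ (k * k + d * (d - k))" using card_stabilizer by blast
    from power_mono[OF this, of m] show "card (?L U) \<le> ?b"
      by (simp add: card_lists_length_eq[OF finSt] mult.commute flip: power_mult)
  qed
  finally have "card (invariant_tuples m k) * q ^ (k * k) \<le> (card ?\<U> * ?b) * q ^ (k * k)"
    by (intro mult_le_mono1) simp
  also have "\<dots> = (card ?\<U> * q ^ (k * k)) * ?b" by simp
  also have "\<dots> \<le> (2 ^ k * q ^ (d * k)) * ?b"
    using W.S.card_submods_bound[of d k] W.Q_scalars card_W by (intro mult_le_mono1) simp
  also have "\<dots> = 2 ^ k * q ^ (d * k + m * (k * k + d * (d - k)))" by (simp add: power_add)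
  finally show ?thesis .
qed

definition nongenerating_tuples where
  "nongenerating_tuples m = {xs. length xs = m \<and> set xs \<subseteq> carrier M \<and>
     (\<exists>S. unital_subalgebra F S M \<and> S \<noteq> carrier M \<and> set xs \<subseteq> S)}"

lemma finite_nongenerating_tuples: "finite (nongenerating_tuples m)"
  by (rule finite_subset[OF _ finite_lists_length_eq[OF finite_M, of m]])
    (auto simp: nongenerating_tuples_def)

text \<open>A proper subalgebra that contains the tuple either has an invariant subspace or is irreducible, and
in the second case Burnside's theorem provides a commuting operator outside \<open>F\<close>.\<close>

lemma nongenerating_tuples_cases:
  "nongenerating_tuples m \<subseteq>
    (\<Union>k\<in>{1..<d}. invariant_tuples m k) \<union> (\<Union>n\<in>{n\<in>{2..d}. n dvd d}. commuting_tuples m n)"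
proof
  fix xs assume "xs \<in> nongenerating_tuples m"
  then obtain S where xs: "length xs = m" "set xs \<subseteq> carrier M" "set xs \<subseteq> S"
    and S: "unital_subalgebra F S M" "S \<noteq> carrier M" by (auto simp: nongenerating_tuples_def)
  show "xs \<in> (\<Union>k\<in>{1..<d}. invariant_tuples m k) \<union> (\<Union>n\<in>{n\<in>{2..d}. n dvd d}. commuting_tuples m n)"
  proof (cases "\<exists>U. W.S.submod U \<and> (\<forall>A\<in>S. \<forall>u\<in>U. act A u \<in> U) \<and> U \<noteq> {\<zero>\<^bsub>W\<^esub>} \<and> U \<noteq> carrier W")
    case True
    then obtain U where U: "W.S.submod U" "\<forall>A\<in>S. \<forall>u\<in>U. act A u \<in> U" "U \<noteq> {\<zero>\<^bsub>W\<^esub>}" "U \<noteq> carrier W"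
      by blast
    obtain us where us: "W.S.indep us" "W.S.sp us = U" "card U = W.S.Q ^ length us"
      using W.S.basis_exists[OF U(1)] .
    have "us \<noteq> []" using us(2) U(3) by auto
    then have "1 \<le> length us" by (cases us) auto
    moreover have "card U < card (carrier W)"
      using W.S.submodD(1)[OF U(1)] U(4) W.finite_vectors by (intro psubset_card_mono) auto
    then have "q ^ length us < q ^ d" unfolding us(3) W.Q_scalars card_W .
    then have "length us < d" using q_gt_1 by (simp add: power_strict_increasing_iff)
    moreover have "xs \<in> invariant_tuples m (length us)"
      using xs U(1,2) us(3)[unfolded W.Q_scalars] unfolding invariant_tuples_def by blast
    ultimately show ?thesis by (intro UnI1 UN_I[of "length us"]) simp_all
  next
    case False
    interpret irreducible_subalgebra F d S
      by unfold_locales (use S(1) False in \<open>blast+\<close>)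
    obtain T where T: "fieldlike T" "\<forall>A\<in>S. commute A T" "T \<in> extensional (carrier W)" "\<not> scalar_op T"
      using burnside[OF S(2)] by blast
    interpret fieldlike_operator F d T by unfold_locales (rule T(1))
    obtain n where "P.Q = q ^ n" using Q_power by blast
    then have n: "T \<in> fieldlike_ops n" using T by (simp add: fieldlike_ops_def)
    obtain r where "d = n * r" using fieldlike_ops_degree_dvd[OF n] by blast
    then have "n dvd d" by simp
    moreover from this have "n \<le> d" using d_pos by (intro dvd_imp_le) auto
    moreover have "2 \<le> n" using degree_ge_2[OF n T(4)] .
    moreover have "xs \<in> commuting_tuples m n" using xs n T(2) unfolding commuting_tuples_def by blast
    ultimately show ?thesis by (intro UnI2 UN_I[of n]) simp_all
  qed
qed

text \<open>For \<open>m \<le> 1\<close> the bound is the number of all \<open>m\<close>-tuples. For \<open>m \<ge> 2\<close> each of the at most \<open>2 * d\<close>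
families in \<open>nongenerating_tuples_cases\<close> satisfies it up to the factor \<open>2 ^ d\<close>.\<close>

lemma card_nongenerating_tuples:
  assumes N: "N + (m - 1) * (d - 1) = m * d * d"
  shows "card (nongenerating_tuples m) \<le> 2 * d * 2 ^ d * q ^ N"
proof (cases "2 \<le> m")
  case False
  have "nongenerating_tuples m \<subseteq> {xs. set xs \<subseteq> carrier M \<and> length xs = m}"
    by (auto simp: nongenerating_tuples_def)
  from card_mono[OF finite_lists_length_eq[OF finite_M] this]
  have "card (nongenerating_tuples m) \<le> card (carrier M) ^ m"
    unfolding card_lists_length_eq[OF finite_M] .
  also have "m - 1 = 0" using False by simp
  then have "N = d * d * m" using N by (simp add: mult.commute mult.left_commute)
  then have "card (carrier M) ^ m = q ^ N" unfolding card_M by (simp only: power_mult)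
  also have "\<dots> \<le> (2 * d * 2 ^ d) * q ^ N" using d_pos by simp
  finally show ?thesis .
next
  case m: True
  have q0: "0 < q" using q_gt_1 by simp
  have pow: "2 ^ k * q ^ N \<le> 2 ^ d * q ^ N" if "k \<le> d" for k
    using that by (intro mult_le_mono1 power_increasing) auto
  have inv: "card (invariant_tuples m k) \<le> 2 ^ d * q ^ N" if "k \<in> {1..<d}" for k
  proof -
    have "card (invariant_tuples m k) \<le> 2 ^ k * q ^ N"
      by (rule le_if_mult_power_le[OF card_invariant_tuples invariant_exponent_bound q0])
        (use that m N in auto)
    also have "\<dots> \<le> 2 ^ d * q ^ N" by (rule pow) (use that in simp)
    finally show ?thesis .
  qed
  have com: "card (commuting_tuples m n) \<le> 2 ^ d * q ^ N" if n: "n \<in> {n\<in>{2..d}. n dvd d}" for n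
  proof -
    obtain r where r: "d = n * r" using n by blast
    then have r1: "1 \<le> r" using d_pos by (cases r) auto
    have "card (commuting_tuples m n) \<le> 2 ^ r * q ^ N"
      by (rule le_if_mult_power_le[OF card_commuting_tuples[OF r r1] commuting_exponent_bound[OF r _ r1 m N] q0])
        (use n in auto)
    also have "r \<le> d" using r n by simp
    then have "2 ^ r * q ^ N \<le> 2 ^ d * q ^ N" by (rule pow)
    finally show ?thesis .
  qed
  let ?I = "\<Union>k\<in>{1..<d}. invariant_tuples m k"
  let ?C = "\<Union>n\<in>{n\<in>{2..d}. n dvd d}. commuting_tuples m n"
  have finI: "finite (invariant_tuples m k)" for k
    by (rule finite_subset[OF _ finite_lists_length_eq[OF finite_M, of m]])
      (auto simp: invariant_tuples_def)
  have "card ?I \<le> (\<Sum>k\<in>{1..<d}. card (invariant_tuples m k))" by (intro card_UN_le) simp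
  also have "\<dots> \<le> card {1..<d} * (2 ^ d * q ^ N)" by (rule sum_bounded_above[of _ _ "2 ^ d * q ^ N", simplified]) (use inv in auto)
  also have "\<dots> \<le> d * (2 ^ d * q ^ N)" by (intro mult_le_mono1) simp
  finally have I: "card ?I \<le> d * (2 ^ d * q ^ N)" .
  have "card {n\<in>{2..d}. n dvd d} \<le> card {1..d}" by (intro card_mono) auto
  then have c: "card {n\<in>{2..d}. n dvd d} \<le> d" by simp
  have "card ?C \<le> (\<Sum>n\<in>{n\<in>{2..d}. n dvd d}. card (commuting_tuples m n))" by (intro card_UN_le) simp
  also have "\<dots> \<le> (\<Sum>n\<in>{n\<in>{2..d}. n dvd d}. 2 ^ d * q ^ N)" by (intro sum_mono com)
  also have "\<dots> \<le> d * (2 ^ d * q ^ N)" using c by simp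
  finally have C: "card ?C \<le> d * (2 ^ d * q ^ N)" .
  have "card (nongenerating_tuples m) \<le> card (?I \<union> ?C)"
    using finI finite_commuting_tuples by (intro card_mono nongenerating_tuples_cases) auto
  also have "\<dots> \<le> card ?I + card ?C" by (rule card_Un_le)
  finally show ?thesis using I C by simp
qed

end

section \<open>From tuples to subspaces and polynomials\<close>

lemma prod_power_diff_factor:
  fixes q n k :: nat
  assumes "k \<le> n" "0 < q"
  shows "int (\<Prod>i<k. q ^ n - q ^ i) = (\<Prod>i<k. int q ^ i) * (\<Prod>i<k. int q ^ (n - i) - 1)"
proof -
  have "int (q ^ n - q ^ i) = int q ^ i * (int q ^ (n - i) - 1)" if "i < k" for i
  proof -
    have "q ^ i \<le> q ^ n" using that assms by (intro power_increasing) auto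
    then have "int (q ^ n - q ^ i) = int q ^ n - int q ^ i" by (simp add: of_nat_diff)
    moreover have "int q ^ n = int q ^ i * int q ^ (n - i)" using that assms by (simp flip: power_add)
    ultimately show ?thesis by (simp only: right_diff_distrib mult_1_right)
  qed
  then show ?thesis by (simp add: prod.distrib)
qed

text \<open>The hypothesis is the double count of subspaces and their ordered bases, and dividing by the powers of
\<open>q\<close> on both sides turns it into the defining equation of the Gaussian binomial coefficient.\<close>

lemma poly_gauss_binom_eqI:
  fixes c n m q :: nat
  assumes mn: "m \<le> n" and q: "2 \<le> q"
    and c: "c * (\<Prod>i<m. q ^ m - q ^ i) = (\<Prod>i<m. q ^ n - q ^ i)"
  shows "poly (gauss_binom n m) (int q) = int c"
proof -
  let ?g = "poly (gauss_binom n m) (int q)" and ?D = "\<Prod>i<m. int q ^ (m - i) - 1"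
  have q0: "0 < q" using q by simp
  have "poly (gauss_binom n m * (\<Prod>i<m. monom 1 (m - i) - 1)) (int q)
      = poly (\<Prod>i<m. monom 1 (n - i) - 1) (int q)"
    by (simp only: gauss_binom_mult_denom[OF mn])
  then have 1: "?g * ?D = (\<Prod>i<m. int q ^ (n - i) - 1)"
    by (simp add: poly_prod poly_monom)
  have "int c * int (\<Prod>i<m. q ^ m - q ^ i) = int (\<Prod>i<m. q ^ n - q ^ i)"
    by (simp only: c flip: of_nat_mult)
  then have "(\<Prod>i<m. int q ^ i) * (int c * ?D) = (\<Prod>i<m. int q ^ i) * (?g * ?D)"
    unfolding prod_power_diff_factor[OF order_refl q0] prod_power_diff_factor[OF mn q0] 1
    by (simp only: mult.left_commute)
  moreover have "(\<Prod>i<m. int q ^ i) \<noteq> 0" using q0 by simp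
  ultimately have "int c * ?D = ?g * ?D" by simp
  moreover have "?D \<noteq> 0"
  proof -
    have "int q ^ (m - i) \<noteq> 1" if "i < m" for i
    proof -
      have "1 < int q ^ (m - i)" using that q by (intro one_less_power) auto
      then show ?thesis by simp
    qed
    then show ?thesis by (simp add: prod_zero_iff)
  qed
  ultimately show ?thesis by simp
qed

context matrices_over_finite_field
begin

lemma card_subspaces_mult:
  "card {U. mat.S.submod U \<and> card U = q ^ m} * (\<Prod>i<m. q ^ m - q ^ i) = (\<Prod>i<m. q ^ d\<^sup>2 - q ^ i)"
proof -
  have "card (carrier M) = mat.S.Q ^ d\<^sup>2" using card_M mat.Q_scalars by (simp add: power2_eq_square)
  from mat.S.card_submods[OF this, of m] show ?thesis unfolding mat.Q_scalars .
qed

lemma proper_subalgebra_if_not_generating: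
  assumes "V \<subseteq> carrier M" "generated_subalgebra F M V \<noteq> carrier M"
  shows "\<exists>S. unital_subalgebra F S M \<and> S \<noteq> carrier M \<and> V \<subseteq> S"
proof (rule ccontr)
  assume "\<not> ?thesis"
  then have all: "S = carrier M" if "unital_subalgebra F S M" "V \<subseteq> S" for S using that by blast
  have "unital_subalgebra F (carrier M) M"
    unfolding unital_subalgebra_def using R.carrier_is_subring mat.smult_closed by blast
  then have "{S. unital_subalgebra F S M \<and> V \<subseteq> S} = {carrier M}" using all assms(1) by blast
  then show False using assms(2) by (simp add: generated_subalgebra_def)
qed

definition nongenerating_subspaces where
  "nongenerating_subspaces m = {V. mat.S.submod V \<and> card V = q ^ m \<and>
     generated_subalgebra F M V \<noteq> carrier M}"

lemma card_generating_subspaces: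
  "card (generating_subspaces F d m) + card (nongenerating_subspaces m)
    = card {U. mat.S.submod U \<and> card U = q ^ m}"
proof -
  have "generating_subspaces F d m
      = {V. mat.S.submod V \<and> card V = q ^ m \<and> generated_subalgebra F M V = carrier M}"
    unfolding generating_subspaces_def using mat.submod_iff_subspace mat.dim_eq_iff_card by blast
  moreover have "{U. mat.S.submod U \<and> card U = q ^ m}
      = {V. mat.S.submod V \<and> card V = q ^ m \<and> generated_subalgebra F M V = carrier M}
        \<union> nongenerating_subspaces m"
    by (auto simp: nongenerating_subspaces_def)
  moreover have "finite {V. mat.S.submod V \<and> P V}" for P
    by (rule finite_subset[OF _ mat.S.finite_submods]) blast
  ultimately show ?thesis
    by (simp add: card_Un_disjoint nongenerating_subspaces_def disjoint_iff)
qed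

text \<open>Every ordered basis of a non-generating subspace is a non-generating tuple, and a subspace of
dimension \<open>m\<close> has at least \<open>q ^ (m * m) / 2 ^ m\<close> of them.\<close>

lemma card_nongenerating_subspaces:
  "card (nongenerating_subspaces m) * q ^ (m * m) \<le> 2 ^ m * card (nongenerating_tuples m)"
proof -
  let ?P = "\<Prod>i<m. q ^ m - q ^ i"
  let ?B = "{vs. length vs = m \<and> mat.S.indep vs \<and> mat.S.sp vs \<in> nongenerating_subspaces m}"
  have "?B \<subseteq> nongenerating_tuples m"
  proof
    fix vs assume vs: "vs \<in> ?B"
    then have M: "set vs \<subseteq> carrier M" using mat.S.indep_carrier by blast
    then have sub: "set vs \<subseteq> mat.S.sp vs" "mat.S.sp vs \<subseteq> carrier M"
      using mat.S.set_subset_sp mat.S.submodD(1)[OF mat.S.submod_sp] by blast+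
    have "generated_subalgebra F M (mat.S.sp vs) \<noteq> carrier M"
      using vs by (simp add: nongenerating_subspaces_def)
    from proper_subalgebra_if_not_generating[OF sub(2) this]
    show "vs \<in> nongenerating_tuples m"
      using vs M sub(1) unfolding nongenerating_tuples_def by blast
  qed
  then have "card ?B \<le> card (nongenerating_tuples m)"
    by (rule card_mono[OF finite_nongenerating_tuples])
  moreover have "card (nongenerating_subspaces m) * ?P = card ?B"
    using mat.S.card_submods_mult[of "nongenerating_subspaces m" m]
    by (simp add: nongenerating_subspaces_def mat.Q_scalars)
  ultimately have P: "card (nongenerating_subspaces m) * ?P \<le> card (nongenerating_tuples m)" by simp
  have "q ^ (m * m) \<le> 2 ^ m * ?P"
    using mat.S.prod_diff_power_lower[of m m] by (simp add: mat.Q_scalars)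
  then have "card (nongenerating_subspaces m) * q ^ (m * m)
      \<le> card (nongenerating_subspaces m) * (2 ^ m * ?P)" by (rule mult_le_mono2)
  also have "\<dots> = 2 ^ m * (card (nongenerating_subspaces m) * ?P)" by (simp only: mult.left_commute)
  also have "\<dots> \<le> 2 ^ m * card (nongenerating_tuples m)" using P by (rule mult_le_mono2)
  finally show ?thesis .
qed

end

theorem proposition3p8:
  fixes d m :: nat and s r :: "int poly"
  assumes "1 \<le> d" and "m \<le> d\<^sup>2"
    and "is_s_poly d m s"
    and "r = gauss_binom (d\<^sup>2) m - s"
  shows "r \<noteq> 0 \<longrightarrow>
    int (degree r) \<le> int m * (int d ^ 2 - int m) - (int m - 1) * (int d - 1)"
proof
  assume r0: "r \<noteq> 0"
  \<comment> \<open>The exponent that bounds the number of tuples; it is kept apart from the \<open>m * m\<close> lost in passing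
  to subspaces because the difference may be negative.\<close>
  define N where "N = m * d * d - (m - 1) * (d - 1)"
  have "d - 1 \<le> d * d" using le_square[of d] by linarith
  then have "(m - 1) * (d - 1) \<le> m * (d * d)" by (intro mult_le_mono) simp_all
  then have N: "N + (m - 1) * (d - 1) = m * d * d" by (simp add: N_def mult.assoc)
  let ?C = "2 ^ m * (2 * d * 2 ^ d)"
  have "degree r + m * m \<le> N"
  proof (rule degree_le_if_bounded_at_primes[OF r0])
    fix p :: nat assume p: "Factorial_Ring.prime p"
    let ?F = "nat_mod_field p"
    have carrier: "carrier ?F = {..<p}" by (simp add: nat_mod_field_def)
    interpret matrices_over_finite_field ?F d
      using nat_mod_field[OF p] \<open>1 \<le> d\<close> carrier
      by (simp add: matrices_over_finite_field_def matrices_over_finite_field_axioms_def)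
    have q: "card (carrier ?F) = p" using carrier by simp
    have "poly s (int p) = int (card (generating_subspaces ?F d m))"
      using assms(3) nat_mod_field[OF p] carrier q unfolding is_s_poly_def by (metis finite_lessThan)
    then have rp: "poly r (int p) = int (card (nongenerating_subspaces m))"
      using poly_gauss_binom_eqI[OF assms(2) q_gt_1 card_subspaces_mult]
        card_generating_subspaces[of m] assms(4) q by simp
    have "card (nongenerating_subspaces m) * p ^ (m * m) \<le> 2 ^ m * card (nongenerating_tuples m)"
      using card_nongenerating_subspaces[of m] unfolding q .
    also have "\<dots> \<le> 2 ^ m * (2 * d * 2 ^ d * p ^ N)"
      using card_nongenerating_tuples[OF N] unfolding q by (rule mult_le_mono2)
    also have "\<dots> = ?C * p ^ N" by simp
    finally have "int (card (nongenerating_subspaces m) * p ^ (m * m)) \<le> int (?C * p ^ N)"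
      by (rule of_nat_mono)
    then show "0 \<le> poly r (int p) \<and> poly r (int p) * int p ^ (m * m) \<le> int ?C * int p ^ N"
      unfolding rp by simp
  qed
  then have "degree r + m * m + (m - 1) * (d - 1) \<le> m * d * d" using N by linarith
  then have le: "int (degree r) + int m * int m + int ((m - 1) * (d - 1)) \<le> int m * int d * int d"
    by (simp flip: of_nat_mult of_nat_add)
  have "(int m - 1) * (int d - 1) \<le> int ((m - 1) * (d - 1))"
    using \<open>1 \<le> d\<close> by (cases m) (auto simp: of_nat_diff)
  then show "int (degree r) \<le> int m * (int d ^ 2 - int m) - (int m - 1) * (int d - 1)"
    using le by (simp add: algebra_simps power2_eq_square)
qed

end
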